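(* Let $\Gamma=\Lambda\times\Gamma_t$ be a finitely generated abelian group ($\Lambda$ free of rank $n$, $\Gamma_t$ finite), $T=\mathrm{Hom}(\Gamma,\mathbb{C}^* )$, and $X$ a finite list of nonzero elements of $\Lambda$ spanning a sublattice of finite index in $\Lambda$. Let $\mathcal{R}_X=T\setminus\bigcup_{\chi\in X}H_\chi$ and let $P(q)$ be the Poincaré polynomial of $\mathcal{R}_X$. Then $$P(q)=q^nM_X\!\left(\frac{2q+1}{q},0\right).$$
   Context: Each $\chi\in\Lambda$ gives a character $t\mapsto t(\chi)$ of $T$, and $H_\chi=\{t\in T:t(\chi)=1\}$. The Poincaré polynomial is $P(q)=\sum_k b_k q^k$ with $b_k$ the $k$-th Betti number. Let $\pi:\Gamma\to\Lambda$ be the projection. For a sublist $A\subseteq X$: $r(A)$ is the dimension of the real span of $\pi(A)$, $\langle A\rangle$ the subgroup generated by $A$, $\Gamma_A=\pi^{-1}(\Lambda\cap\langle\pi(A)\rangle_{\mathbb{R}})$, $m(A)=[\Gamma_A:\langle A\rangle]$, and $M_X(x,y)=\sum_{A\subseteq X}m(A)(x-1)^{r(X)-r(A)}(y-1)^{|A|-r(A)}$. *)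

theory Defs
  imports "HOL-Analysis.Analysis" "HOL-Homology.Homology" "HOL-Algebra.Generated_Groups" "HOL-Algebra.Coset"
begin

definition Z_independent :: "('a, 'b) monoid_scheme \<Rightarrow> 'a set \<Rightarrow> bool" where
  "Z_independent H S \<longleftrightarrow>
     (\<forall>c :: 'a \<Rightarrow> int. finprod H (\<lambda>s. s [^]\<^bsub>H\<^esub> c s) S = \<one>\<^bsub>H\<^esub> \<longrightarrow> (\<forall>s\<in>S. c s = 0))"

definition group_rank :: "('a, 'b) monoid_scheme \<Rightarrow> nat" where
  "group_rank H = Sup {card S | S. S \<subseteq> carrier H \<and> finite S \<and> Z_independent H S}"

definition betti :: "nat \<Rightarrow> 'a topology \<Rightarrow> nat" where
  "betti k X = group_rank (homology_group (int k) X)"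

definition Lat :: "(int ^ 'n) monoid" where
  "Lat = \<lparr>carrier = UNIV, monoid.mult = (+), one = 0\<rparr>"

definition Gam :: "('g, 'b) monoid_scheme \<Rightarrow> ((int ^ 'n) \<times> 'g) monoid" where
  "Gam G = Lat \<times>\<times> G"

definition incl :: "('g, 'b) monoid_scheme \<Rightarrow> (int ^ 'n) \<Rightarrow> (int ^ 'n) \<times> 'g" where
  "incl G a = (a, \<one>\<^bsub>G\<^esub>)"

definition realv :: "int ^ 'n \<Rightarrow> real ^ 'n" where
  "realv l = (\<chi> i. real_of_int (l $ i))"

definition Cstar :: "complex monoid" where
  "Cstar = \<lparr>carrier = UNIV - {0}, monoid.mult = (*), one = 1\<rparr>"

text \<open>The torus T = Hom(Gamma, C^*) as a topological space (topology of pointwise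
  convergence, i.e. compact-open topology, Gamma being discrete).\<close>
definition torus_set :: "('g, 'b) monoid_scheme \<Rightarrow> ((int ^ 'n) \<times> 'g \<Rightarrow> complex) set" where
  "torus_set G = {t \<in> PiE (carrier (Gam G)) (\<lambda>_. UNIV). t \<in> hom (Gam G) Cstar}"

definition Hchi :: "('g, 'b) monoid_scheme \<Rightarrow> (int ^ 'n) \<Rightarrow> ((int ^ 'n) \<times> 'g \<Rightarrow> complex) set" where
  "Hchi G a = {t \<in> torus_set G. t (incl G a) = 1}"

definition complement :: "('g, 'b) monoid_scheme \<Rightarrow> (int ^ 'n) list \<Rightarrow> ((int ^ 'n) \<times> 'g \<Rightarrow> complex) set" where
  "complement G X = torus_set G - (\<Union>a\<in>set X. Hchi G a)"

definition complement_top :: "('g, 'b) monoid_scheme \<Rightarrow> (int ^ 'n) list \<Rightarrow> ((int ^ 'n) \<times> 'g \<Rightarrow> complex) topology" where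
  "complement_top G X =
     subtopology (product_topology (\<lambda>_. euclidean) (carrier (Gam G))) (complement G X)"

text \<open>A sublist of X is given by a set S of positions; its elements are X ! i, i in S.\<close>
definition sub :: "'a list \<Rightarrow> nat set \<Rightarrow> 'a set" where
  "sub X S = (\<lambda>i. X ! i) ` S"

definition rk :: "(int ^ 'n) set \<Rightarrow> nat" where
  "rk A = dim (realv ` A)"

definition GamA :: "('g, 'b) monoid_scheme \<Rightarrow> (int ^ 'n) set \<Rightarrow> ((int ^ 'n) \<times> 'g) set" where
  "GamA G A = {(l, g). realv l \<in> span (realv ` A) \<and> g \<in> carrier G}"

definition mult_A :: "('g, 'b) monoid_scheme \<Rightarrow> (int ^ 'n) set \<Rightarrow> nat" where
  "mult_A G A = card (rcosets\<^bsub>(Gam G)\<lparr>carrier := GamA G A\<rparr>\<^esub> (generate (Gam G) (incl G ` A)))"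

definition arith_tutte :: "('g, 'b) monoid_scheme \<Rightarrow> (int ^ 'n) list \<Rightarrow> real \<Rightarrow> real \<Rightarrow> real" where
  "arith_tutte G X x y =
     (\<Sum>S\<in>Pow {..<length X}. real (mult_A G (sub X S))
        * (x - 1) ^ (rk (set X) - rk (sub X S)) * (y - 1) ^ (card S - rk (sub X S)))"

end

theory Submission
  imports Defs "HOL-Computational_Algebra.Polynomial"
begin

text \<open>
Up to \<open>|\<Gamma>\<^sub>t|\<close> clopen copies, the torus is \<open>(\<complex>\<^sup>*)\<^sup>n\<close>. For a finite set \<open>B\<close> of characters let
\<open>K\<^sub>B\<close> be their common kernel and \<open>R(B, X)\<close> the complement in \<open>K\<^sub>B\<close> of the hypersurfaces of \<open>X\<close>, so that
\<open>R(B, v # X) = R(B, X) - R(B \<union> {v}, X)\<close>. If \<open>v\<close> has finite order on \<open>K\<^sub>B\<close>, this difference is clopen.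
Otherwise \<open>R(B \<union> {v}, X)\<close> has a tubular neighbourhood in \<open>R(B, X)\<close>, the Thom isomorphism identifies
\<open>H\<^sub>p(R(B, X), R(B, v # X))\<close> with \<open>H\<^sub>p\<^sub>-\<^sub>2(R(B \<union> {v}, X))\<close>, and the long exact sequence splits into short
ones because \<open>H\<^sub>p(R(B, v # X)) \<rightarrow> H\<^sub>p(R(B, X))\<close> is surjective. More generally, classes of \<open>R(B, X)\<close> can be moved
off any finite set \<open>E\<close> of further hypersurfaces: if \<open>X\<close> is empty, the compact torus is a deformation
retract, and it is translated off \<open>E\<close> by a generic real vector; for \<open>v # X\<close>, the image of a class in
\<open>R(B, X)\<close> can be moved, and what remains is the boundary of a tube around a class of
\<open>R(B \<union> {v}, X)\<close>, which can be moved as well.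

Hence the Poincare polynomial of \<open>R(B, X)\<close> is
\<open>\<Sum>\<^sub>A (-1)\<^bsup>|A|\<^esup> (-q)\<^bsup>r(B \<union> A) - r(B)\<^esup> P(K\<^bsub>B \<union> A\<^esub>)(q)\<close>, where \<open>K\<^bsub>B \<union> A\<^esub>\<close> is a union of \<open>m(B \<union> A)\<close> tori
of dimension \<open>n - r(B \<union> A)\<close>.
\<close>

section \<open>Ranks of abelian groups\<close>

text \<open>The theorem is the case \<open>B = {}\<close>; relations \<open>B\<close> are carried
  along because every deletion leads to an arrangement on a smaller kernel, in general a
  disconnected one. The main obstacle is surjectivity in homology, which has to be shown by honest
  homotopies. Lifting a class past \<open>v\<close> already means avoiding \<open>v\<close> together
  with \<open>E\<close>, hence the additional set \<open>E\<close>. But a character of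
  \<open>E\<close> that is independent of \<open>B\<close> may become one of finite order on the
  hypersurface of \<open>v\<close>; that hypersurface may then have components on which it is
  constantly 1, and nothing can be moved off them. The remedy is an exchange: such an
  \<open>e\<close> depends on \<open>B\<close> and \<open>v\<close>, so \<open>v\<close> has finite
  order on the hypersurface of \<open>e\<close>, and the part of the latter away from the former is
  closed. Only this part is removed from the space around the tube. The second obstacle is
  naturality. Thom isomorphisms for nested open sets must be compared, while their tubes have
  different widths; hence charts with a variable radius, compared up to homotopy. As homology is
  integral, Betti numbers are ranks, and additivity of ranks on short exact sequences is proved
  directly for abelian groups.\<close>

definition lc :: "('a, 'b) monoid_scheme \<Rightarrow> 'i set \<Rightarrow> ('i \<Rightarrow> 'a) \<Rightarrow> ('i \<Rightarrow> int) \<Rightarrow> 'a" where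
  "lc H I x c = finprod H (\<lambda>i. x i [^]\<^bsub>H\<^esub> c i) I"

text \<open>Families indexed by naturals rather than subsets, so that repeated members count: images
  under a non-injective map and combinations of combinations stay within the notion.\<close>

definition rank_le :: "('a, 'b) monoid_scheme \<Rightarrow> nat \<Rightarrow> bool" where
  "rank_le H r \<longleftrightarrow> (\<forall>(I :: nat set) x. finite I \<and> r < card I \<and> x \<in> I \<rightarrow> carrier H \<longrightarrow>
     (\<exists>c. (\<exists>i\<in>I. c i \<noteq> 0) \<and> lc H I x c = \<one>\<^bsub>H\<^esub>))"

definition rank_ge :: "('a, 'b) monoid_scheme \<Rightarrow> nat \<Rightarrow> bool" where
  "rank_ge H r \<longleftrightarrow> (\<exists>x :: nat \<Rightarrow> 'a. x \<in> {..<r} \<rightarrow> carrier H \<and>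
     (\<forall>c. lc H {..<r} x c = \<one>\<^bsub>H\<^esub> \<longrightarrow> (\<forall>i<r. c i = 0)))"

text \<open>\<open>Sup\<close> of an unbounded set of naturals carries no information, so a rank is
  certified by both bounds before \<open>group_rank\<close> is evaluated.\<close>

definition has_rank :: "('a, 'b) monoid_scheme \<Rightarrow> nat \<Rightarrow> bool" where
  "has_rank H r \<longleftrightarrow> rank_le H r \<and> rank_ge H r"

context comm_group
begin

lemma subgroup_imp_comm_group:
  assumes "subgroup K G"
  shows "comm_group (G\<lparr>carrier := K\<rparr>)"
  by (rule group.group_comm_groupI[OF subgroup_imp_group[OF assms]])
    (use subgroup.subset[OF assms] in \<open>auto intro: m_comm\<close>)

lemma lc_closed [simp]: "x \<in> I \<rightarrow> carrier G \<Longrightarrow> lc G I x c \<in> carrier G"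
  unfolding lc_def by (intro finprod_closed) auto

lemma lc_cong:
  "\<lbrakk>x \<in> I \<rightarrow> carrier G; \<And>i. i \<in> I \<Longrightarrow> x i = y i; \<And>i. i \<in> I \<Longrightarrow> c i = d i\<rbrakk> \<Longrightarrow> lc G I x c = lc G I y d"
  unfolding lc_def by (intro finprod_cong') (auto simp: Pi_def)

lemma lc_add: "x \<in> I \<rightarrow> carrier G \<Longrightarrow> lc G I x (\<lambda>i. c i + d i) = lc G I x c \<otimes> lc G I x d"
proof -
  assume x: "x \<in> I \<rightarrow> carrier G"
  have "lc G I x (\<lambda>i. c i + d i) = finprod G (\<lambda>i. x i [^] c i \<otimes> x i [^] d i) I"
    unfolding lc_def using x by (intro finprod_cong') (auto simp: int_pow_mult Pi_iff)
  also have "\<dots> = lc G I x c \<otimes> lc G I x d"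
    unfolding lc_def using x by (intro finprod_multf) auto
  finally show ?thesis .
qed

lemma lc_zero [simp]: "lc G I x (\<lambda>i. 0) = \<one>"
  unfolding lc_def by simp

lemma lc_insert:
  "\<lbrakk>finite I; i \<notin> I; x \<in> insert i I \<rightarrow> carrier G\<rbrakk> \<Longrightarrow> lc G (insert i I) x c = x i [^] c i \<otimes> lc G I x c"
  unfolding lc_def by (subst finprod_insert) auto

lemma lc_scale: "\<lbrakk>finite I; x \<in> I \<rightarrow> carrier G\<rbrakk> \<Longrightarrow> lc G I x (\<lambda>i. k * c i) = lc G I x c [^] (k :: int)"
proof (induction I rule: finite_induct)
  case empty
  then show ?case by (simp add: lc_def)
next
  case (insert i I)
  then show ?case
    by (auto simp: lc_insert int_pow_distrib int_pow_pow mult.commute)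
qed

lemma lc_lc:
  assumes "finite J" "finite I" "x \<in> I \<rightarrow> carrier G"
  shows "lc G J (\<lambda>j. lc G I x (C j)) d = lc G I x (\<lambda>i. \<Sum>j\<in>J. d j * C j i)"
  using assms(1)
proof (induction J rule: finite_induct)
  case empty
  then show ?case by (simp add: lc_def)
next
  case (insert j J)
  then show ?case using assms by (simp add: lc_insert lc_add lc_scale)
qed

lemma lc_mono:
  assumes "finite I" "I' \<subseteq> I" "x \<in> I \<rightarrow> carrier G" "\<And>i. i \<in> I - I' \<Longrightarrow> c i = 0"
  shows "lc G I' x c = lc G I x c"
  unfolding lc_def by (rule finprod_mono_neutral_cong_left) (use assms in auto)

lemma lc_reindex:
  assumes "inj_on h J" "x \<in> h ` J \<rightarrow> carrier G"
  shows "lc G (h ` J) x c = lc G J (x \<circ> h) (c \<circ> h)"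
  unfolding lc_def using assms by (subst finprod_reindex) (auto simp: Pi_def)

lemma lc_Un:
  assumes "finite I" "finite J" "I \<inter> J = {}" "x \<in> I \<union> J \<rightarrow> carrier G"
  shows "lc G (I \<union> J) x c = lc G I x c \<otimes> lc G J x c"
  unfolding lc_def using assms by (subst finprod_Un_disjoint) (auto simp: Pi_def)

lemma lc_hom:
  assumes "comm_group K" "f \<in> hom G K" "finite I" "x \<in> I \<rightarrow> carrier G"
  shows "f (lc G I x c) = lc K I (f \<circ> x) c"
  using assms(3,4)
proof (induction I rule: finite_induct)
  case empty
  have "f \<one> = \<one>\<^bsub>K\<^esub>"
    using assms(1,2) comm_group.axioms(2) group_axioms hom_one by blast
  then show ?case using assms(1) by (simp add: lc_def comm_monoid.finprod_empty comm_group.axioms(1))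
next
  case (insert i I)
  interpret K: comm_group K by fact
  have *: "f \<circ> x \<in> insert i I \<rightarrow> carrier K"
    using insert.prems assms(2) by (auto simp: hom_def Pi_def)
  have "f (x i [^] c i) = f (x i) [^]\<^bsub>K\<^esub> c i"
    using hom_int_pow[OF assms(2)] insert.prems by (simp add: K.is_group group_axioms)
  moreover have "f (x i [^] c i \<otimes> lc G I x c) = f (x i [^] c i) \<otimes>\<^bsub>K\<^esub> f (lc G I x c)"
    using insert.prems by (intro hom_mult[OF assms(2)]) auto
  ultimately show ?case
    using insert K.lc_insert[OF insert.hyps *] by (simp add: lc_insert o_def)
qed

lemma rank_ge_mono:
  assumes "rank_ge G r" "s \<le> r"
  shows "rank_ge G s"
proof -
  obtain x where x: "x \<in> {..<r} \<rightarrow> carrier G"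
    "\<And>c. lc G {..<r} x c = \<one> \<Longrightarrow> \<forall>i<r. c i = 0"
    using assms(1) unfolding rank_ge_def by blast
  have "\<forall>i<s. c i = 0" if "lc G {..<s} x c = \<one>" for c
  proof -
    have "lc G {..<s} x (\<lambda>i. if i < s then c i else 0) = lc G {..<r} x (\<lambda>i. if i < s then c i else 0)"
      by (rule lc_mono) (use assms(2) x(1) in auto)
    moreover have "lc G {..<s} x (\<lambda>i. if i < s then c i else 0) = lc G {..<s} x c"
      by (rule lc_cong) (use x(1) assms(2) in auto)
    ultimately have "lc G {..<r} x (\<lambda>i. if i < s then c i else 0) = \<one>"
      using that by metis
    from x(2)[OF this] show ?thesis using assms(2) by (metis order_less_le_trans)
  qed
  moreover have "x \<in> {..<s} \<rightarrow> carrier G" using x(1) assms(2) by auto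
  ultimately show ?thesis unfolding rank_ge_def by blast
qed

lemma rank_ge_if_independent:
  fixes I :: "'i set"
  assumes "finite I" "x \<in> I \<rightarrow> carrier G" "\<And>c. lc G I x c = \<one> \<Longrightarrow> \<forall>i\<in>I. c i = 0"
  shows "rank_ge G (card I)"
proof -
  obtain h where "bij_betw h {..<card I} I"
    using ex_bij_betw_nat_finite[OF assms(1)] by (auto simp: atLeast0LessThan)
  then have inj: "inj_on h {..<card I}" and im: "h ` {..<card I} = I" by (auto simp: bij_betw_def)
  have xh: "x \<circ> h \<in> {..<card I} \<rightarrow> carrier G"
  proof (rule Pi_I)
    fix k assume "k \<in> {..<card I}"
    then have "h k \<in> I" using im by blast
    then show "(x \<circ> h) k \<in> carrier G" using assms(2) by auto
  qed
  have "\<forall>i<card I. c i = 0" if c: "lc G {..<card I} (x \<circ> h) c = \<one>" for c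
  proof -
    define d where "d = c \<circ> inv_into {..<card I} h"
    have "lc G {..<card I} (x \<circ> h) (d \<circ> h) = lc G {..<card I} (x \<circ> h) c"
      by (rule lc_cong) (use xh inj in \<open>auto simp: d_def\<close>)
    then have "lc G I x d = \<one>"
      using lc_reindex[OF inj, of x d] c assms(2) im by simp
    then have "\<forall>i\<in>I. d i = 0" using assms(3) by blast
    then have "d (h i) = 0" if "i < card I" for i using im that by blast
    then show ?thesis using inj by (auto simp: d_def)
  qed
  then show ?thesis using xh unfolding rank_ge_def by blast
qed

lemma rank_ge_le:
  assumes "rank_ge G r" "rank_le G s"
  shows "r \<le> s"
proof (rule ccontr)
  assume "\<not> r \<le> s"
  moreover obtain x where x: "x \<in> {..<r} \<rightarrow> carrier G"
    "\<And>c. lc G {..<r} x c = \<one> \<Longrightarrow> \<forall>i<r. c i = 0"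
    using assms(1) unfolding rank_ge_def by blast
  ultimately show False
    using assms(2)[unfolded rank_le_def, rule_format, of "{..<r}" x] by auto
qed

lemma has_rank_unique: "has_rank G r \<Longrightarrow> has_rank G s \<Longrightarrow> r = s"
  unfolding has_rank_def by (meson rank_ge_le order_antisym)

lemma not_rank_le: "\<not> rank_le G r \<Longrightarrow> rank_ge G (Suc r)"
proof -
  assume "\<not> rank_le G r"
  then obtain I :: "nat set" and x where I: "finite I" "r < card I" "x \<in> I \<rightarrow> carrier G"
     and "\<not> (\<exists>c. (\<exists>i\<in>I. c i \<noteq> 0) \<and> lc G I x c = \<one>)"
    unfolding rank_le_def not_all not_imp by (elim exE conjE)
  then have "rank_ge G (card I)" by (intro rank_ge_if_independent) blast+
  then show ?thesis using I by (meson Suc_leI rank_ge_mono)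
qed

lemma ex_has_rank: "rank_le G r \<Longrightarrow> \<exists>s. has_rank G s"
proof -
  assume r: "rank_le G r"
  define s where "s = (LEAST s. rank_le G s)"
  have s: "rank_le G s" using r unfolding s_def by (rule LeastI)
  have "rank_ge G s"
  proof (cases s)
    case 0
    then show ?thesis unfolding rank_ge_def by auto
  next
    case (Suc m)
    then have "\<not> rank_le G m" using not_less_Least[of m "rank_le G"] s_def by auto
    then show ?thesis using Suc not_rank_le by auto
  qed
  then show ?thesis using s has_rank_def by blast
qed

lemma group_rank_eq:
  assumes "has_rank G r"
  shows "group_rank G = r"
  unfolding group_rank_def
proof (rule cSup_eq_maximum)
  have indep: "Z_independent G S \<longleftrightarrow> (\<forall>c. lc G S (\<lambda>s. s) c = \<one> \<longrightarrow> (\<forall>s\<in>S. c s = 0))" for S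
    unfolding Z_independent_def lc_def ..
  obtain x where x: "x \<in> {..<r} \<rightarrow> carrier G"
    "\<And>c. lc G {..<r} x c = \<one> \<Longrightarrow> \<forall>i<r. c i = 0"
    using assms unfolding has_rank_def rank_ge_def by blast
  have inj: "inj_on x {..<r}"
  proof (rule inj_onI, rule ccontr)
    fix i j assume ij: "i \<in> {..<r}" "j \<in> {..<r}" "x i = x j" "i \<noteq> j"
    \<comment> \<open>A repeated member would give a relation with coefficients 1 and -1; so an
      independent family is injective and its range is an independent set of the same size.\<close>
    define c where "c = (\<lambda>k. if k = i then 1 else if k = j then -1 else 0 :: int)"
    have "lc G {i, j} x c = lc G {..<r} x c"
      by (rule lc_mono) (use ij x(1) in \<open>auto simp: c_def\<close>)
    moreover have "lc G {i, j} x c = x i [^] (1::int) \<otimes> x j [^] (-1::int)"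
      using ij x(1) by (auto simp: lc_def c_def Pi_def)
    moreover have "\<dots> = \<one>" 
      using ij x(1) by (auto simp: int_pow_neg Pi_def)
    ultimately have "c i = 0" using x(2) ij by auto
    then show False by (simp add: c_def)
  qed
  have "\<forall>s\<in>x ` {..<r}. c s = 0" if "lc G (x ` {..<r}) (\<lambda>s. s) c = \<one>" for c
    using lc_reindex[OF inj, of "\<lambda>s. s" c] x that by (fastforce simp: o_def)
  then have "Z_independent G (x ` {..<r})" unfolding indep by blast
  moreover have "card (x ` {..<r}) = r" using inj by (simp add: card_image)
  moreover have "x ` {..<r} \<subseteq> carrier G" using x(1) by auto
  ultimately show "r \<in> {card S |S. S \<subseteq> carrier G \<and> finite S \<and> Z_independent G S}"
    by (intro CollectI exI[of _ "x ` {..<r}"]) simp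
  fix k assume "k \<in> {card S |S. S \<subseteq> carrier G \<and> finite S \<and> Z_independent G S}"
  then obtain S where "k = card S" "S \<subseteq> carrier G" "finite S" "Z_independent G S" by blast
  then have "rank_ge G k" using rank_ge_if_independent[of S "\<lambda>s. s"] unfolding indep by auto
  then show "k \<le> r" using rank_ge_le assms has_rank_def by blast
qed

end

text \<open>Each time an index where the last combination is nonzero is discarded, so that the coefficient
  matrix is triangular.\<close>

lemma independent_combinations:
  fixes P :: "(nat \<Rightarrow> int) \<Rightarrow> bool"
  assumes ex: "\<And>I. I \<subseteq> I0 \<Longrightarrow> b < card I \<Longrightarrow> \<exists>c. (\<exists>i\<in>I. c i \<noteq> 0) \<and> (\<forall>i. i \<notin> I \<longrightarrow> c i = 0) \<and> P c"
    and "I \<subseteq> I0" "finite I" "card I = b + m"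
  shows "\<exists>C. (\<forall>j<m. P (C j) \<and> (\<forall>i. i \<notin> I \<longrightarrow> C j i = 0)) \<and>
     (\<forall>d :: nat \<Rightarrow> int. (\<forall>i\<in>I. (\<Sum>j<m. d j * C j i) = 0) \<longrightarrow> (\<forall>j<m. d j = 0))"
  using assms(2-)
proof (induction m arbitrary: I)
  case 0
  then show ?case by auto
next
  case (Suc m)
  obtain c i where c: "i \<in> I" "c i \<noteq> 0" "\<forall>k. k \<notin> I \<longrightarrow> c k = 0" "P c"
    using ex[of I] Suc.prems by auto
  obtain C where C: "\<And>j. j < m \<Longrightarrow> P (C j) \<and> (\<forall>k. k \<notin> I - {i} \<longrightarrow> C j k = 0)"
    "\<And>d :: nat \<Rightarrow> int. (\<forall>k\<in>I-{i}. (\<Sum>j<m. d j * C j k) = 0) \<Longrightarrow> \<forall>j<m. d j = 0"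
  proof -
    have "I - {i} \<subseteq> I0" "finite (I - {i})" "card (I - {i}) = b + m"
      using Suc.prems c(1) by auto
    from Suc.IH[OF this] show ?thesis using that by blast
  qed
  let ?C = "C(m := c)"
  have "\<forall>j<Suc m. d j = 0" if d: "\<forall>k\<in>I. (\<Sum>j<Suc m. d j * ?C j k) = 0" for d :: "nat \<Rightarrow> int"
  proof -
    have *: "(\<Sum>j<Suc m. d j * ?C j k) = (\<Sum>j<m. d j * C j k) + d m * c k" for k
      by simp
    have "(\<Sum>j<m. d j * C j i) = 0" using C(1) by simp
    then have "d m = 0" using d[rule_format, OF c(1)] c(2) unfolding * by simp
    moreover from this have "\<forall>j<m. d j = 0" using d unfolding * by (intro C(2)) auto
    ultimately show ?thesis by (simp add: less_Suc_eq)
  qed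
  moreover have "\<forall>j<Suc m. P (?C j) \<and> (\<forall>k. k \<notin> I \<longrightarrow> ?C j k = 0)"
    using C(1) c by (auto simp: less_Suc_eq)
  ultimately show ?case by blast
qed

text \<open>Among \<open>a + b + 1\<close> elements there are enough dependencies modulo
  \<open>K\<close> for \<open>a + 1\<close> independent integer combinations to land in
  \<open>K\<close>. A dependency among these, pulled back through the coefficients, is a nontrivial
  relation among the original elements.\<close>

lemma rank_le_extension:
  assumes "comm_group H" "subgroup K H" "rank_le (H\<lparr>carrier := K\<rparr>) a"
    and "comm_group Q" "g \<in> hom H Q" "kernel H Q g = K" "rank_le Q b"
  shows "rank_le H (a + b)"
  unfolding rank_le_def
proof (intro allI impI)
  interpret H: comm_group H by fact
  interpret Q: comm_group Q by fact
  let ?K = "H\<lparr>carrier := K\<rparr>"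
  interpret K: comm_group ?K
    using H.subgroup_imp_comm_group[OF assms(2)] .
  fix I0 :: "nat set" and x
  assume *: "finite I0 \<and> a + b < card I0 \<and> x \<in> I0 \<rightarrow> carrier H"
  then obtain I where I: "I \<subseteq> I0" "card I = b + Suc a" "finite I"
  proof -
    have "b + Suc a \<le> card I0" using * by auto
    then show ?thesis using obtain_subset_with_card_n[of "b + Suc a" I0] that by metis
  qed
  have xI: "x \<in> I \<rightarrow> carrier H" using I * by auto
  have "\<exists>c. (\<exists>i\<in>J. c i \<noteq> 0) \<and> (\<forall>i. i \<notin> J \<longrightarrow> c i = 0) \<and> lc H I x c \<in> K"
    if J: "J \<subseteq> I" "b < card J" for J
  proof -
    have fin: "finite J" using J I finite_subset by blast
    moreover have xJ: "x \<in> J \<rightarrow> carrier H" using xI J by blast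
    moreover have "g \<circ> x \<in> J \<rightarrow> carrier Q"
      using xJ assms(5) by (auto simp: hom_def Pi_def)
    ultimately obtain c where c: "\<exists>i\<in>J. c i \<noteq> 0" "lc Q J (g \<circ> x) c = \<one>\<^bsub>Q\<^esub>"
      using assms(7)[unfolded rank_le_def, rule_format, of J "g \<circ> x"] J by auto
    \<comment> \<open>Padding by zero makes combinations over different \<open>J\<close> comparable
      as combinations over \<open>I\<close>.\<close>
    let ?c = "\<lambda>i. if i \<in> J then c i else 0"
    have "lc H J x c = lc H J x ?c" by (rule H.lc_cong[OF xJ]) auto
    also have "\<dots> = lc H I x ?c" by (rule H.lc_mono) (use I J xI in auto)
    finally have "lc H I x ?c = lc H J x c" ..
    moreover have "g (lc H J x c) = \<one>\<^bsub>Q\<^esub>"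
      using H.lc_hom[OF assms(4,5) fin xJ] c by simp
    ultimately have "lc H I x ?c \<in> K"
      using H.lc_closed[OF xJ] assms(6) by (auto simp: kernel_def)
    moreover have "\<exists>i\<in>J. ?c i \<noteq> 0" using c(1) by auto
    ultimately show ?thesis by (intro exI[of _ ?c]) auto
  qed
  then obtain C where C: "\<And>j. j < Suc a \<Longrightarrow> lc H I x (C j) \<in> K"
     and ind: "\<And>d :: nat \<Rightarrow> int. (\<forall>i\<in>I. (\<Sum>j<Suc a. d j * C j i) = 0) \<Longrightarrow> \<forall>j<Suc a. d j = 0"
    using independent_combinations[of I b "\<lambda>c. lc H I x c \<in> K" I "Suc a", OF _ subset_refl I(3,2)]
    by blast
  let ?y = "\<lambda>j. lc H I x (C j)"
  have y: "?y \<in> {..<Suc a} \<rightarrow> K" using C by auto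
  then obtain d where d: "\<exists>j\<in>{..<Suc a}. d j \<noteq> 0" "lc ?K {..<Suc a} ?y d = \<one>\<^bsub>?K\<^esub>"
    using assms(3)[unfolded rank_le_def, rule_format, of "{..<Suc a}" ?y] by auto
  have "id \<in> hom ?K H" using subgroup.subset[OF assms(2)] by (auto simp: hom_def)
  then have "lc ?K {..<Suc a} ?y d = lc H {..<Suc a} ?y d"
    using K.lc_hom[OF assms(1), of id "{..<Suc a}" ?y d] y by simp
  also have "\<dots> = lc H I x (\<lambda>i. \<Sum>j<Suc a. d j * C j i)"
    by (rule H.lc_lc) (use I xI in auto)
  also have "\<dots> = lc H I x (\<lambda>i. if i \<in> I then \<Sum>j<Suc a. d j * C j i else 0)"
    by (rule H.lc_cong) (use xI in auto)
  also have "\<dots> = lc H I0 x (\<lambda>i. if i \<in> I then \<Sum>j<Suc a. d j * C j i else 0)"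
    by (rule H.lc_mono) (use I * in auto)
  finally have "lc H I0 x (\<lambda>i. if i \<in> I then \<Sum>j<Suc a. d j * C j i else 0) = \<one>\<^bsub>H\<^esub>"
    using d(2) by simp
  moreover have "\<exists>i\<in>I0. (if i \<in> I then \<Sum>j<Suc a. d j * C j i else 0) \<noteq> 0"
  proof -
    obtain i where "i \<in> I" "(\<Sum>j<Suc a. d j * C j i) \<noteq> 0"
      using ind[of d] d(1) by blast
    then show ?thesis using I(1) by (intro bexI[of _ i]) auto
  qed
  ultimately show "\<exists>c. (\<exists>i\<in>I0. c i \<noteq> 0) \<and> lc H I0 x c = \<one>\<^bsub>H\<^esub>"
    by (intro exI conjI)
qed

text \<open>Independent elements of \<open>K\<close>, mapped by \<open>f\<close>, and lifts of
  independent elements of \<open>Q\<close> are jointly independent: applying \<open>g\<close> shows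
  that the coefficients of the lifts vanish, and injectivity of \<open>f\<close> then handles the
  others.\<close>

lemma rank_ge_extension:
  assumes "comm_group K" "comm_group H" "comm_group Q"
    and f: "f \<in> hom K H" "inj_on f (carrier K)"
    and g: "g \<in> hom H Q" "g ` carrier H = carrier Q"
    and gf: "\<And>x. x \<in> carrier K \<Longrightarrow> g (f x) = \<one>\<^bsub>Q\<^esub>"
    and "rank_ge K a" "rank_ge Q b"
  shows "rank_ge H (a + b)"
proof -
  interpret K: comm_group K by fact
  interpret H: comm_group H by fact
  interpret Q: comm_group Q by fact
  obtain x where x: "x \<in> {..<a} \<rightarrow> carrier K"
    "\<And>c. lc K {..<a} x c = \<one>\<^bsub>K\<^esub> \<Longrightarrow> \<forall>i<a. c i = 0"
    using \<open>rank_ge K a\<close> unfolding rank_ge_def by blast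
  obtain y where y: "y \<in> {..<b} \<rightarrow> carrier Q"
    "\<And>c. lc Q {..<b} y c = \<one>\<^bsub>Q\<^esub> \<Longrightarrow> \<forall>i<b. c i = 0"
    using \<open>rank_ge Q b\<close> unfolding rank_ge_def by blast
  define z where "z i = inv_into (carrier H) g (y i)" for i
  have z: "z i \<in> carrier H \<and> g (z i) = y i" if "i < b" for i
  proof -
    have "y i \<in> g ` carrier H" using y(1) g(2) that by auto
    then show ?thesis unfolding z_def by (simp add: inv_into_into f_inv_into_f)
  qed
  define w where "w = case_sum (f \<circ> x) z"
  \<comment> \<open>The sum type keeps the two index ranges disjoint.\<close>
  let ?A = "Inl ` {..<a} :: (nat + nat) set" and ?B = "Inr ` {..<b} :: (nat + nat) set"
  have w: "w \<in> ?A \<union> ?B \<rightarrow> carrier H"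
    using x(1) z f(1) by (auto simp: w_def hom_def Pi_def)
  have "rank_ge H (card (?A \<union> ?B))"
  proof (rule H.rank_ge_if_independent[of _ w])
    fix c assume c: "lc H (?A \<union> ?B) w c = \<one>\<^bsub>H\<^esub>"
    have "lc H ?A w c = lc H {..<a} (w \<circ> Inl) (c \<circ> Inl)"
      using w by (intro H.lc_reindex) auto
    also have "\<dots> = f (lc K {..<a} x (c \<circ> Inl))"
      using K.lc_hom[OF assms(2) f(1), of "{..<a}" x] x(1) by (simp add: w_def comp_def)
    finally have A: "lc H ?A w c = f (lc K {..<a} x (c \<circ> Inl))" .
    have "lc H ?B w c = lc H {..<b} z (c \<circ> Inr)"
      using w by (subst H.lc_reindex) (auto simp: w_def comp_def)
    then have "g (lc H ?B w c) = lc Q {..<b} (g \<circ> z) (c \<circ> Inr)"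
      using H.lc_hom[OF assms(3) g(1), of "{..<b}" z] z by auto
    also have "\<dots> = lc Q {..<b} y (c \<circ> Inr)"
      using z y(1) by (intro Q.lc_cong) auto
    finally have B: "g (lc H ?B w c) = lc Q {..<b} y (c \<circ> Inr)" .
    have AB: "lc H (?A \<union> ?B) w c = lc H ?A w c \<otimes>\<^bsub>H\<^esub> lc H ?B w c"
      using w by (intro H.lc_Un) auto
    have wAB: "lc H ?A w c \<in> carrier H" "lc H ?B w c \<in> carrier H"
      using w by (auto intro!: H.lc_closed)
    have "\<one>\<^bsub>Q\<^esub> = g (lc H ?A w c) \<otimes>\<^bsub>Q\<^esub> g (lc H ?B w c)"
      using hom_mult[OF g(1) wAB] AB c hom_one[OF g(1)] by simp
    also have "g (lc H ?A w c) = \<one>\<^bsub>Q\<^esub>"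
      unfolding A using x(1) by (intro gf K.lc_closed)
    finally have "lc Q {..<b} y (c \<circ> Inr) = \<one>\<^bsub>Q\<^esub>"
      using B y(1) by simp
    then have cB: "\<forall>i<b. c (Inr i) = 0" using y(2) by fastforce
    then have "lc H ?B w c = lc H ?B w (\<lambda>_. 0)"
      using w by (intro H.lc_cong) auto
    then have "f (lc K {..<a} x (c \<circ> Inl)) = f \<one>\<^bsub>K\<^esub>"
      using AB c A wAB hom_one[OF f(1)] by simp
    then have "lc K {..<a} x (c \<circ> Inl) = \<one>\<^bsub>K\<^esub>"
      using x(1) by (intro inj_onD[OF f(2)]) auto
    then have "\<forall>i<a. c (Inl i) = 0" using x(2) by fastforce
    then show "\<forall>i\<in>?A \<union> ?B. c i = 0" using cB by auto
  qed (use w in auto)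
  moreover have "card (?A \<union> ?B) = a + b"
    by (subst card_Un_disjoint) (auto simp: card_image)
  ultimately show ?thesis by simp
qed

lemma rank_le_hom:
  assumes "comm_group H" "comm_group Q" "g \<in> hom H Q" "g ` carrier H = carrier Q" "rank_le H c"
  shows "rank_le Q c"
  unfolding rank_le_def
proof (intro allI impI)
  interpret H: comm_group H by fact
  interpret Q: comm_group Q by fact
  fix I :: "nat set" and y assume *: "finite I \<and> c < card I \<and> y \<in> I \<rightarrow> carrier Q"
  define z where "z i = inv_into (carrier H) g (y i)" for i
  have z: "z i \<in> carrier H \<and> g (z i) = y i" if "i \<in> I" for i
  proof -
    have "y i \<in> g ` carrier H" using * assms(4) that by auto
    then show ?thesis unfolding z_def by (simp add: inv_into_into f_inv_into_f)
  qed
  then have zI: "z \<in> I \<rightarrow> carrier H" by auto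
  then obtain d where d: "\<exists>i\<in>I. d i \<noteq> 0" "lc H I z d = \<one>\<^bsub>H\<^esub>"
    using assms(5) * unfolding rank_le_def by metis
  have "lc Q I y d = lc Q I (g \<circ> z) d"
    by (rule Q.lc_cong) (use z * in auto)
  also have "\<dots> = g (lc H I z d)" using H.lc_hom[OF assms(2,3) _ zI] * by simp
  also have "\<dots> = \<one>\<^bsub>Q\<^esub>" using d hom_one[OF assms(3)] by simp
  finally show "\<exists>c. (\<exists>i\<in>I. c i \<noteq> 0) \<and> lc Q I y c = \<one>\<^bsub>Q\<^esub>" using d by blast
qed

lemma rank_le_inj_hom:
  assumes "comm_group K" "comm_group H" "f \<in> hom K H" "inj_on f (carrier K)" "rank_le H c"
  shows "rank_le K c"
  unfolding rank_le_def
proof (intro allI impI)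
  interpret K: comm_group K by fact
  interpret H: comm_group H by fact
  fix I :: "nat set" and x assume *: "finite I \<and> c < card I \<and> x \<in> I \<rightarrow> carrier K"
  then have "f \<circ> x \<in> I \<rightarrow> carrier H" using assms(3) by (auto simp: hom_def Pi_def)
  then obtain d where d: "\<exists>i\<in>I. d i \<noteq> 0" "lc H I (f \<circ> x) d = \<one>\<^bsub>H\<^esub>"
    using assms(5)[unfolded rank_le_def, rule_format, of I "f \<circ> x"] * by blast
  have "f (lc K I x d) = f \<one>\<^bsub>K\<^esub>" using K.lc_hom[OF assms(2,3), of I x d] * d hom_one[OF assms(3)] by simp
  then have "lc K I x d = \<one>\<^bsub>K\<^esub>"
    using * by (intro inj_onD[OF assms(4)]) auto
  then show "\<exists>c. (\<exists>i\<in>I. c i \<noteq> 0) \<and> lc K I x c = \<one>\<^bsub>K\<^esub>" using d by blast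
qed

section \<open>Ranks in short exact sequences\<close>

definition short_exact ::
  "('a, 'x) monoid_scheme \<Rightarrow> ('b, 'y) monoid_scheme \<Rightarrow> ('c, 'z) monoid_scheme \<Rightarrow> ('a \<Rightarrow> 'b) \<Rightarrow> ('b \<Rightarrow> 'c) \<Rightarrow> bool"
  where "short_exact K H Q f g \<longleftrightarrow> comm_group K \<and> comm_group H \<and> comm_group Q \<and>
    f \<in> hom K H \<and> inj_on f (carrier K) \<and> g \<in> hom H Q \<and> g ` carrier H = carrier Q \<and>
    kernel H Q g = f ` carrier K"

lemma has_rank_short_exact:
  assumes "short_exact K H Q f g" "has_rank K a" "has_rank Q b"
  shows "has_rank H (a + b)"
proof -
  interpret K: comm_group K using assms short_exact_def by blast
  interpret H: comm_group H using assms short_exact_def by blast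
  interpret Q: comm_group Q using assms short_exact_def by blast
  have f: "f \<in> hom K H" "inj_on f (carrier K)" and g: "g \<in> hom H Q" "g ` carrier H = carrier Q"
    and ker: "kernel H Q g = f ` carrier K"
    using assms(1) unfolding short_exact_def by simp_all
  have sub: "subgroup (f ` carrier K) H"
    by (metis K.is_group H.is_group f(1) group_hom.img_is_subgroup group_hom.intro group_hom_axioms.intro)
  let ?K = "H\<lparr>carrier := f ` carrier K\<rparr>"
  have "comm_group ?K" using H.subgroup_imp_comm_group[OF sub] .
  moreover have "f \<in> hom K ?K" "f ` carrier K = carrier ?K" using f by (auto simp: hom_def)
  ultimately have "rank_le ?K a"
    using rank_le_hom K.comm_group_axioms assms(2) has_rank_def by blast
  then have "rank_le H (a + b)"
    using rank_le_extension[OF H.comm_group_axioms sub _ Q.comm_group_axioms g(1) ker] assms(3)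
    unfolding has_rank_def by blast
  moreover have "rank_ge H (a + b)"
    using rank_ge_extension[OF K.comm_group_axioms H.comm_group_axioms Q.comm_group_axioms f g]
      assms(2,3) ker unfolding has_rank_def kernel_def by blast
  ultimately show ?thesis by (simp add: has_rank_def)
qed

text \<open>That \<open>Q\<close> has a finite rank at all is inherited from \<open>H\<close>
  through the surjection; additivity then determines it.\<close>

lemma has_rank_short_exact_quotient:
  assumes "short_exact K H Q f g" "has_rank K a" "has_rank H c"
  obtains b where "has_rank Q b" "c = a + b"
proof -
  interpret H: comm_group H using assms short_exact_def by blast
  interpret Q: comm_group Q using assms short_exact_def by blast
  have "rank_le Q c"
    using rank_le_hom assms unfolding short_exact_def has_rank_def by metis
  then obtain b where "has_rank Q b" using Q.ex_has_rank by blast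
  then show ?thesis using that has_rank_short_exact[OF assms(1,2)] H.has_rank_unique assms(3) by blast
qed

lemma has_rank_iso:
  assumes "comm_group K" "comm_group H" "h \<in> iso K H" "has_rank K a"
  shows "has_rank H a"
proof -
  have h: "h \<in> hom K H" "inj_on h (carrier K)" "h ` carrier K = carrier H"
    using assms(3) by (auto simp: iso_def bij_betw_def)
  interpret K: comm_group K by fact
  interpret H: comm_group H by fact
  have "rank_le H a" using rank_le_hom[OF assms(1,2) h(1,3)] assms(4) by (simp add: has_rank_def)
  moreover obtain s where s: "has_rank H s" using calculation H.ex_has_rank by blast
  moreover have "rank_le K s" using rank_le_inj_hom[OF assms(1,2) h(1,2)] s by (simp add: has_rank_def)
  ultimately have "s = a"
    using assms(4) H.rank_ge_le K.rank_ge_le unfolding has_rank_def by (meson order_antisym)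
  then show ?thesis using s by simp
qed

lemma has_rank_trivial_group:
  assumes "comm_group H" "trivial_group H"
  shows "has_rank H 0"
proof -
  interpret comm_group H by fact
  have "lc H I x (\<lambda>_. 1) = \<one>\<^bsub>H\<^esub>" if "x \<in> I \<rightarrow> carrier H" for I :: "nat set" and x
    using lc_closed[OF that, of "\<lambda>_. 1"] assms(2) by (auto simp: trivial_group_def)
  then show ?thesis
    unfolding has_rank_def rank_le_def rank_ge_def
    by (auto intro!: exI[of _ "\<lambda>_. 1"] simp: card_gt_0_iff)
qed

lemma has_rank_integer_group: "has_rank integer_group 1"
proof -
  interpret Z: comm_group integer_group by (rule abelian_integer_group)
  have lc: "lc integer_group I x c = (\<Sum>i\<in>I. c i * x i)" if "finite I" for I :: "nat set" and x c
    using that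
  proof (induction I rule: finite_induct)
    case (insert i I)
    then show ?case by (subst Z.lc_insert) auto
  qed (simp add: lc_def)
  have "\<exists>c. (\<exists>i\<in>I. c i \<noteq> 0) \<and> lc integer_group I x c = 0" if I: "finite I" "1 < card I" for I :: "nat set" and x
  proof -
    obtain i j where ij: "i \<in> I" "j \<in> I" "i \<noteq> j"
      using I by (metis card_le_Suc0_iff_eq One_nat_def not_less)
    \<comment> \<open>Two integers are dependent through \<open>x j * x i - x i * x j = 0\<close>;
      when \<open>x i = 0\<close> these coefficients might both vanish, so \<open>x i\<close> alone
      supplies the relation.\<close>
    define c where "c = (if x i = 0 then (\<lambda>k. if k = i then 1 else 0)
      else (\<lambda>k. if k = i then x j else if k = j then - x i else 0))"
    have "(\<Sum>k\<in>I. c k * x k) = (\<Sum>k\<in>{i, j}. c k * x k)"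
      by (rule sum.mono_neutral_right) (use I ij in \<open>auto simp: c_def\<close>)
    then have "lc integer_group I x c = 0" using ij I by (simp add: lc c_def)
    moreover have "c i \<noteq> 0 \<or> c j \<noteq> 0" using ij(3) by (auto simp: c_def)
    ultimately show ?thesis using ij by blast
  qed
  then have "rank_le integer_group 1" by (auto simp: rank_le_def)
  moreover have "rank_ge integer_group 1"
    unfolding rank_ge_def by (intro exI[of _ "\<lambda>_. 1"]) (auto simp: lc)
  ultimately show ?thesis by (simp add: has_rank_def)
qed

section \<open>Homology of pairs and the Thom isomorphism\<close>

abbreviation tp :: "'a::topological_space set \<Rightarrow> 'a topology" where
  "tp A \<equiv> top_of_set A"

abbreviation hm :: "int \<Rightarrow> 'a::topological_space set \<Rightarrow> 'a set \<Rightarrow> 'a chain set monoid" where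
  "hm p A S \<equiv> relative_homology_group p (top_of_set A) S"

definition inc :: "int \<Rightarrow> 'a::topological_space set \<Rightarrow> 'a set \<Rightarrow> 'a set \<Rightarrow> 'a set \<Rightarrow> 'a chain set \<Rightarrow> 'a chain set" where
  "inc p A S B T = hom_induced p (top_of_set A) S (top_of_set B) T id"

definition inc_surj :: "int \<Rightarrow> 'a::topological_space set \<Rightarrow> 'a set \<Rightarrow> 'a set \<Rightarrow> 'a set \<Rightarrow> bool" where
  "inc_surj p A S B T \<longleftrightarrow> inc p A S B T ` carrier (hm p A S) = carrier (hm p B T)"

lemma inc_hom: "inc p A S B T \<in> hom (hm p A S) (hm p B T)"
  unfolding inc_def by (rule hom_induced_hom)

lemma inc_closed [simp]: "inc p A S B T x \<in> carrier (hm p B T)"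
  unfolding inc_def by (rule hom_induced_carrier)

lemma inc_compose:
  assumes "A \<subseteq> B" "B \<subseteq> C" "S \<subseteq> T" "T \<subseteq> U"
  shows "inc p B T C U (inc p A S B T x) = inc p A S C U x"
  unfolding inc_def using assms
  by (subst hom_induced_compose') (auto simp: continuous_map_in_subtopology)

lemma hom_induced_inc:
  assumes "continuous_on B f" "f ` B \<subseteq> C" "A \<subseteq> B" "S \<subseteq> T" "f ` T \<subseteq> U"
  shows "hom_induced p (tp B) T (tp C) U f (inc p A S B T x) = hom_induced p (tp A) S (tp C) U f x"
  unfolding inc_def using assms
  by (subst hom_induced_compose') (auto simp: continuous_map_in_subtopology)

lemma inc_hom_induced:
  assumes "continuous_on A f" "f ` A \<subseteq> B" "B \<subseteq> C" "f ` S \<subseteq> T" "T \<subseteq> U"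
  shows "inc p B T C U (hom_induced p (tp A) S (tp B) T f x) = hom_induced p (tp A) S (tp C) U f x"
  unfolding inc_def using assms
  by (subst hom_induced_compose') (auto simp: continuous_map_in_subtopology)

lemma inc_surjI:
  assumes "\<And>y. y \<in> carrier (hm p B T) \<Longrightarrow> \<exists>x\<in>carrier (hm p A S). inc p A S B T x = y"
  shows "inc_surj p A S B T"
  unfolding inc_surj_def using assms by fastforce

lemma inc_surjD:
  assumes "inc_surj p A S B T" "y \<in> carrier (hm p B T)"
  obtains x where "x \<in> carrier (hm p A S)" "inc p A S B T x = y"
  using assms unfolding inc_surj_def by (metis imageE)

lemma subtopology_tp: "S \<subseteq> A \<Longrightarrow> subtopology (tp A) S = tp S"
  by (simp add: subtopology_subtopology inf.absorb2)

text \<open>The excised set is \<open>B - A\<close>: it is closed in \<open>B\<close> and lies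
  inside the open set \<open>T\<close> because \<open>A\<close> and \<open>T\<close> cover
  \<open>B\<close>.\<close>

lemma excision_iso:
  assumes "A \<subseteq> B" "S \<subseteq> T" "T \<subseteq> B" "openin (tp B) A" "openin (tp B) T" "A \<union> T = B" "S = A \<inter> T"
  shows "inc p A S B T \<in> iso (hm p A S) (hm p B T)"
proof -
  let ?X = "tp B"
  have "closedin ?X (B - A)" using assms(4) by (metis closedin_diff closedin_topspace topspace_euclidean_subtopology)
  then have "?X closure_of (B - A) = B - A" by (rule closure_of_closedin)
  moreover have "?X interior_of T = T" using assms(5) by (simp add: interior_of_openin)
  ultimately have *: "?X closure_of (B - A) \<subseteq> ?X interior_of T" using assms by auto
  have "subtopology ?X (B - (B - A)) = tp A" "subtopology ?X B = ?X" "T - (B - A) = S"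
    using assms by (auto simp: subtopology_tp double_diff)
  with homology_excision_axiom[OF * assms(3), of p] show ?thesis
    unfolding inc_def by simp
qed

lemma inc_exact_triple:
  assumes "T \<subseteq> S" "S \<subseteq> A"
  shows "kernel (hm p S T) (hm p A T) (inc p S T A T) = hom_relboundary (p + 1) (tp A) S T ` carrier (hm (p + 1) A S)"
    and "kernel (hm p A T) (hm p A S) (inc p A T A S) = inc p S T A T ` carrier (hm p S T)"
    and "kernel (hm p A S) (hm (p - 1) S T) (hom_relboundary p (tp A) S T) = inc p A T A S ` carrier (hm p A T)"
  using homology_exactness_triple_1[OF assms(1), of p "tp A"]
    homology_exactness_triple_2[OF assms(1), of "p + 1" "tp A"]
    homology_exactness_triple_3[OF assms(1), of p "tp A"] subtopology_tp[OF assms(2)]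
  unfolding inc_def by simp_all

lemma relboundary_hom:
  assumes "S \<subseteq> A"
  shows "hom_relboundary p (tp A) S T \<in> hom (hm p A S) (hm (p - 1) S T)"
  using group_homomorphism_hom_relboundary[of p "tp A" S T] subtopology_tp[OF assms] by simp

lemma relboundary_inc:
  assumes "A \<subseteq> B" "S \<subseteq> A" "S' \<subseteq> B" "S \<subseteq> S'" "T \<subseteq> T'"
  shows "hom_relboundary p (tp B) S' T' (inc p A S B S' x) = inc (p - 1) S T S' T' (hom_relboundary p (tp A) S T x)"
proof -
  have "hom_relboundary p (tp B) S' T' \<circ> inc p A S B S' = inc (p - 1) S T S' T' \<circ> hom_relboundary p (tp A) S T"
    unfolding inc_def using assms
    by (subst naturality_hom_induced_relboundary)
      (auto simp: continuous_map_in_subtopology subtopology_tp)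
  then show ?thesis by (metis comp_apply)
qed


lemma iso_imp_inj: "h \<in> iso G H \<Longrightarrow> inj_on h (carrier G)"
  and iso_imp_surj: "h \<in> iso G H \<Longrightarrow> h ` carrier G = carrier H"
  by (auto simp: iso_def bij_betw_def)

lemma hom_isoI: "\<lbrakk>h \<in> hom G H; inj_on h (carrier G); h ` carrier G = carrier H\<rbrakk> \<Longrightarrow> h \<in> iso G H"
  by (simp add: iso_def bij_betw_def)

lemma iso_cancel_right:
  assumes "f \<in> iso G H" "k \<in> iso G K" "h \<in> hom H K" "\<And>x. x \<in> carrier G \<Longrightarrow> h (f x) = k x"
  shows "h \<in> iso H K"
proof (rule hom_isoI[OF assms(3)])
  have f: "inj_on f (carrier G)" "f ` carrier G = carrier H" using assms(1) by (auto dest: iso_imp_inj iso_imp_surj)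
  have k: "inj_on k (carrier G)" "k ` carrier G = carrier K" using assms(2) by (auto dest: iso_imp_inj iso_imp_surj)
  show "inj_on h (carrier H)"
  proof (rule inj_onI)
    fix x y assume xy: "x \<in> carrier H" "y \<in> carrier H" "h x = h y"
    then obtain a b where "a \<in> carrier G" "b \<in> carrier G" "x = f a" "y = f b"
      using f(2) by blast
    then show "x = y" using xy(3) assms(4) inj_onD[OF k(1), of a b] by simp
  qed
  show "h ` carrier H = carrier K"
    unfolding f(2)[symmetric] k(2)[symmetric] image_image using assms(4) by auto
qed

text \<open>Transports surjectivity of inclusion maps along natural isomorphisms, both for the Thom
  isomorphism and for the passage to tubes.\<close>

lemma surj_square:
  assumes "h \<in> iso G G'" "k \<in> iso H H'" "f ` carrier G \<subseteq> carrier H"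
    and "\<And>x. x \<in> carrier G \<Longrightarrow> k (f x) = f' (h x)"
  shows "f ` carrier G = carrier H \<longleftrightarrow> f' ` carrier G' = carrier H'"
proof -
  have "f' ` carrier G' = k ` f ` carrier G"
    unfolding iso_imp_surj[OF assms(1), symmetric] image_image using assms(4) by auto
  then show ?thesis
    using iso_imp_surj[OF assms(2)] inj_on_image_eq_iff[OF iso_imp_inj[OF assms(2)] assms(3) subset_refl]
    by auto
qed

text \<open>In the exact sequence of the pair, injectivity one degree lower makes the boundary map
  vanish, and surjectivity in degree \<open>p\<close> makes the map from the homology of
  \<open>A\<close> vanish.\<close>

lemma relative_homology_trivial_if_inc_iso:
  assumes "S \<subseteq> A" "\<And>p. inc p S {} A {} \<in> iso (hm p S {}) (hm p A {})"
  shows "trivial_group (hm p A S)"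
proof -
  let ?d = "hom_relboundary p (tp A) S {}"
  interpret d: group_hom "hm p A S" "hm (p - 1) S {}" ?d
    using relboundary_hom[OF assms(1)] by (simp add: group_hom_def group_hom_axioms_def)
  have "x = \<one>\<^bsub>hm p A S\<^esub>" if x: "x \<in> carrier (hm p A S)" for x
  proof -
    interpret i: group_hom "hm (p-1) S {}" "hm (p-1) A {}" "inc (p-1) S {} A {}"
      using inc_hom by (simp add: group_hom_def group_hom_axioms_def)
    have "?d x \<in> kernel (hm (p-1) S {}) (hm (p-1) A {}) (inc (p-1) S {} A {})"
      using inc_exact_triple(1)[of "{}" S A "p-1"] assms(1) x by auto
    then have "?d x = \<one>\<^bsub>hm (p-1) S {}\<^esub>"
      using iso_imp_inj[OF assms(2)[of "p-1"]] i.inj_iff_trivial_ker by auto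
    then have "x \<in> inc p A {} A S ` carrier (hm p A {})"
      using inc_exact_triple(3)[of "{}" S A p] assms(1) x by (auto simp: kernel_def)
    then obtain y where y: "y \<in> carrier (hm p A {})" "x = inc p A {} A S y" by blast
    then have "y \<in> inc p S {} A {} ` carrier (hm p S {})"
      using iso_imp_surj[OF assms(2)[of p]] by simp
    then show ?thesis
      using inc_exact_triple(2)[of "{}" S A p] assms(1) y by (auto simp: kernel_def)
  qed
  then show ?thesis by (auto simp: trivial_group_def)
qed

text \<open>Exact sequence of the triple \<open>T\<close>, \<open>S\<close>, \<open>A\<close>: the
  homology of \<open>(A, T)\<close>, on both sides of the boundary map, is zero.\<close>

lemma relboundary_iso:
  assumes "T \<subseteq> S" "S \<subseteq> A" "\<And>p. trivial_group (hm p A T)"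
  shows "hom_relboundary p (tp A) S T \<in> iso (hm p A S) (hm (p - 1) S T)"
proof (rule hom_isoI[OF relboundary_hom[OF assms(2)]])
  let ?d = "hom_relboundary p (tp A) S T"
  interpret d: group_hom "hm p A S" "hm (p - 1) S T" ?d
    using relboundary_hom[OF assms(2)] by (simp add: group_hom_def group_hom_axioms_def)
  interpret i: group_hom "hm p A T" "hm p A S" "inc p A T A S"
    using inc_hom by (simp add: group_hom_def group_hom_axioms_def)
  have "kernel (hm p A S) (hm (p - 1) S T) ?d = {\<one>\<^bsub>hm p A S\<^esub>}"
    using inc_exact_triple(3)[OF assms(1,2), of p] assms(3)[of p] by (simp add: trivial_group_def)
  then show "inj_on ?d (carrier (hm p A S))" using d.inj_iff_trivial_ker by blast
  have "?d ` carrier (hm p A S) = kernel (hm (p-1) S T) (hm (p-1) A T) (inc (p-1) S T A T)"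
    using inc_exact_triple(1)[OF assms(1,2), of "p-1"] by simp
  also have "\<dots> = carrier (hm (p-1) S T)"
    using assms(3)[of "p-1"] inc_closed[of "p-1" S T A T] by (auto simp: kernel_def trivial_group_def)
  finally show "?d ` carrier (hm p A S) = carrier (hm (p-1) S T)" .
qed

section \<open>Products with star-shaped sets and the natural Thom isomorphism\<close>

definition starlike_at :: "'a::real_vector \<Rightarrow> 'a set \<Rightarrow> bool" where
  "starlike_at c S \<longleftrightarrow> c \<in> S \<and> (\<forall>x\<in>S. closed_segment c x \<subseteq> S)"

lemma starlike_at_convex: "convex S \<Longrightarrow> c \<in> S \<Longrightarrow> starlike_at c S"
  unfolding starlike_at_def by (simp add: closed_segment_subset)

lemma slice_iso:
  fixes Y :: "'a::topological_space set" and S :: "'b::real_normed_vector set"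
  assumes "starlike_at c S"
  shows "hom_induced p (tp Y) {} (tp (Y \<times> S)) {} (\<lambda>y. (y, c)) \<in> iso (hm p Y {}) (hm p (Y \<times> S) {})"
proof (rule homotopy_equivalence_homology_group_isomorphism[where g = fst])
  have c: "c \<in> S" and seg: "\<And>x. x \<in> S \<Longrightarrow> closed_segment c x \<subseteq> S"
    using assms by (auto simp: starlike_at_def)
  show "continuous_map (tp Y) (tp (Y \<times> S)) (\<lambda>y. (y, c))"
    using c by (auto simp: continuous_map_in_subtopology intro!: continuous_intros)
  show "continuous_map (tp (Y \<times> S)) (tp Y) fst"
    by (auto simp: continuous_map_in_subtopology intro!: continuous_intros)
  show "homotopic_with (\<lambda>h. True) (tp Y) (tp Y) (fst \<circ> (\<lambda>y. (y, c))) id"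
    by (rule homotopic_with_equal) (auto simp: continuous_map_in_subtopology intro!: continuous_intros)
  have "homotopic_with_canon (\<lambda>h. True) (Y \<times> S) (Y \<times> S) ((\<lambda>y. (y, c)) \<circ> fst) id"
  proof -
    let ?h = "\<lambda>(t::real, z::'a \<times> 'b). (fst z, (1 - t) *\<^sub>R c + t *\<^sub>R snd z)"
    have "continuous_on ({0..1} \<times> (Y \<times> S)) ?h"
      unfolding case_prod_unfold by (intro continuous_intros)
    moreover have "?h ` ({0..1} \<times> (Y \<times> S)) \<subseteq> Y \<times> S"
      using seg by (force simp: closed_segment_def)
    ultimately show "homotopic_with (\<lambda>h. True) (tp (Y \<times> S)) (tp (Y \<times> S)) ((\<lambda>y. (y, c)) \<circ> fst) id"
      by (intro homotopic_with[THEN iffD2] exI[of _ ?h]) (auto simp: o_def)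
  qed
  then show "homotopic_with (\<lambda>k. True) (tp (Y \<times> S)) (tp (Y \<times> S)) ((\<lambda>y. (y, c)) \<circ> fst) id" .
qed

text \<open>Both products retract onto the same slice over \<open>c\<close>. Star-shapedness about a
  named point is used because the slit plane in the Thom isomorphism is not convex, and nested sets
  have to share their centre.\<close>

lemma starlike_inc_iso:
  fixes Y :: "'a::topological_space set" and S :: "'b::real_normed_vector set"
  assumes "starlike_at c S" "starlike_at c S'" "S \<subseteq> S'"
  shows "inc p (Y \<times> S) {} (Y \<times> S') {} \<in> iso (hm p (Y \<times> S) {}) (hm p (Y \<times> S') {})"
proof (rule iso_cancel_right[OF slice_iso[OF assms(1)] slice_iso[OF assms(2)] inc_hom])
  fix x
  show "inc p (Y \<times> S) {} (Y \<times> S') {} (hom_induced p (tp Y) {} (tp (Y \<times> S)) {} (\<lambda>y. (y, c)) x) =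
      hom_induced p (tp Y) {} (tp (Y \<times> S')) {} (\<lambda>y. (y, c)) x"
    by (rule inc_hom_induced) (use assms in \<open>auto simp: starlike_at_def intro!: continuous_intros\<close>)
qed

text \<open>One isomorphism for each subspace \<open>Y\<close> of a fixed type, natural for
  inclusions. Naturality is what later moves surjectivity from a hypersurface to its tube. The
  \<open>itself\<close> argument records the type of \<open>Y\<close>, which the other arguments do
  not mention.\<close>

definition shift_iso ::
    "'a::topological_space itself \<Rightarrow> int \<Rightarrow> complex set \<Rightarrow> complex set \<Rightarrow> int \<Rightarrow> complex set \<Rightarrow> complex set \<Rightarrow> bool" where
  "shift_iso _ p L M p' L' M' \<longleftrightarrow> (\<exists>\<phi>.
     (\<forall>Y :: 'a set. \<phi> Y \<in> iso (hm p (Y \<times> L) (Y \<times> M)) (hm p' (Y \<times> L') (Y \<times> M'))) \<and>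
     (\<forall>(Y :: 'a set) Z. \<forall>x\<in>carrier (hm p (Z \<times> L) (Z \<times> M)). Z \<subseteq> Y \<longrightarrow>
        \<phi> Y (inc p (Z \<times> L) (Z \<times> M) (Y \<times> L) (Y \<times> M) x) =
        inc p' (Z \<times> L') (Z \<times> M') (Y \<times> L') (Y \<times> M') (\<phi> Z x)))"

lemma shift_iso_sym:
  assumes "shift_iso TYPE('a::topological_space) p L M p' L' M'"
  shows "shift_iso TYPE('a) p' L' M' p L M"
proof -
  obtain \<phi> where iso: "\<And>Y :: 'a set. \<phi> Y \<in> iso (hm p (Y \<times> L) (Y \<times> M)) (hm p' (Y \<times> L') (Y \<times> M'))"
    and nat: "\<And>(Y :: 'a set) Z x. x\<in>carrier (hm p (Z \<times> L) (Z \<times> M)) \<Longrightarrow> Z \<subseteq> Y \<Longrightarrow>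
        \<phi> Y (inc p (Z \<times> L) (Z \<times> M) (Y \<times> L) (Y \<times> M) x) =
        inc p' (Z \<times> L') (Z \<times> M') (Y \<times> L') (Y \<times> M') (\<phi> Z x)"
    using assms unfolding shift_iso_def by (elim exE conjE) (rule that, blast+)
  let ?\<psi> = "\<lambda>Y. inv_into (carrier (hm p (Y \<times> L) (Y \<times> M))) (\<phi> Y)"
  have "?\<psi> Y \<in> iso (hm p' (Y \<times> L') (Y \<times> M')) (hm p (Y \<times> L) (Y \<times> M))" for Y
    by (intro group.iso_set_sym iso) simp
  moreover have "?\<psi> Y (inc p' (Z \<times> L') (Z \<times> M') (Y \<times> L') (Y \<times> M') x) =
      inc p (Z \<times> L) (Z \<times> M) (Y \<times> L) (Y \<times> M) (?\<psi> Z x)"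
    if x: "x \<in> carrier (hm p' (Z \<times> L') (Z \<times> M'))" "Z \<subseteq> Y" for Y Z x
  proof -
    obtain y where y: "y \<in> carrier (hm p (Z \<times> L) (Z \<times> M))" "x = \<phi> Z y"
      using x(1) iso_imp_surj[OF iso[of Z]] by blast
    then show ?thesis
      using nat[OF y(1) x(2), symmetric] iso_imp_inj[OF iso[of Z]] iso_imp_inj[OF iso[of Y]]
      by (simp add: inv_into_f_f)
  qed
  ultimately show ?thesis unfolding shift_iso_def by (intro exI[of _ ?\<psi>]) blast
qed

lemma shift_iso_trans:
  assumes "shift_iso TYPE('a::topological_space) p L M p' L' M'" "shift_iso TYPE('a) p' L' M' p'' L'' M''"
  shows "shift_iso TYPE('a) p L M p'' L'' M''"
proof -
  obtain \<phi> where 1: "\<And>Y :: 'a set. \<phi> Y \<in> iso (hm p (Y \<times> L) (Y \<times> M)) (hm p' (Y \<times> L') (Y \<times> M'))"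
    "\<And>(Y :: 'a set) Z x. x\<in>carrier (hm p (Z \<times> L) (Z \<times> M)) \<Longrightarrow> Z \<subseteq> Y \<Longrightarrow>
        \<phi> Y (inc p (Z \<times> L) (Z \<times> M) (Y \<times> L) (Y \<times> M) x) =
        inc p' (Z \<times> L') (Z \<times> M') (Y \<times> L') (Y \<times> M') (\<phi> Z x)"
    using assms(1) unfolding shift_iso_def by (elim exE conjE) (rule that, blast+)
  obtain \<psi> where 2: "\<And>Y :: 'a set. \<psi> Y \<in> iso (hm p' (Y \<times> L') (Y \<times> M')) (hm p'' (Y \<times> L'') (Y \<times> M''))"
    "\<And>(Y :: 'a set) Z x. x\<in>carrier (hm p' (Z \<times> L') (Z \<times> M')) \<Longrightarrow> Z \<subseteq> Y \<Longrightarrow>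
        \<psi> Y (inc p' (Z \<times> L') (Z \<times> M') (Y \<times> L') (Y \<times> M') x) =
        inc p'' (Z \<times> L'') (Z \<times> M'') (Y \<times> L'') (Y \<times> M'') (\<psi> Z x)"
    using assms(2) unfolding shift_iso_def by (elim exE conjE) (rule that, blast+)
  have "\<psi> Y \<circ> \<phi> Y \<in> iso (hm p (Y \<times> L) (Y \<times> M)) (hm p'' (Y \<times> L'') (Y \<times> M''))" for Y
    using iso_set_trans 1(1) 2(1) by blast
  moreover have "\<phi> Z x \<in> carrier (hm p' (Z \<times> L') (Z \<times> M'))" if "x \<in> carrier (hm p (Z \<times> L) (Z \<times> M))" for Z x
    using iso_imp_surj[OF 1(1)[of Z]] that by blast
  ultimately show ?thesis
    unfolding shift_iso_def using 1(2) 2(2) by (intro exI[of _ "\<lambda>Y. \<psi> Y \<circ> \<phi> Y"]) simp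
qed

lemma shift_iso_excision:
  assumes "openin (tp L') L" "openin (tp L') M'" "L \<union> M' = L'" "M = L \<inter> M'"
  shows "shift_iso TYPE('a::topological_space) p L M p L' M'"
proof -
  have "inc p (Y \<times> L) (Y \<times> M) (Y \<times> L') (Y \<times> M') \<in> iso (hm p (Y \<times> L) (Y \<times> M)) (hm p (Y \<times> L') (Y \<times> M'))"
    for Y :: "'a set"
    using assms by (intro excision_iso openin_Times) auto
  then show ?thesis
    unfolding shift_iso_def using assms
    by (intro exI[of _ "\<lambda>Y. inc p (Y \<times> L) (Y \<times> M) (Y \<times> L') (Y \<times> M')"])
      (auto simp: inc_compose Sigma_mono)
qed

lemma shift_iso_boundary:
  assumes "N \<subseteq> M" "M \<subseteq> L" "starlike_at c N" "starlike_at c L"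
  shows "shift_iso TYPE('a::topological_space) p L M (p - 1) M N"
proof -
  have "trivial_group (hm p (Y \<times> L) (Y \<times> N))" for Y :: "'a set" and p
    using assms by (intro relative_homology_trivial_if_inc_iso starlike_inc_iso[of c] Sigma_mono) auto
  then have "hom_relboundary p (tp (Y \<times> L)) (Y \<times> M) (Y \<times> N) \<in> iso (hm p (Y \<times> L) (Y \<times> M)) (hm (p-1) (Y \<times> M) (Y \<times> N))"
    for Y :: "'a set"
    using assms by (intro relboundary_iso Sigma_mono) auto
  then show ?thesis
    unfolding shift_iso_def using assms
    by (intro exI[of _ "\<lambda>Y. hom_relboundary p (tp (Y \<times> L)) (Y \<times> M) (Y \<times> N)"])
      (metis relboundary_inc Sigma_mono subset_refl)
qed

lemma shift_iso_starlike:
  assumes "starlike_at c L" "starlike_at c L'" "L \<subseteq> L'"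
  shows "shift_iso TYPE('a::topological_space) p L {} p L' {}"
  unfolding shift_iso_def using assms
  by (intro exI[of _ "\<lambda>Y. inc p (Y \<times> L) {} (Y \<times> L') {}"])
    (auto simp: inc_compose Sigma_mono intro!: starlike_inc_iso)

text \<open>The shift by two comes from two boundary isomorphisms joined by excisions. In the fibre
  the pairs are \<open>(UNIV, - {0})\<close>, \<open>(- {0}, ?N)\<close>, \<open>(?R, ?Q)\<close>,
  \<open>(?Q, ?M)\<close>, \<open>(?P, {})\<close> and finally a point of \<open>?P\<close>.\<close>

lemma thom_shift_iso: "shift_iso TYPE('a::topological_space) p UNIV (- {0}) (p - 2) {Complex 1 1} {}"
proof -
  \<comment> \<open>\<open>?N\<close> is the plane slit along the nonnegative reals, star-shaped
    about -1; \<open>?R\<close> is the open right half-plane, which the real axis cuts into the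
    quadrants \<open>?P\<close> and \<open>?M\<close>.\<close>
  let ?N = "{z::complex. Re z < 0 \<or> Im z \<noteq> 0}"
  let ?R = "{z. 0 < Re z}" and ?P = "{z. 0 < Re z \<and> 0 < Im z}" and ?M = "{z. 0 < Re z \<and> Im z < 0}"
  let ?Q = "{z. 0 < Re z \<and> Im z \<noteq> 0}"
  have op: "open ?N" "open ?R" "open ?P" "open ?M" "open ?Q"
    by (auto intro!: open_Collect_disj open_Collect_conj open_Collect_less open_Collect_neq continuous_intros)
  have "starlike_at (-1) ?N"
    unfolding starlike_at_def
  proof (intro conjI ballI subsetI)
    fix x y assume x: "x \<in> ?N" and y: "y \<in> closed_segment (-1) x"
    then obtain u where u: "0 \<le> u" "u \<le> 1" "y = (1 - u) *\<^sub>R (-1) + u *\<^sub>R x"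
      by (auto simp: closed_segment_def)
    show "y \<in> ?N"
    proof (cases "u = 0 \<or> Im x \<noteq> 0")
      case False
      then have "u * Re x < 0" using x u(1) by (simp add: mult_pos_neg)
      then show ?thesis using u by simp
    qed (use u in auto)
  qed simp
  then have "shift_iso TYPE('a) p UNIV (- {0}) (p - 1) (- {0}) ?N"
    by (intro shift_iso_boundary[of _ _ _ "-1"]) (auto intro: starlike_at_convex)
  moreover have "shift_iso TYPE('a) (p - 1) ?R ?Q (p - 1) (- {0}) ?N"
    using op by (intro shift_iso_excision open_openin_trans) (auto simp: complex_eq_iff)
  moreover have "shift_iso TYPE('a) (p - 1) ?R ?Q (p - 1 - 1) ?Q ?M"
  proof (rule shift_iso_boundary[of _ _ _ "Complex 1 (-1)"])
    have "convex ?M" "convex ?R"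
      using convex_halfspace_Re_gt[of 0] convex_halfspace_Im_lt[of 0]
      by (auto simp: Collect_conj_eq intro!: convex_Int)
    then show "starlike_at (Complex 1 (-1)) ?M" "starlike_at (Complex 1 (-1)) ?R"
      by (auto intro: starlike_at_convex)
  qed auto
  moreover have "shift_iso TYPE('a) (p - 1 - 1) ?P {} (p - 1 - 1) ?Q ?M"
    using op by (intro shift_iso_excision open_openin_trans) auto
  moreover have "shift_iso TYPE('a) (p - 1 - 1) {Complex 1 1} {} (p - 1 - 1) ?P {}"
  proof (rule shift_iso_starlike)
    have "convex ?P"
      using convex_halfspace_Re_gt[of 0] convex_halfspace_Im_gt[of 0]
      by (auto simp: Collect_conj_eq intro!: convex_Int)
    then show "starlike_at (Complex 1 1) ?P"
      by (auto intro: starlike_at_convex)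
  qed (auto simp: starlike_at_def)
  ultimately have "shift_iso TYPE('a) p UNIV (- {0}) (p - 1 - 1) {Complex 1 1} {}"
    by (meson shift_iso_sym shift_iso_trans)
  then show ?thesis by simp
qed


text \<open>Naturality of the zigzag makes the two surjectivity statements equivalent, once the
  fibre point \<open>Complex 1 1\<close> is forgotten.\<close>

lemma thom_naturality:
  fixes Y Z :: "'a::topological_space set"
  assumes "Z \<subseteq> Y"
  shows "inc_surj (p - 2) Z {} Y {} \<longleftrightarrow> inc_surj p (Z \<times> UNIV) (Z \<times> (- {0::complex})) (Y \<times> UNIV) (Y \<times> (- {0}))"
proof -
  let ?c = "Complex 1 1"
  obtain \<phi> where \<phi>: "\<And>Y :: 'a set. \<phi> Y \<in> iso (hm p (Y \<times> UNIV) (Y \<times> (-{0::complex}))) (hm (p - 2) (Y \<times> {?c}) (Y \<times> {}))"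
    "\<And>(Y :: 'a set) Z x. x\<in>carrier (hm p (Z \<times> UNIV) (Z \<times> (-{0::complex}))) \<Longrightarrow> Z \<subseteq> Y \<Longrightarrow>
        \<phi> Y (inc p (Z \<times> UNIV) (Z \<times> (-{0})) (Y \<times> UNIV) (Y \<times> (-{0})) x) =
        inc (p - 2) (Z \<times> {?c}) (Z \<times> {}) (Y \<times> {?c}) (Y \<times> {}) (\<phi> Z x)"
    using thom_shift_iso[where ?'a = 'a, of p] unfolding shift_iso_def by (elim exE conjE) (rule that, blast+)
  have "inc_surj p (Z \<times> UNIV) (Z \<times> (- {0::complex})) (Y \<times> UNIV) (Y \<times> (- {0})) \<longleftrightarrow>
      inc_surj (p - 2) (Z \<times> {?c}) {} (Y \<times> {?c}) {}"
  proof -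
    have "inc p (Z \<times> UNIV) (Z \<times> - {0::complex}) (Y \<times> UNIV) (Y \<times> - {0}) ` carrier (hm p (Z \<times> UNIV) (Z \<times> (-{0}))) =
        carrier (hm p (Y \<times> UNIV) (Y \<times> (-{0}))) \<longleftrightarrow>
      inc (p - 2) (Z \<times> {?c}) (Z \<times> {}) (Y \<times> {?c}) (Y \<times> {}) ` carrier (hm (p - 2) (Z \<times> {?c}) (Z \<times> {})) =
        carrier (hm (p - 2) (Y \<times> {?c}) (Y \<times> {}))"
      by (rule surj_square[where h = "\<phi> Z" and k = "\<phi> Y"]) (use \<phi> assms in auto)
    then show ?thesis unfolding inc_surj_def by simp
  qed
  moreover have "starlike_at ?c {?c}" by (simp add: starlike_at_def)
  note slice = slice_iso[OF this]
  have "hom_induced (p-2) (tp Y) {} (tp (Y \<times> {?c})) {} (\<lambda>y. (y, ?c)) (inc (p-2) Z {} Y {} x) =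
      inc (p-2) (Z \<times> {?c}) {} (Y \<times> {?c}) {} (hom_induced (p-2) (tp Z) {} (tp (Z \<times> {?c})) {} (\<lambda>y. (y, ?c)) x)" for x
  proof -
    have c: "continuous_on A (\<lambda>y. (y, ?c))" for A :: "'a set" by (intro continuous_intros)
    show ?thesis
      using assms hom_induced_inc[OF c, of Y "Y \<times> {?c}" Z "{}" "{}" "{}" "p - 2" x]
        inc_hom_induced[OF c, of Z "Z \<times> {?c}" "Y \<times> {?c}" "{}" "{}" "{}" "p - 2" x] by auto
  qed
  then have "inc_surj (p - 2) Z {} Y {} \<longleftrightarrow> inc_surj (p - 2) (Z \<times> {?c}) {} (Y \<times> {?c}) {}"
    unfolding inc_surj_def
    by (intro surj_square[OF slice[of "p - 2" Z] slice[of "p - 2" Y]]) auto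
  ultimately show ?thesis by blast
qed

lemma thom_iso:
  fixes Y :: "'a::topological_space set"
  shows "hm (p - 2) Y {} \<cong> hm p (Y \<times> UNIV) (Y \<times> (- {0::complex}))"
proof -
  let ?c = "Complex 1 1"
  obtain \<phi> where \<phi>: "\<phi> Y \<in> iso (hm p (Y \<times> UNIV) (Y \<times> (-{0::complex}))) (hm (p - 2) (Y \<times> {?c}) (Y \<times> {}))"
    using thom_shift_iso[where ?'a = 'a, of p] unfolding shift_iso_def by (elim exE conjE) (rule that, erule spec)
  have "starlike_at ?c {?c}" by (simp add: starlike_at_def)
  from slice_iso[OF this, of "p - 2" Y]
  have "hm (p - 2) Y {} \<cong> hm (p - 2) (Y \<times> {?c}) {}" by (auto simp: is_iso_def)
  also have "hm (p - 2) (Y \<times> {?c}) {} \<cong> hm p (Y \<times> UNIV) (Y \<times> (- {0::complex}))"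
    using group.iso_set_sym[OF _ \<phi>] by (auto simp: is_iso_def)
  finally show ?thesis .
qed

text \<open>A tubular neighbourhood of codimension two with trivialised normal bundle;
  \<open>\<psi>\<close> reads off base point and fibre coordinate. The radius 1 is a normalisation:
  inside an open \<open>A\<close> the tube is narrowed by a function of the base point.\<close>

locale tube =
  fixes K K' :: "'a::metric_space set" and \<phi> :: "'a \<times> complex \<Rightarrow> 'a" and \<psi> :: "'a \<Rightarrow> 'a \<times> complex"
  assumes \<phi>: "continuous_on (K' \<times> ball 0 1) \<phi>" "\<phi> ` (K' \<times> ball 0 1) \<subseteq> K"
    and open_tube: "openin (tp K) (\<phi> ` (K' \<times> ball 0 1))"
    and \<psi>: "continuous_on (\<phi> ` (K' \<times> ball 0 1)) \<psi>"
    and \<psi>\<phi>: "\<And>z. z \<in> K' \<times> ball 0 1 \<Longrightarrow> \<psi> (\<phi> z) = z"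
    and \<phi>0: "\<And>y. y \<in> K' \<Longrightarrow> \<phi> (y, 0) = y"
    and \<phi>_K': "\<And>y s. (y, s) \<in> K' \<times> ball 0 1 \<Longrightarrow> \<phi> (y, s) \<in> K' \<Longrightarrow> s = 0"
    and closed: "closedin (tp K) K'"
begin

text \<open>Distance from \<open>(y, 0)\<close> to the points that are outside the unit tube or
  mapped outside \<open>A\<close>. Being a distance it is continuous in \<open>y\<close>, it shrinks
  with \<open>A\<close>, and it is positive on \<open>A \<inter> K'\<close> for open
  \<open>A\<close>.\<close>

definition radius :: "'a set \<Rightarrow> 'a \<Rightarrow> real" where
  "radius A y = infdist (y, 0) (K' \<times> UNIV - {z \<in> K' \<times> ball 0 1. \<phi> z \<in> A})"

text \<open>The factor \<open>r y / (1 + norm s)\<close> compresses the whole plane onto the open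
  disc of radius \<open>r y\<close>, so that the domain is a product with the plane whatever the
  width of the tube.\<close>

definition chart :: "('a \<Rightarrow> real) \<Rightarrow> 'a \<times> complex \<Rightarrow> 'a" where
  "chart r = (\<lambda>(y, s). \<phi> (y, of_real (r y / (1 + norm s)) * s))"

lemma radius_mem:
  assumes "y \<in> K'" "norm s < radius A y"
  shows "norm s < 1" "\<phi> (y, s) \<in> A"
proof -
  let ?C = "K' \<times> UNIV - {z \<in> K' \<times> ball 0 1. \<phi> z \<in> A}"
  have "(y, s) \<notin> ?C"
  proof
    assume "(y, s) \<in> ?C"
    then have "infdist (y, 0) ?C \<le> dist (y, 0) (y, s)" by (rule infdist_le)
    then show False using assms(2) by (simp add: radius_def dist_Pair_Pair dist_norm)
  qed
  then show "norm s < 1" "\<phi> (y, s) \<in> A" using assms(1) by auto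
qed

lemma radius_pos:
  assumes "openin (tp K) A" "y \<in> A \<inter> K'"
  shows "0 < radius A y"
proof -
  let ?W = "{z \<in> K' \<times> ball 0 1. \<phi> z \<in> A}"
  have "openin (tp (K' \<times> ball 0 1)) ?W"
  proof -
    have "openin (tp (K' \<times> ball 0 1)) ((K' \<times> ball 0 1) \<inter> \<phi> -` A)"
      using \<phi> assms(1) by (intro continuous_openin_preimage) auto
    moreover have "(K' \<times> ball 0 1) \<inter> \<phi> -` A = ?W" by auto
    ultimately show ?thesis by simp
  qed
  moreover have "openin (tp (K' \<times> UNIV)) (K' \<times> ball 0 1)"
    by (intro openin_Times) auto
  ultimately have "openin (tp (K' \<times> UNIV)) ?W" by (rule openin_trans)
  then obtain e where "e > 0" and e: "\<And>z. z \<in> K' \<times> UNIV \<Longrightarrow> dist z (y, 0) < e \<Longrightarrow> z \<in> ?W"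
  proof -
    have "(y, 0) \<in> ?W" using assms(2) \<phi>0 by simp
    then show ?thesis
      using \<open>openin (tp (K' \<times> UNIV)) ?W\<close> that unfolding openin_euclidean_subtopology_iff by blast
  qed
  \<comment> \<open>Fibre coordinate 2 lies outside the unit tube, so the set is nonempty;
    \<open>infdist\<close> to the empty set would be 0.\<close>
  have "(y, 2) \<in> K' \<times> UNIV - ?W" using assms(2) by simp
  then have "K' \<times> UNIV - ?W \<noteq> {}" by blast
  moreover have "e \<le> dist (y, 0) z" if "z \<in> K' \<times> UNIV - ?W" for z
    using e[of z] that by (force simp: dist_commute)
  ultimately have "e \<le> radius A y"
    unfolding radius_def infdist_def by (auto intro!: cINF_greatest)
  then show ?thesis using \<open>e > 0\<close> by simp
qed

lemma radius_mono:
  assumes "A2 \<subseteq> A" "y \<in> K'"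
  shows "radius A2 y \<le> radius A y"
proof -
  have "(y, 2) \<in> K' \<times> UNIV - {z \<in> K' \<times> ball 0 1. \<phi> z \<in> A}" using assms by simp
  then have "K' \<times> UNIV - {z \<in> K' \<times> ball 0 1. \<phi> z \<in> A} \<noteq> {}" by blast
  then show ?thesis unfolding radius_def using assms by (intro infdist_mono) auto
qed

lemma continuous_on_radius: "continuous_on T (radius A)"
  unfolding radius_def by (intro continuous_intros)

lemma shrink_less:
  fixes s :: complex and r :: real
  assumes "0 < r"
  shows "norm (of_real (r / (1 + norm s)) * s) < r"
proof -
  have "r * norm s < r * (1 + norm s)" using assms by simp
  moreover have "1 + norm s > 0" by (simp add: add_pos_nonneg)
  ultimately have "r / (1 + norm s) * norm s < r" by (simp add: pos_divide_less_eq)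
  moreover have "\<bar>r / (1 + norm s)\<bar> = r / (1 + norm s)"
    using assms \<open>1 + norm s > 0\<close> by simp
  ultimately show ?thesis by (simp only: norm_mult norm_of_real)
qed

text \<open>The chart is a homeomorphism of the pair onto \<open>(N, N - K')\<close> for an open
  neighbourhood \<open>N\<close> of \<open>A \<inter> K'\<close> in \<open>A\<close>, and excision
  replaces \<open>N\<close> by \<open>A\<close>.\<close>

lemma chart_iso:
  assumes A: "openin (tp K) A"
  shows "hom_induced p (tp ((A \<inter> K') \<times> UNIV)) ((A \<inter> K') \<times> (- {0})) (tp A) (A - K') (chart (radius A))
     \<in> iso (hm p ((A \<inter> K') \<times> UNIV) ((A \<inter> K') \<times> (- {0}))) (hm p A (A - K'))"
proof -
  define Y where "Y = A \<inter> K'"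
  define r where "r = radius A"
  define V :: "('a \<times> complex) set" where "V = {z \<in> K' \<times> ball 0 1. fst z \<in> A \<and> norm (snd z) < r (fst z)}"
  define N where "N = \<phi> ` V"
  \<comment> \<open>Inverse of the chart: dividing by \<open>r - |s|\<close> undoes the compression
    by \<open>r / (1 + |s|)\<close>.\<close>
  define g where "g z = (fst (\<psi> z), snd (\<psi> z) / of_real (r (fst (\<psi> z)) - norm (snd (\<psi> z))))" for z
  have rpos: "0 < r y" if "y \<in> Y" for y
    using radius_pos[OF A] that by (simp add: r_def Y_def)
  have shrink: "(y, of_real (r y / (1 + norm s)) * s) \<in> V" if "y \<in> Y" for y s
    using shrink_less[OF rpos[OF that], of s] that radius_mem(1)[of y _ A]
    by (auto simp: V_def Y_def r_def)
  have NA: "N \<subseteq> A"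
    using radius_mem(2) by (auto simp: N_def V_def r_def)
  have NT: "N \<subseteq> \<phi> ` (K' \<times> ball 0 1)" by (auto simp: N_def V_def)
  have gchart: "g (chart r z) = z" and chartN: "chart r z \<in> N" if "z \<in> Y \<times> UNIV" for z :: "'a \<times> complex"
  proof -
    obtain y s where z: "z = (y, s)" by fastforce
    with that have "y \<in> Y" by simp
    note z = z this
    let ?s = "of_real (r y / (1 + norm s)) * s"
    have V: "(y, ?s) \<in> V" using shrink z by blast
    then show "chart r z \<in> N" by (auto simp: chart_def N_def z)
    have "(y, ?s) \<in> K' \<times> ball 0 1" using V by (simp add: V_def)
    then have *: "\<psi> (chart r z) = (y, ?s)" by (simp add: chart_def z \<psi>\<phi>)
    have "1 + norm s > 0" by (simp add: add_pos_nonneg)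
    moreover have "\<bar>r y / (1 + norm s)\<bar> = r y / (1 + norm s)"
      using rpos[OF z(2)] \<open>1 + norm s > 0\<close> by simp
    then have "norm ?s = r y / (1 + norm s) * norm s"
      by (simp only: norm_mult norm_of_real)
    ultimately have "r y - norm ?s = r y / (1 + norm s)"
      by (simp add: field_simps)
    moreover have "1 + complex_of_real (norm s) \<noteq> 0"
      using \<open>1 + norm s > 0\<close> by (metis of_real_1 of_real_add of_real_eq_0_iff less_irrefl)
    ultimately have "?s / of_real (r y - norm ?s) = s"
      using rpos[OF z(2)] by simp
    then show "g (chart r z) = z" unfolding g_def * using z by simp
  qed
  have chartg: "chart r (g z) = z" and gN: "g z \<in> Y \<times> UNIV" if zN: "z \<in> N" for z
  proof -
    obtain y s where z: "z = \<phi> (y, s)" "(y, s) \<in> V" using zN by (auto simp: N_def)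
    then have y: "y \<in> Y" and s: "norm s < r y" by (auto simp: V_def Y_def)
    have \<psi>z: "\<psi> z = (y, s)" using z by (simp add: V_def \<psi>\<phi>)
    then show "g z \<in> Y \<times> UNIV" using y by (simp add: g_def)
    let ?t = "s / of_real (r y - norm s)"
    have "norm ?t = norm s / \<bar>r y - norm s\<bar>" by (simp only: norm_divide norm_of_real)
    then have "norm ?t = norm s / (r y - norm s)" using s by simp
    then have "1 + norm ?t = r y / (r y - norm s)" using s by (simp add: field_simps)
    then have "of_real (r y / (1 + norm ?t)) * ?t = s" using s rpos[OF y] by simp
    moreover have "g z = (y, ?t)" by (simp add: g_def \<psi>z)
    ultimately show "chart r (g z) = z" unfolding z(1) chart_def by (simp only: prod.case)
  qed
  have cont_chart: "continuous_on (Y \<times> UNIV) (chart r)"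
    unfolding chart_def case_prod_unfold
  proof (rule continuous_on_compose2[OF \<phi>(1)])
    have "1 + norm (snd x) \<noteq> 0" for x :: "'a \<times> complex"
      by (metis add_pos_nonneg less_irrefl norm_ge_zero zero_less_one)
    then show "continuous_on (Y \<times> UNIV) (\<lambda>x. (fst x, complex_of_real (r (fst x) / (1 + norm (snd x))) * snd x))"
      unfolding r_def by (intro continuous_intros continuous_on_compose2[OF continuous_on_radius]) auto
    show "(\<lambda>x. (fst x, complex_of_real (r (fst x) / (1 + norm (snd x))) * snd x)) ` (Y \<times> UNIV) \<subseteq> K' \<times> ball 0 1"
      using shrink by (auto simp: V_def)
  qed
  have cont_g: "continuous_on N g"
  proof -
    have \<psi>N: "continuous_on N \<psi>" using \<psi> NT continuous_on_subset by blast
    moreover have "r (fst (\<psi> z)) - norm (snd (\<psi> z)) \<noteq> 0" if "z \<in> N" for z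
      using that by (auto simp: N_def V_def \<psi>\<phi>)
    ultimately show ?thesis
      unfolding g_def r_def
      by (intro continuous_intros continuous_on_compose2[OF continuous_on_radius[of UNIV]]) auto
  qed
  have homeo: "homeomorphic_maps (tp (Y \<times> UNIV)) (tp N) (chart r) g"
    unfolding homeomorphic_maps_def
    using gchart chartN chartg gN cont_chart cont_g by (auto simp: continuous_map_in_subtopology)
  have chart_K': "chart r (y, s) \<in> K' \<longleftrightarrow> s = 0" if "y \<in> Y" for y s
  proof
    assume c: "chart r (y, s) \<in> K'"
    have "(y, of_real (r y / (1 + norm s)) * s) \<in> K' \<times> ball 0 1"
      using shrink[OF that, of s] by (simp add: V_def)
    then have "of_real (r y / (1 + norm s)) * s = 0"
      by (rule \<phi>_K') (use c in \<open>simp add: chart_def\<close>)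
    moreover have "1 + norm s > 0" by (simp add: add_pos_nonneg)
    then have "1 + complex_of_real (norm s) \<noteq> 0"
      by (metis of_real_1 of_real_add of_real_eq_0_iff less_irrefl)
    ultimately show "s = 0" using rpos[OF that] by simp
  next
    assume "s = 0"
    then show "chart r (y, s) \<in> K'" using that \<phi>0 by (simp add: chart_def Y_def)
  qed
  have "chart r ` (Y \<times> (-{0})) \<subseteq> N - K'" using chartN chart_K' by auto
  moreover have "g ` (N - K') \<subseteq> Y \<times> (- {0})"
  proof (rule image_subsetI)
    fix z assume "z \<in> N - K'"
    then have z: "z \<in> N" "z \<notin> K'" by auto
    then obtain y s where ys: "g z = (y, s)" "y \<in> Y" using gN[of z] by (cases "g z") auto
    then have "chart r (y, s) = z" using chartg[OF z(1)] by simp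
    then show "g z \<in> Y \<times> (- {0})" using chart_K'[OF ys(2), of s] z ys by auto
  qed
  ultimately have "chart r ` (Y \<times> (-{0})) = N - K'"
    using chartg by force
  then have iso1: "hom_induced p (tp (Y \<times> UNIV)) (Y \<times> (- {0})) (tp N) (N - K') (chart r) \<in>
      iso (hm p (Y \<times> UNIV) (Y \<times> (- {0}))) (hm p N (N - K'))"
    using homeo by (intro homeomorphic_map_relative_homology_iso) (auto simp: homeomorphic_map_maps)
  have "openin (tp (K' \<times> ball 0 1)) V"
  proof -
    have "openin (tp (K' \<times> ball 0 1)) ((K' \<times> ball 0 1) \<inter> (\<lambda>z. norm (snd z) - radius A (fst z)) -` {..<0})"
      by (intro continuous_openin_preimage_gen continuous_intros continuous_on_compose2[OF continuous_on_radius[of UNIV]]) auto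
    moreover have "openin (tp K') (K' \<inter> A)"
    proof -
      have "K' \<subseteq> K" using closed closedin_imp_subset by blast
      moreover obtain T where "open T" "A = K \<inter> T" using A by (auto simp: openin_open)
      ultimately have "K' \<inter> A = K' \<inter> T" by blast
      then show ?thesis using \<open>open T\<close> by (simp add: openin_open_Int)
    qed
    then have "openin (tp (K' \<times> ball 0 1)) ((K' \<inter> A) \<times> ball 0 1)"
      by (intro openin_Times) auto
    ultimately have "openin (tp (K' \<times> ball 0 1)) (((K' \<inter> A) \<times> ball 0 1) \<inter> ((K' \<times> ball 0 1) \<inter> (\<lambda>z. norm (snd z) - radius A (fst z)) -` {..<0}))"
      by (rule openin_Int[rotated])
    also have "\<dots> = V" by (auto simp: V_def r_def)
    finally show ?thesis .
  qed
  then have "openin (tp (\<phi> ` (K' \<times> ball 0 1))) (\<phi> ` (K' \<times> ball 0 1) \<inter> \<psi> -` V)"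
    by (rule continuous_openin_preimage[OF \<psi>, rotated]) (auto simp: \<psi>\<phi>)
  moreover have "\<phi> ` (K' \<times> ball 0 1) \<inter> \<psi> -` V = N"
    by (auto simp: N_def V_def \<psi>\<phi>)
  ultimately have "openin (tp K) N" using open_tube openin_trans by metis
  then have "openin (tp A) N"
    using NA openin_subset_trans[of K N A] openin_imp_subset[OF A] by simp
  moreover have "openin (tp A) (A - K')"
  proof -
    obtain T where T: "closed T" "K' = K \<inter> T" using closed unfolding closedin_closed by blast
    moreover have "A \<subseteq> K" using A openin_imp_subset by blast
    ultimately have "A - K' = A \<inter> - T" by blast
    moreover have "open (- T)" using T(1) by (simp add: open_Compl)
    ultimately show ?thesis by (simp add: openin_open_Int)
  qed
  moreover have "Y \<subseteq> N"
  proof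
    fix y assume y: "y \<in> Y"
    then have "(y, 0) \<in> V" using rpos[OF y] by (simp add: V_def Y_def)
    then have "\<phi> (y, 0) \<in> N" unfolding N_def by (rule imageI)
    then show "y \<in> N" using \<phi>0 y by (simp add: Y_def)
  qed
  ultimately have iso2: "inc p N (N - K') A (A - K') \<in> iso (hm p N (N - K')) (hm p A (A - K'))"
    using NA by (intro excision_iso) (auto simp: Y_def)
  have "inc p N (N - K') A (A - K') \<circ> hom_induced p (tp (Y \<times> UNIV)) (Y \<times> (- {0})) (tp N) (N - K') (chart r)
      = hom_induced p (tp (Y \<times> UNIV)) (Y \<times> (- {0})) (tp A) (A - K') (chart r)"
    unfolding comp_def
  proof (rule ext, rule inc_hom_induced[OF cont_chart])
    show "chart r ` (Y \<times> UNIV) \<subseteq> N" using chartN by blast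
    show "chart r ` (Y \<times> - {0}) \<subseteq> N - K'" using chartN chart_K' by auto
  qed (use NA in auto)
  then show ?thesis
    using iso_set_trans[OF iso1 iso2] unfolding Y_def[symmetric] r_def[symmetric] by simp
qed

text \<open>The two charts differ only in their radii, which are interpolated linearly. The
  interpolated radius is positive and at most that of \<open>A\<close>; this keeps the image in
  \<open>A\<close> and points with nonzero fibre coordinate off \<open>K'\<close>.\<close>

lemma chart_homotopic:
  assumes A: "openin (tp K) A" and A2: "openin (tp K) A2" "A2 \<subseteq> A"
    and "Y2 = A2 \<inter> K'"
  shows "homotopic_with (\<lambda>h. h \<in> Y2 \<times> (-{0}) \<rightarrow> A - K') (tp (Y2 \<times> UNIV)) (tp A) (chart (radius A2)) (chart (radius A))"
proof -
  let ?n = "\<lambda>s::complex. 1 + norm s"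
  define F where "F = (\<lambda>(t, y, s). \<phi> (y, of_real (((1 - t) * radius A2 y + t * radius A y) / ?n s) * s))"
  have npos: "0 < ?n s" for s by (simp add: add_pos_nonneg)
  have mem: "norm (of_real (((1 - t) * radius A2 y + t * radius A y) / ?n s) * s) < radius A y"
    and pos: "0 < (1 - t) * radius A2 y + t * radius A y"
    if "y \<in> Y2" "0 \<le> t" "t \<le> 1" for t y and s :: complex
  proof -
    have y: "y \<in> K'" "y \<in> A2 \<inter> K'" using that assms by auto
    let ?r = "(1 - t) * radius A2 y + t * radius A y"
    have r2: "0 < radius A2 y" "radius A2 y \<le> radius A y"
      using radius_pos[OF A2(1) y(2)] radius_mono[OF A2(2) y(1)] by auto
    have "?r = radius A2 y + t * (radius A y - radius A2 y)" by (simp add: algebra_simps)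
    then show *: "0 < ?r" using r2 that by (simp add: add_pos_nonneg)
    have "?r = radius A y - (1 - t) * (radius A y - radius A2 y)" by (simp add: algebra_simps)
    then have "?r \<le> radius A y" using r2 that by simp
    then show "norm (of_real (?r / ?n s) * s) < radius A y"
      using shrink_less[OF *, of s] by simp
  qed
  have cont: "continuous_on ({0..1} \<times> (Y2 \<times> UNIV)) F"
    unfolding F_def case_prod_unfold
  proof (rule continuous_on_compose2[OF \<phi>(1)])
    have "1 + norm (snd (snd x)) \<noteq> 0" for x :: "real \<times> 'a \<times> complex"
      using npos[of "snd (snd x)"] by simp
    then show "continuous_on ({0..1} \<times> (Y2 \<times> UNIV)) (\<lambda>x. (fst (snd x), of_real (((1 - fst x) * radius A2 (fst (snd x))
        + fst x * radius A (fst (snd x))) / ?n (snd (snd x))) * snd (snd x)))"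
      by (intro continuous_intros continuous_on_compose2[OF continuous_on_radius[of UNIV]]) auto
    show "(\<lambda>x. (fst (snd x), of_real (((1 - fst x) * radius A2 (fst (snd x))
        + fst x * radius A (fst (snd x))) / ?n (snd (snd x))) * snd (snd x))) ` ({0..1} \<times> (Y2 \<times> UNIV)) \<subseteq> K' \<times> ball 0 1"
      using mem radius_mem(1) assms(4) by fastforce
  qed
  show ?thesis
    unfolding homotopic_with_def
  proof (rule exI[of _ F])
    have "F z \<in> A" if "z \<in> {0..1} \<times> (Y2 \<times> UNIV)" for z
    proof -
      obtain t y s where z: "z = (t, y, s)" "y \<in> Y2" "0 \<le> t" "t \<le> 1"
        using \<open>z \<in> {0..1} \<times> (Y2 \<times> UNIV)\<close> by (cases z) auto
      have "\<phi> (y, of_real (((1 - t) * radius A2 y + t * radius A y) / ?n s) * s) \<in> A"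
        using mem[OF z(2-4)] z(2) assms(4) by (intro radius_mem(2)) auto
      then show ?thesis using z(1) by (simp add: F_def)
    qed
    then have "F ` ({0..1} \<times> (Y2 \<times> UNIV)) \<subseteq> A" by (rule image_subsetI)
    then have "continuous_map (tp ({0..1} \<times> (Y2 \<times> UNIV))) (tp A) F"
      using cont by (simp only: continuous_map_in_subtopology continuous_map_iff_continuous topspace_euclidean_subtopology image_subset_iff_funcset)
    then have "continuous_map (prod_topology (top_of_set {0..1}) (tp (Y2 \<times> UNIV))) (tp A) F"
      by (simp only: subtopology_Times[symmetric] prod_topology_euclidean)
    moreover have "\<forall>x. F (0, x) = chart (radius A2) x" "\<forall>x. F (1, x) = chart (radius A) x"
      by (simp_all add: chart_def F_def)
    moreover have "(\<lambda>z. F (t, z)) \<in> Y2 \<times> (-{0}) \<rightarrow> A - K'" if t: "t \<in> {0..1}" for t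
    proof (rule Pi_I)
      fix z :: "'a \<times> complex" assume "z \<in> Y2 \<times> (-{0})"
      then obtain y s where z: "z = (y, s)" and ys: "y \<in> Y2" "s \<noteq> 0" by auto
      let ?s = "of_real (((1 - t) * radius A2 y + t * radius A y) / ?n s) * s"
      have y: "y \<in> K'" using ys assms by auto
      have m: "norm ?s < radius A y" using mem[OF ys(1)] t by auto
      have "\<phi> (y, ?s) \<notin> K'"
      proof
        assume "\<phi> (y, ?s) \<in> K'"
        then have "?s = 0" using \<phi>_K'[of y ?s] radius_mem(1)[OF y m] y by auto
        moreover have "((1 - t) * radius A2 y + t * radius A y) / ?n s \<noteq> 0"
          using pos[OF ys(1), of t] t npos[of s] by auto
        ultimately show False using ys(2) by (simp only: mult_eq_0_iff of_real_eq_0_iff simp_thms)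
      qed
      then show "F (t, z) \<in> A - K'"
        using radius_mem(2)[OF y m] z by (simp add: F_def)
    qed
    ultimately show "continuous_map (prod_topology (top_of_set {0..1}) (tp (Y2 \<times> UNIV))) (tp A) F \<and>
         (\<forall>x. F (0, x) = chart (radius A2) x) \<and> (\<forall>x. F (1, x) = chart (radius A) x) \<and>
         (\<forall>t\<in>{0..1}. (\<lambda>x. F (t, x)) \<in> Y2 \<times> (-{0}) \<rightarrow> A - K')"
      by (intro conjI ballI)
  qed
qed

text \<open>The constant case \<open>A2 = A\<close> of the preceding homotopy.\<close>

lemma chart_continuous:
  assumes "openin (tp K) A" "Y = A \<inter> K'"
  shows "continuous_on (Y \<times> UNIV) (chart (radius A))" "chart (radius A) ` (Y \<times> UNIV) \<subseteq> A"
    "chart (radius A) ` (Y \<times> (-{0})) \<subseteq> A - K'"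
proof -
  note h = chart_homotopic[OF assms(1,1) subset_refl assms(2)]
  have "continuous_map (tp (Y \<times> UNIV)) (tp A) (chart (radius A))"
    using homotopic_with_imp_continuous_maps[OF h] by blast
  then show "continuous_on (Y \<times> UNIV) (chart (radius A))" "chart (radius A) ` (Y \<times> UNIV) \<subseteq> A"
    by (simp_all add: continuous_map_in_subtopology image_subset_iff_funcset)
  show "chart (radius A) ` (Y \<times> (-{0})) \<subseteq> A - K'"
    using homotopic_with_imp_property[OF h] by (simp add: image_subset_iff_funcset)
qed

text \<open>Restricting the chart of \<open>A\<close> does not give the chart of \<open>A2\<close>,
  whose tube may be narrower; the square commutes in homology because the two are homotopic as maps
  of pairs.\<close>

lemma chart_natural:
  assumes A: "openin (tp K) A" and A2: "openin (tp K) A2" "A2 \<subseteq> A"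
    and "Y = A \<inter> K'" "Y2 = A2 \<inter> K'"
  shows "hom_induced p (tp (Y \<times> UNIV)) (Y \<times> (- {0})) (tp A) (A - K') (chart (radius A))
       (inc p (Y2 \<times> UNIV) (Y2 \<times> (-{0})) (Y \<times> UNIV) (Y \<times> (-{0})) x)
    = inc p A2 (A2 - K') A (A - K')
       (hom_induced p (tp (Y2 \<times> UNIV)) (Y2 \<times> (- {0})) (tp A2) (A2 - K') (chart (radius A2)) x)"
proof -
  note c = chart_continuous[OF A assms(4)] and c2 = chart_continuous[OF A2(1) assms(5)]
  have Y2Y: "Y2 \<subseteq> Y" using assms by auto
  have "hom_induced p (tp (Y \<times> UNIV)) (Y \<times> (- {0})) (tp A) (A - K') (chart (radius A))
       (inc p (Y2 \<times> UNIV) (Y2 \<times> (-{0})) (Y \<times> UNIV) (Y \<times> (-{0})) x)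
     = hom_induced p (tp (Y2 \<times> UNIV)) (Y2 \<times> (- {0})) (tp A) (A - K') (chart (radius A)) x"
    using c Y2Y by (intro hom_induced_inc) auto
  also have "\<dots> = hom_induced p (tp (Y2 \<times> UNIV)) (Y2 \<times> (- {0})) (tp A) (A - K') (chart (radius A2)) x"
    using homology_homotopy_axiom[OF chart_homotopic[OF A A2 assms(5)]] by simp
  also have "\<dots> = inc p A2 (A2 - K') A (A - K')
       (hom_induced p (tp (Y2 \<times> UNIV)) (Y2 \<times> (- {0})) (tp A2) (A2 - K') (chart (radius A2)) x)"
    using c2 A2(2) by (intro inc_hom_induced[symmetric]) auto
  finally show ?thesis .
qed

lemma tube_thom_iso:
  assumes "openin (tp K) A"
  shows "hm (p - 2) (A \<inter> K') {} \<cong> hm p A (A - K')"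
  using iso_trans[OF thom_iso is_isoI[OF chart_iso[OF assms]]] .

text \<open>Relative classes of \<open>(A, A - K')\<close> are tubes over classes of
  \<open>A \<inter> K'\<close>; representing the latter inside \<open>A2\<close> represents the
  tubes there.\<close>

lemma tube_thom_surj:
  assumes "openin (tp K) A" "openin (tp K) A2" "A2 \<subseteq> A" "inc_surj (p - 2) (A2 \<inter> K') {} (A \<inter> K') {}"
  shows "inc_surj p A2 (A2 - K') A (A - K')"
proof -
  let ?Y = "A \<inter> K'" and ?Y2 = "A2 \<inter> K'"
  have "inc_surj p (?Y2 \<times> UNIV) (?Y2 \<times> (- {0::complex})) (?Y \<times> UNIV) (?Y \<times> (- {0}))"
    using assms by (subst thom_naturality[symmetric]) auto
  moreover have "inc p (?Y2 \<times> UNIV) (?Y2 \<times> (- {0::complex})) (?Y \<times> UNIV) (?Y \<times> (- {0})) `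
      carrier (hm p (?Y2 \<times> UNIV) (?Y2 \<times> (- {0::complex}))) = carrier (hm p (?Y \<times> UNIV) (?Y \<times> (- {0::complex}))) \<longleftrightarrow>
      inc p A2 (A2 - K') A (A - K') ` carrier (hm p A2 (A2 - K')) = carrier (hm p A (A - K'))"
    by (rule surj_square[OF chart_iso[OF assms(2)] chart_iso[OF assms(1)]])
      (use chart_natural[OF assms(1-3) refl refl] in auto)
  ultimately show ?thesis unfolding inc_surj_def by simp
qed

end

section \<open>Poincare polynomials\<close>

lemma inc_group_hom: "group_hom (hm p A S) (hm p B T) (inc p A S B T)"
  using inc_hom by (simp add: group_hom_def group_hom_axioms_def)

text \<open>If \<open>U\<close> carries all classes of \<open>A\<close>, the map from the homology
  of \<open>A\<close> to that of \<open>(A, U)\<close> is zero, and exactness leaves the boundary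
  map with trivial kernel.\<close>

lemma relboundary_inj_if_surj:
  assumes "U \<subseteq> A" "\<And>p. inc_surj p U {} A {}"
  shows "inj_on (hom_relboundary (p + 1) (tp A) U {}) (carrier (hm (p + 1) A U))"
proof -
  let ?d = "hom_relboundary (p + 1) (tp A) U {}"
  interpret d: group_hom "hm (p+1) A U" "hm (p + 1 - 1) U {}" ?d
    using relboundary_hom[OF assms(1), of "p + 1" "{}"] by (simp add: group_hom_def group_hom_axioms_def)
  interpret j: group_hom "hm (p+1) A {}" "hm (p+1) A U" "inc (p+1) A {} A U" by (rule inc_group_hom)
  have "inc (p+1) A {} A U ` carrier (hm (p+1) A {}) \<subseteq> {\<one>\<^bsub>hm (p+1) A U\<^esub>}"
  proof (rule image_subsetI)
    fix x assume "x \<in> carrier (hm (p+1) A {})"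
    then have "x \<in> inc (p+1) U {} A {} ` carrier (hm (p+1) U {})"
      using assms(2)[of "p+1"] by (simp add: inc_surj_def)
    then show "inc (p+1) A {} A U x \<in> {\<one>\<^bsub>hm (p+1) A U\<^esub>}"
      using inc_exact_triple(2)[of "{}" U A "p+1"] assms(1) by (auto simp: kernel_def)
  qed
  moreover have "\<one>\<^bsub>hm (p+1) A U\<^esub> \<in> inc (p+1) A {} A U ` carrier (hm (p+1) A {})"
    using j.hom_one by (metis image_eqI j.G.one_closed)
  ultimately have "kernel (hm (p+1) A U) (hm (p + 1 - 1) U {}) ?d = {\<one>\<^bsub>hm (p+1) A U\<^esub>}"
    using inc_exact_triple(3)[of "{}" U A "p+1"] assms(1) by auto
  then show ?thesis using d.inj_iff_trivial_ker by blast
qed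

lemma short_exact_if_surj:
  assumes "U \<subseteq> A" "\<And>p. inc_surj p U {} A {}"
  shows "short_exact (hm (p + 1) A U) (hm p U {}) (hm p A {}) (hom_relboundary (p + 1) (tp A) U {}) (inc p U {} A {})"
  unfolding short_exact_def
  using relboundary_hom[OF assms(1), of "p + 1" "{}"] inc_hom[of p U "{}" A "{}"] assms(2)[of p]
    relboundary_inj_if_surj[OF assms] inc_exact_triple(1)[of "{}" U A p] assms(1)
  by (simp add: inc_surj_def)

text \<open>The two lifting tasks are separated: absolute classes of \<open>A\<close> have to come
  from \<open>U2\<close>, while \<open>A2\<close> carries only the relative classes and may itself
  still meet the deleted hypersurface.\<close>

lemma inc_surj_deletion:
  assumes "U \<subseteq> A" "U2 \<subseteq> U" "A2 \<subseteq> A" "U2 \<subseteq> A2"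
    and lift: "inc_surj p U2 {} A {}" and rel: "inc_surj (p + 1) A2 U2 A U"
  shows "inc_surj p U2 {} U {}"
proof (rule inc_surjI)
  fix a assume a: "a \<in> carrier (hm p U {})"
  interpret H: comm_group "hm p U {}" by simp
  interpret i: group_hom "hm p U {}" "hm p A {}" "inc p U {} A {}" by (rule inc_group_hom)
  interpret i2: group_hom "hm p U2 {}" "hm p U {}" "inc p U2 {} U {}" by (rule inc_group_hom)
  obtain b where b: "b \<in> carrier (hm p U2 {})" "inc p U2 {} A {} b = inc p U {} A {} a"
    using inc_surjD[OF lift, of "inc p U {} A {} a"] by auto
  let ?b = "inc p U2 {} U {} b"
  have "inc p U {} A {} ?b = inc p U {} A {} a"
    using b(2) assms by (simp add: inc_compose)
  then have "a \<otimes>\<^bsub>hm p U {}\<^esub> inv\<^bsub>hm p U {}\<^esub> ?b \<in> kernel (hm p U {}) (hm p A {}) (inc p U {} A {})"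
    using a by (simp add: kernel_def i.hom_mult i.hom_inv)
  then obtain c where c: "c \<in> carrier (hm (p + 1) A U)"
    "a \<otimes>\<^bsub>hm p U {}\<^esub> inv\<^bsub>hm p U {}\<^esub> ?b = hom_relboundary (p + 1) (tp A) U {} c"
    using inc_exact_triple(1)[of "{}" U A p] assms(1) by auto
  obtain d where d: "d \<in> carrier (hm (p + 1) A2 U2)" "inc (p + 1) A2 U2 A U d = c"
    using inc_surjD[OF rel c(1)] by blast
  let ?d = "hom_relboundary (p + 1) (tp A2) U2 {} d"
  have dc: "?d \<in> carrier (hm p U2 {})"
    using relboundary_hom[OF assms(4), of "p + 1" "{}"] d(1) by (auto simp: hom_def)
  have "inc p U2 {} U {} ?d = hom_relboundary (p + 1) (tp A) U {} c"
    using relboundary_inc[of A2 A U2 U "{}" "{}" "p + 1" d] assms d(2) by simp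
  then have "inc p U2 {} U {} (?d \<otimes>\<^bsub>hm p U2 {}\<^esub> b) = a \<otimes>\<^bsub>hm p U {}\<^esub> inv\<^bsub>hm p U {}\<^esub> ?b \<otimes>\<^bsub>hm p U {}\<^esub> ?b"
    using i2.hom_mult[OF dc b(1)] c(2) by simp
  also have "\<dots> = a" using a by (simp add: H.m_assoc)
  finally show "\<exists>x\<in>carrier (hm p U2 {}). inc p U2 {} U {} x = a"
    using dc b(1) i2.G.m_closed by blast
qed

lemma clopen_excision:
  assumes "openin (tp A) U" "openin (tp A) Y" "A = U \<union> Y" "U \<inter> Y = {}"
  shows "inc p U {} A Y \<in> iso (hm p U {}) (hm p A Y)"
  by (rule excision_iso) (use assms in auto)

text \<open>A relative class modulo the clopen piece \<open>Y\<close> is carried by the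
  complementary piece \<open>U\<close>, hence comes from an absolute class.\<close>

lemma clopen_surj:
  assumes "openin (tp A) U" "openin (tp A) Y" "A = U \<union> Y" "U \<inter> Y = {}"
  shows "inc_surj p A {} A Y"
proof (rule inc_surjI)
  fix y assume "y \<in> carrier (hm p A Y)"
  then have "y \<in> inc p U {} A Y ` carrier (hm p U {})"
    by (simp only: iso_imp_surj[OF clopen_excision[OF assms, of p]])
  then obtain x where "x \<in> carrier (hm p U {})" "inc p U {} A Y x = y"
    by (elim imageE) (rule that, simp_all)
  moreover have "inc p A {} A Y (inc p U {} A {} x) = inc p U {} A Y x"
    using assms(3) by (intro inc_compose) auto
  ultimately show "\<exists>x\<in>carrier (hm p A {}). inc p A {} A Y x = y"
    by (metis inc_closed)
qed

lemma clopen_short_exact: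
  assumes "openin (tp A) U" "openin (tp A) Y" "A = U \<union> Y" "U \<inter> Y = {}"
  shows "short_exact (hm p Y {}) (hm p A {}) (hm p A Y) (inc p Y {} A {}) (inc p A {} A Y)"
proof -
  have YA: "Y \<subseteq> A" using assms by auto
  interpret i: group_hom "hm p Y {}" "hm p A {}" "inc p Y {} A {}" by (rule inc_group_hom)
  interpret d: group_hom "hm (p+1) A Y" "hm (p + 1 - 1) Y {}" "hom_relboundary (p + 1) (tp A) Y {}"
    using relboundary_hom[OF YA, of "p + 1" "{}"] by (simp add: group_hom_def group_hom_axioms_def)
  have "hom_relboundary (p + 1) (tp A) Y {} x = \<one>\<^bsub>hm p Y {}\<^esub>" if x: "x \<in> carrier (hm (p+1) A Y)" for x
  proof -
    have "x \<in> inc (p+1) A {} A Y ` carrier (hm (p+1) A {})"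
      using clopen_surj[OF assms, of "p+1"] x by (simp add: inc_surj_def)
    then show ?thesis using inc_exact_triple(3)[of "{}" Y A "p+1"] YA by (auto simp: kernel_def)
  qed
  then have "kernel (hm p Y {}) (hm p A {}) (inc p Y {} A {}) \<subseteq> {\<one>\<^bsub>hm p Y {}\<^esub>}"
    using inc_exact_triple(1)[of "{}" Y A p] YA by auto
  moreover have "\<one>\<^bsub>hm p Y {}\<^esub> \<in> kernel (hm p Y {}) (hm p A {}) (inc p Y {} A {})"
    by (simp add: kernel_def i.hom_one)
  ultimately have "inj_on (inc p Y {} A {}) (carrier (hm p Y {}))"
    using i.inj_iff_trivial_ker by blast
  then show ?thesis
    unfolding short_exact_def
    using inc_hom[of p Y "{}" A "{}"] inc_hom[of p A "{}" A Y] clopen_surj[OF assms, of p]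
      inc_exact_triple(2)[of "{}" Y A p] YA by (simp add: inc_surj_def)
qed

text \<open>Classes of \<open>U\<close> are compared in the homology of \<open>(A, Y)\<close>, where
  the part of a lift lying in \<open>Y\<close> disappears.\<close>

lemma inc_surj_clopen:
  assumes "openin (tp A) U" "openin (tp A) Y" "A = U \<union> Y" "U \<inter> Y = {}"
    and "A2 \<subseteq> A" "inc_surj p A2 {} A {}"
  shows "inc_surj p (A2 \<inter> U) {} U {}"
proof (rule inc_surjI)
  let ?U2 = "A2 \<inter> U" and ?Y2 = "A2 \<inter> Y"
  have op2: "openin (tp A2) ?U2" "openin (tp A2) ?Y2"
    using assms(1,2,5) by (auto simp: openin_open)
  have iso2: "inc p ?U2 {} A2 ?Y2 \<in> iso (hm p ?U2 {}) (hm p A2 ?Y2)"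
    by (rule clopen_excision[OF op2]) (use assms in auto)
  fix u assume u: "u \<in> carrier (hm p U {})"
  obtain a where a: "a \<in> carrier (hm p A2 {})" "inc p A2 {} A {} a = inc p U {} A {} u"
    using inc_surjD[OF assms(6), of "inc p U {} A {} u"] by auto
  have "inc p A2 {} A2 ?Y2 a \<in> carrier (hm p A2 ?Y2)" by simp
  then have "inc p A2 {} A2 ?Y2 a \<in> inc p ?U2 {} A2 ?Y2 ` carrier (hm p ?U2 {})"
    by (simp only: iso_imp_surj[OF iso2])
  then obtain x where x: "x \<in> carrier (hm p ?U2 {})" "inc p ?U2 {} A2 ?Y2 x = inc p A2 {} A2 ?Y2 a"
    by (elim imageE) (rule that, simp_all)
  have "inc p U {} A Y (inc p ?U2 {} U {} x) = inc p ?U2 {} A Y x"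
    using assms(3) by (intro inc_compose) auto
  also have "\<dots> = inc p A2 ?Y2 A Y (inc p ?U2 {} A2 ?Y2 x)"
    using assms(5) by (intro inc_compose[symmetric]) auto
  also have "\<dots> = inc p A {} A Y (inc p A2 {} A {} a)"
    unfolding x(2) using assms(5) by (simp add: inc_compose)
  also have "\<dots> = inc p U {} A Y u"
    unfolding a(2) using assms(3) by (simp add: inc_compose)
  finally have "inc p ?U2 {} U {} x = u"
    using inj_onD[OF iso_imp_inj[OF clopen_excision[OF assms(1-4), of p]]] u by simp
  then show "\<exists>x\<in>carrier (hm p ?U2 {}). inc p ?U2 {} U {} x = u" using x(1) by blast
qed

text \<open>All integer degrees are included, with rank 0 in the negative ones, because the Thom
  shift by two reaches them. Real coefficients allow the differences that arise from characters of
  finite order.\<close>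

definition has_poincare :: "'a::topological_space set \<Rightarrow> real poly \<Rightarrow> bool" where
  "has_poincare S P \<longleftrightarrow> (\<forall>p. \<exists>r. has_rank (hm p S {}) r \<and> real r = (if p < 0 then 0 else Polynomial.coeff P (nat p)))"

lemma has_poincareD:
  assumes "has_poincare S P"
  obtains r where "has_rank (hm p S {}) r" "real r = (if p < 0 then 0 else Polynomial.coeff P (nat p))"
  using assms unfolding has_poincare_def by blast

lemma has_rank_is_iso:
  assumes "G \<cong> H" "comm_group G" "comm_group H" "has_rank G r"
  shows "has_rank H r"
proof -
  obtain h where "h \<in> iso G H" using assms(1) unfolding is_iso_def by blast
  from has_rank_iso[OF assms(2,3) this assms(4)] show ?thesis .
qed

lemma has_poincare_is_iso:
  assumes "\<And>p. hm p S {} \<cong> hm p T {}" "has_poincare S P"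
  shows "has_poincare T P"
  unfolding has_poincare_def
proof
  fix p
  obtain r where "has_rank (hm p S {}) r" "real r = (if p < 0 then 0 else Polynomial.coeff P (nat p))"
    using has_poincareD[OF assms(2)] .
  with has_rank_is_iso[OF assms(1)[of p], of r]
  show "\<exists>r. has_rank (hm p T {}) r \<and> real r = (if p < 0 then 0 else Polynomial.coeff P (nat p))"
    by (intro exI[of _ r]) simp
qed

lemma has_poincare_homeomorphic:
  assumes "tp S homeomorphic_space tp T" "has_poincare S P"
  shows "has_poincare T P"
  by (rule has_poincare_is_iso[OF homeomorphic_space_imp_isomorphic_homology_groups[OF assms(1)] assms(2)])

text \<open>The relative group contributing to degree \<open>p\<close> of \<open>U\<close> sits in
  degree \<open>p + 1\<close> and is the homology of \<open>Y\<close> in degree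
  \<open>p - 1\<close>; the net shift by one is the factor \<open>q\<close> encoded by
  \<open>pCons 0\<close>.\<close>

lemma has_poincare_deletion:
  assumes "U \<subseteq> A" "\<And>p. inc_surj p U {} A {}" "\<And>p. hm (p - 2) Y {} \<cong> hm p A U"
    and "has_poincare A P" "has_poincare Y Q"
  shows "has_poincare U (P + pCons 0 Q)"
  unfolding has_poincare_def
proof
  fix p
  obtain r where r: "has_rank (hm p A {}) r" "real r = (if p < 0 then 0 else Polynomial.coeff P (nat p))"
    using has_poincareD[OF assms(4)] .
  obtain s where s: "has_rank (hm (p - 1) Y {}) s" "real s = (if p - 1 < 0 then 0 else Polynomial.coeff Q (nat (p - 1)))"
    using has_poincareD[OF assms(5)] .
  have "hm (p - 1) Y {} \<cong> hm (p + 1) A U" using assms(3)[of "p + 1"] by simp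
  then have "has_rank (hm (p + 1) A U) s" by (rule has_rank_is_iso) (simp_all add: s(1))
  then have "has_rank (hm p U {}) (s + r)"
    by (rule has_rank_short_exact[OF short_exact_if_surj[OF assms(1,2)] _ r(1)])
  moreover have "real (s + r) = (if p < 0 then 0 else Polynomial.coeff (P + pCons 0 Q) (nat p))"
  proof (cases "p \<le> 0")
    case True
    then show ?thesis using r s by (auto simp: Polynomial.coeff_pCons split: nat.split)
  next
    case False
    then have "nat p = Suc (nat (p - 1))" by simp
    then show ?thesis using r s False by simp
  qed
  ultimately show "\<exists>r. has_rank (hm p U {}) r \<and> real r = (if p < 0 then 0 else Polynomial.coeff (P + pCons 0 Q) (nat p))"
    by blast
qed

text \<open>The relative group of \<open>(A, Y)\<close> is the homology of \<open>U\<close>, so its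
  rank is found as that of a quotient.\<close>

lemma has_poincare_clopen_diff:
  assumes "openin (tp A) U" "openin (tp A) Y" "A = U \<union> Y" "U \<inter> Y = {}"
    and "has_poincare A P" "has_poincare Y Q"
  shows "has_poincare U (P - Q)"
  unfolding has_poincare_def
proof
  fix p
  obtain r where r: "has_rank (hm p A {}) r" "real r = (if p < 0 then 0 else Polynomial.coeff P (nat p))"
    using has_poincareD[OF assms(5)] .
  obtain s where s: "has_rank (hm p Y {}) s" "real s = (if p < 0 then 0 else Polynomial.coeff Q (nat p))"
    using has_poincareD[OF assms(6)] .
  obtain b where b: "has_rank (hm p A Y) b" "r = s + b"
    using has_rank_short_exact_quotient[OF clopen_short_exact[OF assms(1-4)] s(1) r(1)] .
  have "hm p A Y \<cong> hm p U {}"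
    using group.iso_set_sym[OF _ clopen_excision[OF assms(1-4), of p]] by (auto simp: is_iso_def)
  then have "has_rank (hm p U {}) b" by (rule has_rank_is_iso) (simp_all add: b(1))
  then show "\<exists>r. has_rank (hm p U {}) r \<and> real r = (if p < 0 then 0 else Polynomial.coeff (P - Q) (nat p))"
    using r s b(2) by (intro exI[of _ b]) auto
qed

lemma has_poincare_clopen_Un:
  assumes "openin (tp (U \<union> Y)) U" "openin (tp (U \<union> Y)) Y" "U \<inter> Y = {}"
    and "has_poincare U P" "has_poincare Y Q"
  shows "has_poincare (U \<union> Y) (P + Q)"
  unfolding has_poincare_def
proof
  fix p
  let ?A = "U \<union> Y"
  obtain r where r: "has_rank (hm p U {}) r" "real r = (if p < 0 then 0 else Polynomial.coeff P (nat p))"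
    using has_poincareD[OF assms(4)] .
  obtain s where s: "has_rank (hm p Y {}) s" "real s = (if p < 0 then 0 else Polynomial.coeff Q (nat p))"
    using has_poincareD[OF assms(5)] .
  have "has_rank (hm p ?A Y) r"
    using has_rank_iso[OF _ _ clopen_excision[OF assms(1,2) refl assms(3)] r(1)] by simp
  then have "has_rank (hm p ?A {}) (s + r)"
    by (rule has_rank_short_exact[OF clopen_short_exact[OF assms(1,2) refl assms(3)] s(1)])
  then show "\<exists>r. has_rank (hm p ?A {}) r \<and> real r = (if p < 0 then 0 else Polynomial.coeff (P + Q) (nat p))"
    using r s by (intro exI[of _ "s + r"]) auto
qed

section \<open>Finite sets, and products with finite sets or the punctured plane\<close>

lemma has_poincare_empty: "has_poincare {} 0"
  unfolding has_poincare_def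
  by (auto intro!: exI[of _ 0] has_rank_trivial_group trivial_homology_group_empty)

lemma has_poincare_singleton: "has_poincare {a} 1"
  unfolding has_poincare_def
proof
  fix p :: int
  consider "p = 0" | "p \<noteq> 0" by blast
  then show "\<exists>r. has_rank (hm p {a} {}) r \<and> real r = (if p < 0 then 0 else Polynomial.coeff 1 (nat p))"
  proof cases
    case 1
    have "hm 0 {a} {} \<cong> integer_group" by (rule homology_coefficients[of _ a]) simp
    then have "integer_group \<cong> hm 0 {a} {}" by (rule group.iso_sym[rotated]) simp
    then have "has_rank (hm 0 {a} {}) 1"
      by (rule has_rank_is_iso) (simp_all add: abelian_integer_group has_rank_integer_group[simplified])
    then show ?thesis using 1 by (intro exI[of _ 1]) auto
  next
    case 2
    have "trivial_group (hm p {a} {})" using 2 by (intro homology_dimension_axiom[of _ a]) auto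
    then have "has_rank (hm p {a} {}) 0" by (intro has_rank_trivial_group) auto
    then show ?thesis using 2 by (intro exI[of _ 0]) (auto simp: Polynomial.coeff_eq_0)
  qed
qed

lemma openin_finite_Un:
  fixes U Y :: "'a::t1_space set"
  assumes "finite U" "finite Y" "U \<inter> Y = {}"
  shows "openin (tp (U \<union> Y)) U"
proof -
  have "U = (U \<union> Y) \<inter> - Y" using assms by auto
  moreover have "open (- Y)" using assms by (simp add: finite_imp_closed open_Compl)
  ultimately show ?thesis by (metis openin_open)
qed

lemma has_poincare_finite:
  fixes S :: "'a::t1_space set"
  assumes "finite S"
  shows "has_poincare S [:real (card S):]"
  using assms
proof (induction S rule: finite_induct)
  case empty
  then show ?case using has_poincare_empty by simp
next
  case (insert a S)
  have "has_poincare ({a} \<union> S) (1 + [:real (card S):])"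
    using insert openin_finite_Un[of "{a}" S] openin_finite_Un[of S "{a}"]
    by (intro has_poincare_clopen_Un has_poincare_singleton) (auto simp: Un_commute)
  moreover have "1 + [:real (card S):] = [:real (card (insert a S)):]" using insert by (simp add: one_pCons)
  ultimately show ?case by simp
qed

lemma has_poincare_times_finite:
  fixes S :: "'a::topological_space set" and F :: "'b::t1_space set"
  assumes "finite F" "has_poincare S P"
  shows "has_poincare (S \<times> F) (of_nat (card F) * P)"
  using assms(1)
proof (induction F rule: finite_induct)
  case empty
  then show ?case using has_poincare_empty by simp
next
  case (insert a F)
  have "tp S homeomorphic_space tp (S \<times> {a})"
    unfolding homeomorphic_space_def homeomorphic_maps_def
    by (intro exI[of _ "\<lambda>x. (x, a)"] exI[of _ fst])
      (auto simp: continuous_map_in_subtopology intro!: continuous_intros)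
  then have "has_poincare (S \<times> {a}) P" by (rule has_poincare_homeomorphic) (rule assms(2))
  moreover have "openin (tp (S \<times> {a} \<union> S \<times> F)) (S \<times> {a})" "openin (tp (S \<times> {a} \<union> S \<times> F)) (S \<times> F)"
    unfolding Sigma_Un_distrib2[symmetric]
    using insert openin_finite_Un[of "{a}" F] openin_finite_Un[of F "{a}"]
    by (auto intro!: openin_Times)
  ultimately have "has_poincare ((S \<times> {a}) \<union> (S \<times> F)) (P + of_nat (card F) * P)"
    using insert by (intro has_poincare_clopen_Un) auto
  moreover have "(S \<times> {a}) \<union> (S \<times> F) = S \<times> insert a F" by auto
  ultimately show ?case using insert by (simp add: distrib_right)
qed

text \<open>The deletion formula for the zero slice of the product with the plane; surjectivity
  holds because the slice over 1 avoids the zero slice and already carries all classes.\<close>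

lemma has_poincare_times_punctured_plane:
  fixes Y :: "'a::topological_space set"
  assumes "has_poincare Y P"
  shows "has_poincare (Y \<times> (- {0::complex})) ([:1, 1:] * P)"
proof -
  have "starlike_at (1::complex) UNIV" by (simp add: starlike_at_def)
  from is_isoI[OF slice_iso[OF this]] have Q: "has_poincare (Y \<times> (UNIV :: complex set)) P"
    by (rule has_poincare_is_iso) (rule assms)
  have surj: "inc_surj p (Y \<times> (- {0})) {} (Y \<times> (UNIV :: complex set)) {}" for p
  proof (rule inc_surjI)
    fix y assume y: "y \<in> carrier (hm p (Y \<times> (UNIV :: complex set)) {})"
    have "starlike_at (1::complex) {1}" by (simp add: starlike_at_def)
    then have "inc p (Y \<times> {1::complex}) {} (Y \<times> UNIV) {} \<in> iso (hm p (Y \<times> {1}) {}) (hm p (Y \<times> UNIV) {})"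
      by (rule starlike_inc_iso) (auto simp: starlike_at_def)
    then have "y \<in> inc p (Y \<times> {1::complex}) {} (Y \<times> UNIV) {} ` carrier (hm p (Y \<times> {1}) {})"
      using y by (simp only: iso_imp_surj)
    then obtain x where x: "y = inc p (Y \<times> {1}) {} (Y \<times> UNIV) {} x" by (rule imageE)
    show "\<exists>x\<in>carrier (hm p (Y \<times> (-{0})) {}). inc p (Y \<times> (-{0})) {} (Y \<times> (UNIV :: complex set)) {} x = y"
    proof (rule bexI)
      show "inc p (Y \<times> (-{0})) {} (Y \<times> UNIV) {} (inc p (Y \<times> {1}) {} (Y \<times> (-{0})) {} x) = y"
        unfolding x by (rule inc_compose) auto
    qed simp
  qed
  have iso: "hm (p - 2) Y {} \<cong> hm p (Y \<times> UNIV) (Y \<times> (- {0::complex}))" for p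
    by (rule thom_iso)
  have "has_poincare (Y \<times> (- {0::complex})) (P + pCons 0 P)"
    by (rule has_poincare_deletion[where A = "Y \<times> UNIV" and Y = Y])
      (use surj iso Q assms in auto)
  also have "P + pCons 0 P = [:1, 1:] * P" by simp
  finally show ?thesis .
qed

section \<open>Toric arrangements\<close>

definition ctorus :: "(complex ^ 'n) set" where
  "ctorus = {z. \<forall>i. z $ i \<noteq> 0}"

definition chi :: "int ^ 'n \<Rightarrow> complex ^ 'n \<Rightarrow> complex" where
  "chi a z = (\<Prod>i\<in>UNIV. z $ i powi (a $ i))"

definition ksub :: "(int ^ 'n) set \<Rightarrow> (complex ^ 'n) set" where
  "ksub B = {z \<in> ctorus. \<forall>b\<in>B. chi b z = 1}"

definition arr :: "(int ^ 'n) set \<Rightarrow> (int ^ 'n) set \<Rightarrow> (complex ^ 'n) set" where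
  "arr B X = {z \<in> ksub B. \<forall>x\<in>X. chi x z \<noteq> 1}"

definition pair :: "int ^ 'n \<Rightarrow> complex ^ 'n \<Rightarrow> complex" where
  "pair a c = (\<Sum>i\<in>UNIV. of_int (a $ i) * c $ i)"

text \<open>Multiplication by the exponential of a tangent vector: \<open>chi a\<close> is
  multiplied by \<open>exp (pair a c)\<close>.\<close>

definition transl :: "complex ^ 'n \<Rightarrow> complex ^ 'n \<Rightarrow> complex ^ 'n" where
  "transl c z = (\<chi> i. z $ i * exp (c $ i))"

definition cvec :: "complex \<Rightarrow> real ^ 'n \<Rightarrow> complex ^ 'n" where
  "cvec s w = (\<chi> i. s * of_real (w $ i))"

lemma chi_nonzero [simp]: "z \<in> ctorus \<Longrightarrow> chi a z \<noteq> 0"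
  by (simp add: chi_def ctorus_def)

lemma chi_zero [simp]: "chi 0 z = 1"
  by (simp add: chi_def)

lemma chi_axis: "chi (axis i 1) z = z $ i"
proof -
  have "chi (axis i 1) z = (\<Prod>j\<in>UNIV. if j = i then z $ j else 1)"
    unfolding chi_def by (intro prod.cong) (auto simp: axis_def)
  then show ?thesis by simp
qed

lemma chi_add: "z \<in> ctorus \<Longrightarrow> chi (a + b) z = chi a z * chi b z"
  by (simp add: chi_def ctorus_def power_int_add prod.distrib)

lemma chi_minus: "chi (- a) z = inverse (chi a z)"
  by (simp add: chi_def power_int_minus prod_inversef[of "\<lambda>i. z $ i powi a $ i" UNIV, unfolded o_def])

lemma prod_powi:
  fixes f :: "'i \<Rightarrow> complex"
  shows "(\<Prod>i\<in>S. f i powi k) = (\<Prod>i\<in>S. f i) powi k"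
  by (induction S rule: infinite_finite_induct) (simp_all add: power_int_mult_distrib)

lemma chi_scale: "chi (k *s a) z = chi a z powi k"
  by (simp add: chi_def power_int_mult mult.commute[of k] prod_powi)

lemma chi_sum: "\<lbrakk>finite S; z \<in> ctorus\<rbrakk> \<Longrightarrow> chi (\<Sum>b\<in>S. f b) z = (\<Prod>b\<in>S. chi (f b) z)"
  by (induction S rule: finite_induct) (simp_all add: chi_add)

lemma transl_ctorus [simp]: "transl c z \<in> ctorus \<longleftrightarrow> z \<in> ctorus"
  by (simp add: transl_def ctorus_def)

lemma chi_transl: "z \<in> ctorus \<Longrightarrow> chi a (transl c z) = chi a z * exp (pair a c)"
  by (simp add: chi_def transl_def pair_def ctorus_def power_int_mult_distrib prod.distrib exp_sum exp_power_int)

lemma transl_transl: "transl c (transl d z) = transl (c + d) z"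
  by (simp add: transl_def vec_eq_iff exp_add mult_ac)

lemma transl_0 [simp]: "transl 0 z = z"
  by (simp add: transl_def vec_eq_iff)

lemma pair_cvec: "pair a (cvec s w) = s * of_real (realv a \<bullet> w)"
  by (simp add: pair_def cvec_def realv_def inner_vec_def sum_distrib_left mult_ac)

lemma continuous_on_chi: "S \<subseteq> ctorus \<Longrightarrow> continuous_on S (chi a)"
  unfolding chi_def ctorus_def by (intro continuous_intros) auto

lemma continuous_on_transl:
  "\<lbrakk>continuous_on S f; continuous_on S g\<rbrakk> \<Longrightarrow> continuous_on S (\<lambda>x. transl (f x) (g x))"
  unfolding transl_def by (intro continuous_intros)

lemma continuous_on_cvec: "continuous_on S f \<Longrightarrow> continuous_on S (\<lambda>x. cvec (f x) w)"
  unfolding cvec_def by (intro continuous_intros)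

lemma ksub_ctorus: "ksub B \<subseteq> ctorus"
  by (auto simp: ksub_def)

lemma ksub_insert: "ksub (insert v B) = {z \<in> ksub B. chi v z = 1}"
  by (auto simp: ksub_def)

lemma closedin_ksub_insert: "closedin (tp (ksub B)) (ksub (insert v B))"
proof -
  have "closedin (tp (ksub B)) (ksub B \<inter> chi v -` {1})"
    by (intro continuous_closedin_preimage continuous_on_chi ksub_ctorus) auto
  moreover have "ksub B \<inter> chi v -` {1} = ksub (insert v B)" by (auto simp: ksub_insert)
  ultimately show ?thesis by simp
qed

lemma openin_arr:
  assumes "finite X"
  shows "openin (tp (ksub B)) (arr B X)"
proof -
  have "closedin (tp (ksub B)) (\<Union>x\<in>X. ksub (insert x B))"
    using assms closedin_ksub_insert by (intro closedin_Union) auto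
  then have "openin (tp (ksub B)) (ksub B - (\<Union>x\<in>X. ksub (insert x B)))"
    using openin_diff openin_subtopology_refl by (metis openin_topspace topspace_euclidean_subtopology)
  moreover have "ksub B - (\<Union>x\<in>X. ksub (insert x B)) = arr B X"
    by (auto simp: arr_def ksub_insert)
  ultimately show ?thesis by simp
qed

lemma arr_insert: "arr B (insert v X) = arr B X - ksub (insert v B)"
  by (auto simp: arr_def ksub_insert)

lemma arr_insert_left: "arr (insert v B) X = arr B X \<inter> ksub (insert v B)"
  by (auto simp: arr_def ksub_insert)

subsection \<open>Rational dependencies\<close>

text \<open>Gaussian elimination with integral pivots.\<close>

lemma integral_solution:
  fixes F :: "('i \<Rightarrow> int) set" and x :: "'i \<Rightarrow> real"
  assumes "finite F" "finite I" "\<And>f. f \<in> F \<Longrightarrow> (\<Sum>i\<in>I. of_int (f i) * x i) = 0" "\<exists>i\<in>I. x i \<noteq> 0"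
  shows "\<exists>c. (\<exists>i\<in>I. c i \<noteq> 0) \<and> (\<forall>f\<in>F. (\<Sum>i\<in>I. f i * c i) = (0::int))"
  using assms
proof (induction "card F" arbitrary: F I rule: less_induct)
  case less
  show ?case
  proof (cases "F = {}")
    case True
    then show ?thesis using less.prems(4) by (auto intro!: exI[of _ "\<lambda>_. 1"])
  next
    case False
    then obtain f where f: "f \<in> F" by blast
    have cardF: "card (F - {f}) < card F" using less.prems(1) f by (rule card_Diff1_less)
  show ?thesis
  proof (cases "\<forall>i\<in>I. f i = 0")
    case True
    have "\<exists>c. (\<exists>i\<in>I. c i \<noteq> 0) \<and> (\<forall>g\<in>F - {f}. (\<Sum>i\<in>I. g i * c i) = (0::int))"
      using less.prems cardF by (intro less.hyps) auto
    then obtain c where c: "\<exists>i\<in>I. c i \<noteq> 0" "\<forall>g\<in>F - {f}. (\<Sum>i\<in>I. g i * c i) = (0::int)" by blast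
    moreover have "(\<Sum>i\<in>I. f i * c i) = 0" using True by (intro sum.neutral) simp
    ultimately show ?thesis by blast
  next
    case False
    then obtain k where k: "k \<in> I" "f k \<noteq> 0" by blast
    \<comment> \<open>Fraction-free elimination of the unknown \<open>k\<close>: its coefficient
      cancels while all entries stay integers.\<close>
    define red where "red g = (\<lambda>i. f k * g i - g k * f i)" for g
    let ?F = "red ` (F - {f})" and ?I = "I - {k}"
    have split: "(\<Sum>i\<in>I. h i) = h k + (\<Sum>i\<in>?I. h i)" for h :: "'i \<Rightarrow> 'c::comm_monoid_add"
      using less.prems(2) k(1) by (simp add: sum.remove)
    have fx: "of_int (f k) * x k = - (\<Sum>i\<in>?I. of_int (f i) * x i)"
      using less.prems(3)[OF f] split[of "\<lambda>i. of_int (f i) * x i"] by simp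
    have "card ?F < card F" using cardF less.prems(1) by (meson card_image_le finite_Diff le_less_trans)
    have red0: "(\<Sum>i\<in>?I. of_int (g i) * x i) = 0" if gF: "g \<in> ?F" for g
    proof -
      obtain h where h: "h \<in> F" "g = red h" using gF by blast
      have "of_int (h k) * x k = - (\<Sum>i\<in>?I. of_int (h i) * x i)"
        using less.prems(3)[OF h(1)] split[of "\<lambda>i. of_int (h i) * x i"] by simp
      then have "of_int (f k) * (\<Sum>i\<in>?I. of_int (h i) * x i) = of_int (h k) * (\<Sum>i\<in>?I. of_int (f i) * x i)"
        using fx by (metis (no_types, lifting) mult.left_commute mult_minus_right neg_equal_iff_equal)
      then show ?thesis
        unfolding h(2) red_def by (simp add: left_diff_distrib sum_subtractf sum_distrib_left mult.assoc)
    qed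
    have nz: "\<exists>i\<in>?I. x i \<noteq> 0"
    proof (rule ccontr)
      assume "\<not> (\<exists>i\<in>?I. x i \<noteq> 0)"
      then have "of_int (f k) * x k = 0" unfolding fx by simp
      then have "x k = 0" using k by simp
      then show False using less.prems(4) \<open>\<not> (\<exists>i\<in>?I. x i \<noteq> 0)\<close> by auto
    qed
    have "\<exists>c. (\<exists>i\<in>?I. c i \<noteq> 0) \<and> (\<forall>g\<in>?F. (\<Sum>i\<in>?I. g i * c i) = (0::int))"
      using less.prems(1,2) by (intro less.hyps \<open>card ?F < card F\<close> red0 nz) auto
    then obtain c where c: "\<exists>i\<in>?I. c i \<noteq> 0" "\<And>g. g \<in> ?F \<Longrightarrow> (\<Sum>i\<in>?I. g i * c i) = (0::int)"
      by blast
    \<comment> \<open>Back-substitution: scaling the other unknowns by the pivot \<open>f k\<close>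
      makes the value of the unknown \<open>k\<close> an integer.\<close>
    define d where "d = (\<lambda>i. if i = k then - (\<Sum>i\<in>?I. f i * c i) else f k * c i)"
    have d: "(\<Sum>i\<in>I. h i * d i) = (\<Sum>i\<in>?I. (f k * h i - h k * f i) * c i)" for h
    proof -
      have "(\<Sum>i\<in>?I. h i * d i) = (\<Sum>i\<in>?I. h i * (f k * c i))" by (rule sum.cong) (auto simp: d_def)
      then show ?thesis
        by (simp add: split d_def algebra_simps sum_subtractf sum_distrib_left)
    qed
    have "(\<Sum>i\<in>I. g i * d i) = 0" if "g \<in> F" for g
      using that c(2)[of "red g"] unfolding d by (cases "g = f") (auto simp: red_def)
    moreover have "\<exists>i\<in>I. d i \<noteq> 0" using c(1) k by (auto simp: d_def)
    ultimately show ?thesis by blast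
  qed
  qed
qed

lemma realv_zero: "realv 0 = 0"
  by (simp add: realv_def vec_eq_iff)

lemma realv_scale: "realv (k *s a) = of_int k *\<^sub>R realv a"
  by (simp add: realv_def vec_eq_iff)

lemma realv_eq_iff: "realv a = realv b \<longleftrightarrow> a = b"
  by (simp add: realv_def vec_eq_iff)

text \<open>A real orthogonal vector exists for dimension reasons; it witnesses that the integral
  linear system has a nontrivial solution.\<close>

lemma integral_orthogonal:
  fixes B :: "(int ^ 'n) set"
  assumes "finite B" "dim (realv ` B) < CARD('n)"
  obtains l where "l \<noteq> 0" "\<And>b. b \<in> B \<Longrightarrow> (\<Sum>i\<in>UNIV. b $ i * l $ i) = 0"
proof -
  obtain w :: "real ^ 'n" where w: "w \<noteq> 0" "\<And>y. y \<in> span (realv ` B) \<Longrightarrow> orthogonal w y"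
    using orthogonal_to_subspace_exists[of "realv ` B"] assms(2) by auto
  let ?F = "(\<lambda>b i. b $ i) ` B"
  have "(\<Sum>i\<in>UNIV. of_int (f i) * w $ i) = 0" if fF: "f \<in> ?F" for f
  proof -
    obtain b where "b \<in> B" "f = (\<lambda>i. b $ i)" using fF by blast
    moreover from this have "orthogonal w (realv b)" by (intro w(2) span_base) blast
    ultimately show ?thesis by (simp add: orthogonal_def inner_vec_def realv_def mult.commute)
  qed
  moreover have "\<exists>i\<in>UNIV. w $ i \<noteq> 0" using w(1) by (simp add: vec_eq_iff)
  ultimately obtain c where "\<exists>i\<in>UNIV. c i \<noteq> 0" and c: "\<And>f. f \<in> ?F \<Longrightarrow> (\<Sum>i\<in>UNIV. f i * c i) = (0::int)"
    using integral_solution[of ?F UNIV "\<lambda>i. w $ i"] assms(1) by auto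
  then have "(\<chi> i. c i) \<noteq> 0" by (simp add: vec_eq_iff)
  then show ?thesis using c that[of "\<chi> i. c i"] by auto
qed

text \<open>\<open>v\<close> is expanded in a basis chosen from \<open>B\<close>; the resulting real
  relation is replaced by an integral one, in which independence of the basis forces a nonzero
  coefficient at \<open>v\<close>.\<close>

lemma span_integral_multiple:
  fixes B :: "(int ^ 'n) set"
  assumes "realv v \<in> span (realv ` B)"
  obtains k S c where "k \<noteq> (0::int)" "finite S" "S \<subseteq> B" "k *s v = (\<Sum>b\<in>S. c b *s b)"
proof (cases "v \<in> B")
  case True
  then show ?thesis using that[of 1 "{v}" "\<lambda>_. 1"] by simp
next
  case False
  obtain D where D: "D \<subseteq> realv ` B" "independent D" "realv ` B \<subseteq> span D"
    by (rule maximal_independent_subset)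
  then have spanD: "span D = span (realv ` B)"
    by (intro antisym span_mono span_minimal) auto
  obtain S where S: "S \<subseteq> B" "realv ` S = D" using D(1) by (metis subset_imageE)
  have inj: "inj_on realv S" by (auto simp: inj_on_def realv_eq_iff)
  have finS: "finite S" using D(2) S(2) inj finite_imageD independent_imp_finite by blast
  obtain r where r: "realv v = (\<Sum>d\<in>D. r d *\<^sub>R d)"
    using assms spanD span_finite[of D] finS S(2) by auto
  let ?I = "insert v S"
  \<comment> \<open>The unknowns are the coefficients of a linear relation, the equations its
    coordinates; the real solution has -1 at \<open>v\<close> and the expansion coefficients at the
    basis.\<close>
  let ?x = "\<lambda>a. if a = v then -1 else r (realv a)"
  let ?F = "range (\<lambda>i a. a $ i) :: (int ^ 'n \<Rightarrow> int) set"
  have vS: "v \<notin> S" using False S by blast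
  have "(\<Sum>a\<in>?I. of_int (f a) * ?x a) = 0" if fF: "f \<in> ?F" for f
  proof -
    obtain i where i: "f = (\<lambda>a. a $ i)" using fF by blast
    have "realv v $ i = (\<Sum>d\<in>D. r d * d $ i)" unfolding r by simp
    also have "\<dots> = (\<Sum>a\<in>S. r (realv a) * realv a $ i)"
      unfolding S(2)[symmetric] using inj by (subst sum.reindex) auto
    finally have "of_int (v $ i) = (\<Sum>a\<in>S. of_int (a $ i) * r (realv a))"
      by (simp add: realv_def mult.commute)
    moreover have "(\<Sum>a\<in>S. of_int (f a) * ?x a) = (\<Sum>a\<in>S. of_int (a $ i) * r (realv a))"
      by (rule sum.cong) (use vS i in auto)
    ultimately show ?thesis using finS vS i by simp
  qed
  then obtain c where nz: "\<exists>a\<in>?I. c a \<noteq> 0" and c0: "\<And>f. f \<in> ?F \<Longrightarrow> (\<Sum>a\<in>?I. f a * c a) = (0::int)"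
    using integral_solution[of ?F ?I ?x] finS by auto
  have "(\<Sum>a\<in>?I. c a * a $ i) = 0" for i
    using c0[of "\<lambda>a. a $ i"] by (simp add: mult.commute)
  then have c: "(\<Sum>a\<in>?I. c a *s a) = 0" by (simp add: vec_eq_iff)
  have "c v \<noteq> 0"
  proof
    assume cv: "c v = 0"
    have "(\<Sum>d\<in>D. of_int (c (inv_into S realv d)) *\<^sub>R d) = (\<Sum>a\<in>S. of_int (c a) *\<^sub>R realv a)"
      unfolding S(2)[symmetric] using inj by (subst sum.reindex) auto
    also have "\<dots> = realv (\<Sum>a\<in>S. c a *s a)"
      by (simp add: realv_def vec_eq_iff)
    also have "(\<Sum>a\<in>S. c a *s a) = 0" using c cv finS vS by simp
    finally have "(\<Sum>d\<in>D. of_int (c (inv_into S realv d)) *\<^sub>R d) = 0" by (simp only: realv_zero)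
    then have "\<forall>d\<in>D. c (inv_into S realv d) = 0"
      using D(2) finS S(2) independentD[of D D "\<lambda>d. of_int (c (inv_into S realv d))"] by auto
    then have "\<forall>a\<in>S. c a = 0" using S(2) inj by auto
    then show False using nz cv by auto
  qed
  moreover have "(- c v) *s v = (\<Sum>a\<in>S. c a *s a)"
    using c finS vS by (simp add: vec_eq_iff add_eq_0_iff)
  ultimately show ?thesis using that[of "- c v" S c] finS S(1) by simp
qed

text \<open>A nonzero multiple of \<open>v\<close> is an integral combination of \<open>B\<close>,
  hence a character trivial on \<open>ksub B\<close>; a negative multiple is handled by
  inversion.\<close>

lemma chi_root_of_unity:
  assumes "realv v \<in> span (realv ` B)"
  obtains k :: nat where "k > 0" "\<And>z. z \<in> ksub B \<Longrightarrow> chi v z ^ k = 1"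
proof -
  obtain k S c where k: "k \<noteq> (0::int)" "finite S" "S \<subseteq> B" "k *s v = (\<Sum>b\<in>S. c b *s b)"
    using span_integral_multiple[OF assms] .
  have "chi v z ^ nat \<bar>k\<bar> = 1" if z: "z \<in> ksub B" for z
  proof -
    have "z \<in> ctorus" using z by (simp add: ksub_def)
    have "chi v z powi k = chi (k *s v) z" by (simp add: chi_scale)
    also have "\<dots> = (\<Prod>b\<in>S. chi b z powi c b)"
      unfolding k(4) using \<open>z \<in> ctorus\<close> k(2) by (simp add: chi_sum chi_scale)
    also have "\<dots> = 1" using z k(3) by (intro prod.neutral) (auto simp: ksub_def)
    finally have "chi v z powi k = 1" .
    then show ?thesis by (cases "k \<ge> 0") (auto simp: power_int_def power_inverse)
  qed
  then show ?thesis using that[of "nat \<bar>k\<bar>"] k(1) by simp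
qed

text \<open>A character of finite order on \<open>ksub B\<close> is locally constant there.\<close>

lemma closedin_ksub_diff:
  assumes "realv v \<in> span (realv ` B)"
  shows "closedin (tp (ksub B)) (ksub B - ksub (insert v B))"
proof -
  obtain k :: nat where k: "k > 0" "\<And>z. z \<in> ksub B \<Longrightarrow> chi v z ^ k = 1"
    by (rule chi_root_of_unity[OF assms]) blast
  have "finite {u::complex. u ^ k = 1}" using k(1) by (simp add: finite_roots_unity)
  then have "closed ({u::complex. u ^ k = 1} - {1})" by (simp add: finite_imp_closed)
  then have "closedin (tp (ksub B)) (ksub B \<inter> chi v -` ({u. u ^ k = 1} - {1}))"
    by (intro continuous_closedin_preimage continuous_on_chi ksub_ctorus)
  moreover have "ksub B \<inter> chi v -` ({u. u ^ k = 1} - {1}) = ksub B - ksub (insert v B)"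
    using k(2) by (auto simp: ksub_insert)
  ultimately show ?thesis by simp
qed

lemma openin_ksub_insert:
  assumes "realv v \<in> span (realv ` B)"
  shows "openin (tp (ksub B)) (ksub (insert v B))"
proof -
  have "ksub (insert v B) \<subseteq> ksub B" by (auto simp: ksub_insert)
  then have "ksub (insert v B) = ksub B - (ksub B - ksub (insert v B))" by blast
  then show ?thesis
    using openin_diff[OF openin_topspace closedin_ksub_diff[OF assms]] by simp
qed

lemma arr_clopen:
  assumes "finite X" "realv v \<in> span (realv ` B)"
  shows "openin (tp (arr B X)) (arr B X - ksub (insert v B))"
    "openin (tp (arr B X)) (arr B X \<inter> ksub (insert v B))"
proof -
  let ?K = "ksub B" and ?K' = "ksub (insert v B)"
  have opA: "openin (tp ?K) (arr B X)" by (rule openin_arr[OF assms(1)])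
  have AK: "arr B X \<subseteq> ?K" by (auto simp: arr_def)
  have "openin (tp ?K) (?K - ?K')"
    using openin_diff[OF openin_topspace closedin_ksub_insert, of B v] by simp
  then have "openin (tp ?K) (arr B X \<inter> (?K - ?K'))" "openin (tp ?K) (arr B X \<inter> ?K')"
    using opA openin_ksub_insert[OF assms(2)] by (auto intro: openin_Int)
  moreover have "arr B X \<inter> (?K - ?K') = arr B X - ?K'" using AK by blast
  ultimately show "openin (tp (arr B X)) (arr B X - ?K')" "openin (tp (arr B X)) (arr B X \<inter> ?K')"
    using AK by (auto intro: openin_subset_trans)
qed

section \<open>Real vectors dual to characters\<close>

lemma dual_vector:
  fixes v :: "real ^ 'n"
  assumes "v \<notin> span S"
  obtains w where "v \<bullet> w = 1" "\<And>x. x \<in> span S \<Longrightarrow> x \<bullet> w = 0"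
proof -
  obtain y z where yz: "y \<in> span S" "\<And>x. x \<in> span S \<Longrightarrow> orthogonal z x" "v = y + z"
    using orthogonal_subspace_decomp_exists[of S v] by metis
  have "z \<noteq> 0" using yz assms by auto
  moreover have "y \<bullet> z = 0" using yz(2)[OF yz(1)] by (simp add: orthogonal_def inner_commute)
  ultimately have "v \<bullet> (z /\<^sub>R (z \<bullet> z)) = 1" by (simp add: yz(3) inner_add_left)
  moreover have "x \<bullet> (z /\<^sub>R (z \<bullet> z)) = 0" if "x \<in> span S" for x
    using yz(2)[OF that] by (simp add: orthogonal_def inner_commute)
  ultimately show ?thesis using that by blast
qed

text \<open>With \<open>w\<close> nonzero on \<open>E\<close> and \<open>u\<close> nonzero on
  \<open>e\<close>, the vector \<open>u + t *\<^sub>R w\<close> is orthogonal to a given member for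
  at most one \<open>t\<close>, so all but finitely many \<open>t\<close> serve.\<close>

lemma generic_dual_vector:
  fixes E :: "(real ^ 'n) set"
  assumes "finite E" "E \<inter> span S = {}"
  shows "\<exists>w. (\<forall>x\<in>span S. x \<bullet> w = 0) \<and> (\<forall>e\<in>E. e \<bullet> w \<noteq> 0)"
  using assms
proof (induction E rule: finite_induct)
  case empty
  then show ?case by (auto intro!: exI[of _ 0])
next
  case (insert e E)
  then obtain w where w: "\<forall>x\<in>span S. x \<bullet> w = 0" "\<forall>e\<in>E. e \<bullet> w \<noteq> 0" by auto
  obtain u where u: "e \<bullet> u = 1" "\<And>x. x \<in> span S \<Longrightarrow> x \<bullet> u = 0"
    using dual_vector[of e S] insert.prems by auto
  have "finite ((\<lambda>x. - (x \<bullet> u) / (x \<bullet> w)) ` insert e E \<union> {0})" using insert by simp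
  then obtain t where t: "t \<notin> (\<lambda>x. - (x \<bullet> u) / (x \<bullet> w)) ` insert e E \<union> {0}"
    using ex_new_if_finite infinite_UNIV_char_0 by blast
  have "x \<bullet> (u + t *\<^sub>R w) \<noteq> 0" if "x \<in> insert e E" for x
  proof
    assume *: "x \<bullet> (u + t *\<^sub>R w) = 0"
    show False
    proof (cases "x \<bullet> w = 0")
      case True
      then show ?thesis using * that w(2) u(1) by (auto simp: inner_add_right)
    next
      case False
      then have "t = - (x \<bullet> u) / (x \<bullet> w)" using * by (simp add: inner_add_right field_simps add_eq_0_iff)
      then show ?thesis using t that by blast
    qed
  qed
  moreover have "\<forall>x\<in>span S. x \<bullet> (u + t *\<^sub>R w) = 0" using u(2) w(1) by (simp add: inner_add_right)
  ultimately show ?case by blast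
qed


subsection \<open>Tubes around toric hypersurfaces\<close>

lemma Ln_exp_ball: "s \<in> ball 0 1 \<Longrightarrow> Ln (exp s) = s"
proof -
  assume "s \<in> ball (0::complex) 1"
  then have "\<bar>Im s\<bar> < 1" using abs_Im_le_cmod[of s] by simp
  then have "- pi < Im s" "Im s \<le> pi" using pi_gt3 by linarith+
  then show ?thesis by (rule Ln_exp)
qed

text \<open>Written through the principal logarithm, which is continuous off the nonpositive reals,
  the image is visibly open. In the unit ball the imaginary part stays below 1, hence inside the
  principal strip.\<close>

lemma exp_image_ball: "exp ` ball 0 1 = (- \<real>\<^sub>\<le>\<^sub>0) \<inter> Ln -` ball (0::complex) 1"
proof (intro equalityI subsetI)
  fix u :: complex assume "u \<in> exp ` ball 0 1"
  then obtain s where s: "s \<in> ball 0 1" "u = exp s" by blast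
  then have "\<bar>Im s\<bar> < 1" using abs_Im_le_cmod[of s] by simp
  then have "cos (Im s) > 0" using pi_gt3 by (intro cos_gt_zero_pi) linarith+
  then have "Re u > 0" by (simp add: s(2) Re_exp)
  then have "u \<notin> \<real>\<^sub>\<le>\<^sub>0" by (auto simp: complex_nonpos_Reals_iff)
  then show "u \<in> (- \<real>\<^sub>\<le>\<^sub>0) \<inter> Ln -` ball 0 1" using s Ln_exp_ball by simp
next
  fix u :: complex assume u: "u \<in> (- \<real>\<^sub>\<le>\<^sub>0) \<inter> Ln -` ball 0 1"
  then have "u \<noteq> 0" by auto
  then have "u = exp (Ln u)" by simp
  then show "u \<in> exp ` ball 0 1" using u by blast
qed

lemma open_exp_ball: "open (exp ` ball (0::complex) 1)"
  unfolding exp_image_ball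
  by (intro continuous_open_preimage continuous_on_Ln) (auto simp: open_Compl)

definition tube_map :: "real ^ 'n \<Rightarrow> (complex ^ 'n) \<times> complex \<Rightarrow> complex ^ 'n" where
  "tube_map w = (\<lambda>(y, s). transl (cvec s w) y)"

text \<open>Along the tube \<open>chi v\<close> equals \<open>exp s\<close>, so its logarithm is the
  fibre coordinate, and flowing back by it gives the base point.\<close>

definition tube_inv :: "int ^ 'n \<Rightarrow> real ^ 'n \<Rightarrow> complex ^ 'n \<Rightarrow> (complex ^ 'n) \<times> complex" where
  "tube_inv v w z = (transl (cvec (- Ln (chi v z)) w) z, Ln (chi v z))"

lemma cvec_add: "cvec s w + cvec t w = cvec (s + t) w"
  by (simp add: cvec_def vec_eq_iff distrib_right)

lemma cvec_0 [simp]: "cvec 0 w = 0"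
  by (simp add: cvec_def vec_eq_iff)

lemma tube_ksub:
  assumes vw: "realv v \<bullet> w = 1" and Bw: "\<And>b. b \<in> B \<Longrightarrow> realv b \<bullet> w = 0"
  shows "tube (ksub B) (ksub (insert v B)) (tube_map w) (tube_inv v w)"
proof -
  let ?K = "ksub B" and ?K' = "ksub (insert v B)"
  have chi_tube: "chi b (transl (cvec s w) y) = chi b y" if "b \<in> B" "y \<in> ctorus" for b s y
    using that Bw by (simp add: chi_transl pair_cvec)
  have chi_v: "chi v (transl (cvec s w) y) = chi v y * exp s" if "y \<in> ctorus" for s y
    using that vw by (simp add: chi_transl pair_cvec)
  have K: "transl (cvec s w) y \<in> ?K \<longleftrightarrow> y \<in> ?K" for s y
    using chi_tube by (cases "y \<in> ctorus") (auto simp: ksub_def)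
  have K'T: "y \<in> ctorus \<and> chi v y = 1 \<and> y \<in> ?K" if "y \<in> ?K'" for y
    using that by (auto simp: ksub_def)
  have inv: "tube_inv v w (tube_map w z) = z" if z: "z \<in> ?K' \<times> ball 0 1" for z
  proof -
    obtain y s where ys: "z = (y, s)" by fastforce
    then have "Ln (chi v (transl (cvec s w) y)) = s"
      using z K'T[of y] chi_v[of y s] by (simp add: Ln_exp_ball)
    then show ?thesis by (simp add: ys tube_map_def tube_inv_def transl_transl cvec_add)
  qed
  have im: "tube_map w ` (?K' \<times> ball 0 1) = ?K \<inter> chi v -` (exp ` ball 0 1)"
  proof (intro equalityI subsetI)
    fix x assume "x \<in> tube_map w ` (?K' \<times> ball 0 1)"
    then obtain y s where "y \<in> ?K'" "s \<in> ball 0 1" "x = transl (cvec s w) y" by (auto simp: tube_map_def)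
    then show "x \<in> ?K \<inter> chi v -` (exp ` ball 0 1)"
      using K[of s y] K'T[of y] chi_v[of y s] by auto
  next
    fix x assume x: "x \<in> ?K \<inter> chi v -` (exp ` ball 0 1)"
    then obtain s where s: "s \<in> ball 0 1" "chi v x = exp s" by auto
    have "x \<in> ctorus" using x by (auto simp: ksub_def)
    then have "chi v (transl (cvec (- s) w) x) = 1" by (simp add: chi_v s(2) exp_minus)
    then have "transl (cvec (- s) w) x \<in> ?K'" using x K[of "- s" x] by (simp add: ksub_insert)
    moreover have "x = tube_map w (transl (cvec (- s) w) x, s)"
      by (simp add: tube_map_def transl_transl cvec_add)
    ultimately show "x \<in> tube_map w ` (?K' \<times> ball 0 1)" using s(1) by blast
  qed
  show ?thesis
  proof
    show "continuous_on (?K' \<times> ball 0 1) (tube_map w)"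
      unfolding tube_map_def case_prod_unfold
      by (intro continuous_on_transl continuous_on_cvec continuous_intros)
    show "tube_map w ` (?K' \<times> ball 0 1) \<subseteq> ?K" unfolding im by blast
    show "openin (tp ?K) (tube_map w ` (?K' \<times> ball 0 1))"
      unfolding im by (intro continuous_openin_preimage_gen continuous_on_chi ksub_ctorus open_exp_ball)
    have "continuous_on (?K \<inter> chi v -` (exp ` ball 0 1)) (chi v)"
      by (intro continuous_on_chi) (auto simp: ksub_def)
    moreover have "chi v z \<notin> \<real>\<^sub>\<le>\<^sub>0" if "z \<in> ?K \<inter> chi v -` (exp ` ball 0 1)" for z
      using that exp_image_ball by blast
    ultimately have "continuous_on (?K \<inter> chi v -` (exp ` ball 0 1)) (\<lambda>z. Ln (chi v z))"
      by (intro continuous_on_Ln') auto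
    then show "continuous_on (tube_map w ` (?K' \<times> ball 0 1)) (tube_inv v w)"
      unfolding im tube_inv_def
      by (intro continuous_on_Pair continuous_on_transl continuous_on_cvec continuous_on_minus continuous_on_id)
    show "tube_inv v w (tube_map w z) = z" if "z \<in> ?K' \<times> ball 0 1" for z using inv that .
    show "tube_map w (y, 0) = y" for y by (simp add: tube_map_def)
    show "s = 0" if "(y, s) \<in> ?K' \<times> ball 0 1" "tube_map w (y, s) \<in> ?K'" for y s
    proof -
      have "exp s = 1" using that K'T[of y] K'T[of "transl (cvec s w) y"] chi_v[of y s] by (simp add: tube_map_def)
      then show ?thesis using Ln_exp_ball[of s] that(1) by auto
    qed
    show "closedin (tp ?K) ?K'" by (rule closedin_ksub_insert)
  qed
qed

section \<open>Moving homology classes off hypersurfaces\<close>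

lemma ln_powi: "0 < x \<Longrightarrow> ln (x powi k) = of_int k * ln (x :: real)"
  by (cases "k \<ge> 0") (simp_all add: power_int_def ln_realpow ln_inverse)

text \<open>One homotopy performs retraction and translation together: it keeps the arguments of the
  coordinates and moves \<open>ln (norm (chi a z))\<close> linearly to
  \<open>realv a \<bullet> w\<close>. For characters of \<open>B\<close> both values are 0, so
  \<open>ksub B\<close> is preserved; at time 1 those of \<open>E\<close> acquire a modulus
  different from 1.\<close>

lemma arr_surj_base:
  fixes B E :: "(int ^ 'n) set"
  assumes "finite E" "\<And>e. e \<in> E \<Longrightarrow> realv e \<notin> span (realv ` B)"
  shows "inc_surj p (arr B E) {} (ksub B) {}"
proof -
  have "realv ` E \<inter> span (realv ` B) = {}" "finite (realv ` E)" using assms by auto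
  then obtain w where w: "\<And>x. x \<in> span (realv ` B) \<Longrightarrow> x \<bullet> w = 0" "\<And>e. e \<in> E \<Longrightarrow> realv e \<bullet> w \<noteq> 0"
    using generic_dual_vector[of "realv ` E" "realv ` B"] by auto
  define h :: "real \<times> (complex ^ 'n) \<Rightarrow> complex ^ 'n" where
    "h = (\<lambda>(t, z). transl (\<chi> i. of_real (t * (w $ i - ln (norm (z $ i))))) z)"
  have pair_h: "pair a (\<chi> i. of_real (t * (w $ i - ln (norm (z $ i)))))
      = of_real (t * (realv a \<bullet> w - ln (norm (chi a z))))" if z: "z \<in> ctorus" for a t z
  proof -
    have "ln (norm (chi a z)) = (\<Sum>i\<in>UNIV. ln (norm (z $ i) powi (a $ i)))"
      using z by (simp add: chi_def prod_norm[symmetric] ctorus_def ln_prod norm_power_int)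
    also have "\<dots> = (\<Sum>i\<in>UNIV. of_int (a $ i) * ln (norm (z $ i)))"
      using z by (intro sum.cong) (auto simp: ctorus_def ln_powi)
    finally show ?thesis
      by (simp add: pair_def realv_def inner_vec_def algebra_simps sum_subtractf sum_distrib_left)
  qed
  have chi_h: "chi a (h (t, z)) = chi a z * exp (of_real (t * (realv a \<bullet> w - ln (norm (chi a z)))))"
    if "z \<in> ctorus" for a t z
    unfolding h_def prod.case chi_transl[OF that] pair_h[OF that] ..
  have hK: "h (t, z) \<in> ksub B" if "z \<in> ksub B" for t z
    using that w(1) chi_h[of z] by (auto simp: ksub_def span_base h_def)
  have "h (1, z) \<in> arr B E" if z: "z \<in> ksub B" for z
  proof -
    have "chi e (h (1, z)) \<noteq> 1" if e: "e \<in> E" for e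
    proof
      assume "chi e (h (1, z)) = 1"
      then have "norm (chi e z) * exp (realv e \<bullet> w - ln (norm (chi e z))) = 1"
        using z chi_h[of z e 1] by (metis (no_types, lifting) ksub_ctorus mult_1 norm_exp_eq_Re norm_mult norm_one of_real_1 Re_complex_of_real subsetD)
      moreover have "norm (chi e z) > 0" using z by (auto simp: ksub_def)
      ultimately have "exp (realv e \<bullet> w) = 1" by (simp add: exp_diff)
      then show False using w(2)[OF e] by simp
    qed
    then show ?thesis using hK[OF z, of 1] by (simp add: arr_def)
  qed
  then have h1: "(\<lambda>z. h (1, z)) ` ksub B \<subseteq> arr B E" by blast
  have cont: "continuous_on ({0..1} \<times> ksub B) h"
    unfolding h_def case_prod_unfold
    by (intro continuous_on_transl continuous_on_vec_lambda continuous_intros) (auto simp: ksub_def ctorus_def)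
  have cont1: "continuous_on (ksub B) (\<lambda>z. h (1, z))"
    by (rule continuous_on_compose2[OF cont]) (auto intro!: continuous_intros)
  have "homotopic_with (\<lambda>h. h \<in> {} \<rightarrow> {}) (tp (ksub B)) (tp (ksub B)) id (\<lambda>z. h (1, z))"
    unfolding homotopic_with_def
  proof (rule exI[of _ h], intro conjI)
    have "continuous_map (tp ({0..1} \<times> ksub B)) (tp (ksub B)) h"
      using cont hK by (auto simp: continuous_map_in_subtopology)
    then show "continuous_map (prod_topology (top_of_set {0..1}) (tp (ksub B))) (tp (ksub B)) h"
      by (simp only: subtopology_Times[symmetric] prod_topology_euclidean)
    have "(\<chi> i. 0) = (0 :: complex ^ 'n)" by (simp add: vec_eq_iff)
    then show "\<forall>x. h (0, x) = id x" by (simp add: h_def)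
  qed auto
  then have homot: "hom_induced p (tp (ksub B)) {} (tp (ksub B)) {} id = hom_induced p (tp (ksub B)) {} (tp (ksub B)) {} (\<lambda>z. h (1, z))"
    by (rule homology_homotopy_axiom)
  show ?thesis
  proof (rule inc_surjI)
    fix y assume y: "y \<in> carrier (hm p (ksub B) {})"
    let ?x = "hom_induced p (tp (ksub B)) {} (tp (arr B E)) {} (\<lambda>z. h (1, z)) y"
    have "inc p (arr B E) {} (ksub B) {} ?x = hom_induced p (tp (ksub B)) {} (tp (ksub B)) {} (\<lambda>z. h (1, z)) y"
      by (rule inc_hom_induced[OF cont1 h1]) (auto simp: arr_def)
    also have "\<dots> = y" unfolding homot[symmetric] using y by (rule hom_induced_id)
    finally show "\<exists>x\<in>carrier (hm p (arr B E) {}). inc p (arr B E) {} (ksub B) {} x = y"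
      using hom_induced_carrier by blast
  qed
qed

text \<open>Induction on \<open>X\<close> with \<open>B\<close>, \<open>E\<close> and the degree
  free. When \<open>v\<close> is independent of \<open>B\<close>, absolute classes use the
  hypothesis for \<open>insert v E\<close> over the same \<open>B\<close>, relative classes use it
  over \<open>insert v B\<close> in degree \<open>p - 1\<close>.\<close>

lemma arr_surj:
  fixes B X E :: "(int ^ 'n) set"
  assumes "finite X" "finite E" "\<And>e. e \<in> E \<Longrightarrow> realv e \<notin> span (realv ` B)"
  shows "inc_surj p (arr B (X \<union> E)) {} (arr B X) {}"
  using assms
proof (induction X arbitrary: B E p rule: finite_induct)
  case empty
  moreover have "arr B {} = ksub B" by (simp add: arr_def)
  ultimately show ?case using arr_surj_base[OF empty.prems] by simp
next
  case (insert v X)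
  let ?K = "ksub B" and ?K' = "ksub (insert v B)"
  define A where "A = arr B X"
  have opA: "openin (tp ?K) A" unfolding A_def using insert by (intro openin_arr)
  have U: "arr B (insert v X) = A - ?K'" unfolding A_def by (rule arr_insert)
  show ?case
  proof (cases "realv v \<in> span (realv ` B)")
    case True
    have "openin (tp A) (A - ?K')" "openin (tp A) (A \<inter> ?K')"
      unfolding A_def using arr_clopen[OF insert.hyps(1) True] .
    moreover have "inc_surj p (arr B (X \<union> E)) {} A {}"
      unfolding A_def by (rule insert.IH[OF insert.prems(1)]) (rule insert.prems(2))
    ultimately have "inc_surj p (arr B (X \<union> E) \<inter> (A - ?K')) {} (A - ?K') {}"
      by (intro inc_surj_clopen[of A "A - ?K'" "A \<inter> ?K'" "arr B (X \<union> E)"]) (auto simp: A_def arr_def)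
    moreover have "arr B (X \<union> E) \<inter> (A - ?K') = arr B (insert v X \<union> E)"
      by (auto simp: A_def arr_def ksub_insert)
    ultimately show ?thesis unfolding U by simp
  next
    case False
    obtain w where w: "realv v \<bullet> w = 1" "\<And>x. x \<in> span (realv ` B) \<Longrightarrow> x \<bullet> w = 0"
      using dual_vector[OF False] by blast
    interpret tube ?K ?K' "tube_map w" "tube_inv v w"
      by (rule tube_ksub[OF w(1)], rule w(2), rule span_base) blast
    \<comment> \<open>The members of \<open>E\<close> that remain independent of the relations after
      \<open>v\<close> is added; only these can be avoided on the hypersurface of
      \<open>v\<close>.\<close>
    define E1 where "E1 = {e \<in> E. realv e \<notin> span (realv ` insert v B)}"
    have E1E: "E1 \<subseteq> E" by (auto simp: E1_def)
    let ?bad = "\<lambda>e. ksub (insert e B) - ksub (insert v (insert e B))"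
    \<comment> \<open>For the other members only the part of their hypersurface off
      \<open>?K'\<close> is removed. Thus \<open>A2\<close> meets \<open>?K'\<close> in an
      arrangement covered by the induction hypothesis, and yet \<open>A2 - ?K'\<close> avoids all of
      \<open>E\<close>.\<close>
    define A2 where "A2 = A - (\<Union>e\<in>E1. ksub (insert e B)) - (\<Union>e\<in>E - E1. ?bad e)"
    have "closedin (tp ?K) (?bad e)" if "e \<in> E - E1" for e
    proof -
      have "realv e \<in> span (insert (realv v) (realv ` B))" "realv e \<notin> span (realv ` B)"
        using that insert.prems(2) by (auto simp: E1_def)
      \<comment> \<open>Exchange: modulo the span of \<open>B\<close> the vectors \<open>v\<close>
        and \<open>e\<close> are proportional, so \<open>chi v\<close> has finite order on the
        hypersurface of \<open>e\<close>, and the removed part is closed.\<close>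
      then have "realv v \<in> span (realv ` insert e B)" by (simp add: in_span_insert)
      then have "closedin (tp (ksub (insert e B))) (?bad e)" by (rule closedin_ksub_diff)
      then show ?thesis using closedin_ksub_insert closedin_trans by blast
    qed
    then have "closedin (tp ?K) (\<Union>e\<in>E - E1. ?bad e)" using insert.prems(1) by (intro closedin_Union) auto
    moreover have "closedin (tp ?K) (\<Union>e\<in>E1. ksub (insert e B))"
      using insert.prems(1) closedin_ksub_insert by (intro closedin_Union) (auto simp: E1_def)
    ultimately have opA2: "openin (tp ?K) A2" unfolding A2_def using opA by (intro openin_diff)
    have A2A: "A2 \<subseteq> A" by (auto simp: A2_def)
    have U2: "A2 - ?K' = arr B (insert v X \<union> E)"
      using E1E by (auto simp: A2_def A_def arr_def ksub_insert)
    have Y2: "A2 \<inter> ?K' = arr (insert v B) (X \<union> E1)"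
      by (auto simp: A2_def A_def arr_def ksub_insert)
    have Y: "A \<inter> ?K' = arr (insert v B) X" unfolding A_def by (rule arr_insert_left[symmetric])
    have "inc_surj (p + 1 - 2) (A2 \<inter> ?K') {} (A \<inter> ?K') {}"
      unfolding Y Y2 by (rule insert.IH) (use insert.prems in \<open>auto simp: E1_def\<close>)
    then have rel: "inc_surj (p + 1) A2 (A2 - ?K') A (A - ?K')"
      by (rule tube_thom_surj[OF opA opA2 A2A])
    \<comment> \<open>Adding \<open>v\<close> to \<open>E\<close> makes the lift of a class of
      \<open>A\<close> avoid \<open>?K'\<close> as well.\<close>
    have "inc_surj p (arr B (X \<union> insert v E)) {} (arr B X) {}"
      by (rule insert.IH) (use insert.prems False in auto)
    then have lift: "inc_surj p (A2 - ?K') {} A {}" unfolding U2 A_def by simp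
    have "inc_surj p (A2 - ?K') {} (A - ?K') {}"
      by (rule inc_surj_deletion[OF _ _ A2A _ lift rel]) (use A2A in auto)
    then show ?thesis unfolding U U2 .
  qed
qed

lemma has_poincare_arr_insert:
  fixes B X :: "(int ^ 'n) set"
  assumes "finite X" "realv v \<notin> span (realv ` B)"
    and "has_poincare (arr B X) P" "has_poincare (arr (insert v B) X) Q"
  shows "has_poincare (arr B (insert v X)) (P + pCons 0 Q)"
proof -
  let ?K = "ksub B" and ?K' = "ksub (insert v B)"
  obtain w where w: "realv v \<bullet> w = 1" "\<And>x. x \<in> span (realv ` B) \<Longrightarrow> x \<bullet> w = 0"
    using dual_vector[OF assms(2)] by blast
  interpret tube ?K ?K' "tube_map w" "tube_inv v w"
    by (rule tube_ksub[OF w(1)], rule w(2), rule span_base) blast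
  have surj: "inc_surj p (arr B X - ?K') {} (arr B X) {}" for p
    using arr_surj[OF assms(1), of "{v}" B p] assms(2) by (simp add: arr_insert[symmetric])
  show ?thesis
    unfolding arr_insert
  proof (rule has_poincare_deletion[OF _ surj tube_thom_iso assms(3)])
    show "openin (tp ?K) (arr B X)" by (rule openin_arr[OF assms(1)])
    show "has_poincare (arr B X \<inter> ?K') Q" using assms(4) unfolding arr_insert_left .
  qed auto
qed

lemma has_poincare_arr_insert_dependent:
  fixes B X :: "(int ^ 'n) set"
  assumes "finite X" "realv v \<in> span (realv ` B)"
    and "has_poincare (arr B X) P" "has_poincare (arr (insert v B) X) Q"
  shows "has_poincare (arr B (insert v X)) (P - Q)"
  unfolding arr_insert using assms(3,4) arr_clopen[OF assms(1,2)]
  by (intro has_poincare_clopen_diff[of "arr B X" _ "arr B X \<inter> ksub (insert v B)"])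
    (auto simp: arr_insert_left)

section \<open>Characters of finite abelian groups\<close>

text \<open>\<open>H\<close> ranges over subsets of one ambient group, so that characters can be
  extended along growing subgroups; extensionality makes counting them meaningful.\<close>

definition chars :: "('a, 'b) monoid_scheme \<Rightarrow> 'a set \<Rightarrow> ('a \<Rightarrow> complex) set" where
  "chars G H = {f \<in> extensional H. (\<forall>x\<in>H. f x \<noteq> 0) \<and> (\<forall>x\<in>H. \<forall>y\<in>H. f (x \<otimes>\<^bsub>G\<^esub> y) = f x * f y)}"

context comm_group
begin

lemma chars_one:
  assumes "subgroup H G" "f \<in> chars G H"
  shows "f \<one> = 1"
proof -
  have "\<one> \<in> H" using assms(1) by (rule subgroup.one_closed)
  then have "f (\<one> \<otimes> \<one>) = f \<one> * f \<one>" and "f \<one> \<noteq> 0" using assms(2) unfolding chars_def by blast+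
  then show ?thesis by simp
qed

lemma chars_pow:
  assumes "subgroup H G" "f \<in> chars G H" "x \<in> H"
  shows "f (x [^] (n::nat)) = f x ^ n"
proof (induction n)
  case 0
  then show ?case using chars_one[OF assms(1,2)] by simp
next
  case (Suc n)
  have x: "x \<in> carrier G" using assms subgroup.subset by blast
  have "x [^] n \<in> H"
    using assms(1,3) by (induction n) (auto simp: subgroup.one_closed subgroup.m_closed)
  then have "f (x [^] n \<otimes> x) = f (x [^] n) * f x" using assms by (auto simp: chars_def)
  then show ?case using Suc by simp
qed

text \<open>A character of \<open>H\<close> extends to \<open>\<langle>H, x\<rangle>\<close> in as many ways as there are choices of a root for
  the value at \<open>x\<close>.\<close>

lemma chars_extend:
  assumes fin: "finite (carrier G)" and H: "subgroup H G" and x: "x \<in> carrier G" "x \<notin> H"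
    and card: "card (chars G H) = card H"
  shows "\<exists>H'. subgroup H' G \<and> card H < card H' \<and> card (chars G H') = card H'"
proof -
  interpret H: subgroup H G by (rule H)
  have HG: "h \<in> carrier G" if "h \<in> H" for h using that by (rule H.mem_carrier)
  \<comment> \<open>The order of \<open>x\<close> modulo \<open>H\<close>: the value of
    \<open>x [^] d\<close> is the only constraint on an extension at \<open>x\<close>.\<close>
  define d where "d = (LEAST d::nat. 0 < d \<and> x [^] d \<in> H)"
  have "0 < order G \<and> x [^] order G \<in> H"
    using fin x(1) by (simp add: pow_order_eq_1 order_gt_0_iff_finite)
  then have d: "0 < d" "x [^] d \<in> H" and least: "\<And>n. 0 < n \<Longrightarrow> n < d \<Longrightarrow> x [^] n \<notin> H"
    unfolding d_def using LeastI[of "\<lambda>d. 0 < d \<and> x [^] d \<in> H" "order G"]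
    by (auto dest: not_less_Least)
  have d2: "1 < d"
  proof (rule ccontr)
    assume "\<not> 1 < d"
    then have "d = 1" using d(1) by simp
    then show False using d(2) x by simp
  qed
  define e where "e = (\<lambda>(h, j::nat). h \<otimes> x [^] j)"
  let ?P = "H \<times> {..<d}"
  define H' where "H' = e ` ?P"
  \<comment> \<open>Uniqueness of the normal form: different exponents below \<open>d\<close> would
    produce a smaller positive power of \<open>x\<close> in \<open>H\<close>.\<close>
  have aux: "j \<le> i" if "h \<in> H" "h' \<in> H" "i < d" "j < d" "h \<otimes> x [^] i = h' \<otimes> x [^] j" for h h' i j
  proof (rule ccontr)
    assume "\<not> j \<le> i"
    then have ij: "0 < j - i" "j - i < d" "j = (j - i) + i" using that by auto
    have "h \<otimes> x [^] i = (h' \<otimes> x [^] (j - i)) \<otimes> x [^] i"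
      using that(5) x(1) HG[OF that(2)] ij(3) by (metis m_assoc nat_pow_closed nat_pow_mult)
    then have "h = h' \<otimes> x [^] (j - i)" using x(1) HG that(1,2) by (metis m_closed nat_pow_closed right_cancel)
    then have "x [^] (j - i) = inv h' \<otimes> h" using x(1) HG that(1,2) by (metis inv_solve_left nat_pow_closed)
    then have "x [^] (j - i) \<in> H" using that by simp
    then show False using least ij by blast
  qed
  have inj: "inj_on e ?P"
  proof (rule inj_onI)
    fix a b assume ab: "a \<in> ?P" "b \<in> ?P" "e a = e b"
    obtain h i h' j where *: "a = (h, i)" "b = (h', j)" by (metis surj_pair)
    have "i = j" using aux[of h h' i j] aux[of h' h j i] ab by (simp add: * e_def)
    moreover from this have "h = h'" using ab x(1) HG by (auto simp: * e_def)
    ultimately show "a = b" by (simp add: *)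
  qed
  \<comment> \<open>Exponents are reduced modulo \<open>d\<close>; the quotient \<open>k\<close>
    moves a power of \<open>x [^] d\<close> into the factor from \<open>H\<close>.\<close>
  have e_mult: "\<exists>k. (h \<otimes> x [^] i) \<otimes> (h' \<otimes> x [^] j) = e ((h \<otimes> h') \<otimes> (x [^] d) [^] k, i + j - k * d)
       \<and> k * d \<le> i + j \<and> i + j - k * d < d"
    if "h \<in> H" "h' \<in> H" for h h' i j
  proof (intro exI conjI)
    let ?k = "(i + j) div d"
    show "?k * d \<le> i + j" by simp
    show "i + j - ?k * d < d" using d(1) by (simp add: minus_div_mult_eq_mod)
    have "(h \<otimes> x [^] i) \<otimes> (h' \<otimes> x [^] j) = (h \<otimes> h') \<otimes> (x [^] i \<otimes> x [^] j)"
      using x(1) HG that by (simp add: m_ac)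
    also have "x [^] i \<otimes> x [^] j = (x [^] d) [^] ?k \<otimes> x [^] (i + j - ?k * d)"
    proof -
      have "d * ?k + (i + j - ?k * d) = i + j" by (simp add: mult.commute)
      then show ?thesis
        using nat_pow_pow[OF x(1), of d ?k] nat_pow_mult[OF x(1), of "d * ?k" "i + j - ?k * d"]
          nat_pow_mult[OF x(1), of i j] by simp
    qed
    finally show "(h \<otimes> x [^] i) \<otimes> (h' \<otimes> x [^] j) = e ((h \<otimes> h') \<otimes> (x [^] d) [^] ?k, i + j - ?k * d)"
      using x(1) HG that by (simp add: e_def m_assoc)
  qed
  have powH: "(x [^] d) [^] (k::nat) \<in> H" for k
    using d(2) by (induction k) auto
  have memH': "\<exists>h\<in>H. \<exists>j<d. y = h \<otimes> x [^] j" if "y \<in> H'" for y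
    using that by (auto simp: H'_def e_def)
  have H'sub: "subgroup H' G"
  proof (rule subgroupI)
    show "H' \<subseteq> carrier G" using HG x(1) by (auto simp: H'_def e_def)
    show "H' \<noteq> {}" using d(1) H.one_closed unfolding H'_def by blast
    show "a \<otimes> b \<in> H'" if ab: "a \<in> H'" "b \<in> H'" for a b
    proof -
      obtain h and i :: nat where "h \<in> H" "a = h \<otimes> x [^] i" using memH'[OF ab(1)] by blast
      moreover obtain h' and j :: nat where "h' \<in> H" "b = h' \<otimes> x [^] j" using memH'[OF ab(2)] by blast
      ultimately have *: "h \<in> H" "h' \<in> H" "a = h \<otimes> x [^] i" "b = h' \<otimes> x [^] j" by simp_all
      obtain k where k: "a \<otimes> b = e ((h \<otimes> h') \<otimes> (x [^] d) [^] k, i + j - k * d)" "i + j - k * d < d"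
        using e_mult[OF *(1,2), of i j] * by auto
      have "(h \<otimes> h') \<otimes> (x [^] d) [^] k \<in> H" using *(1,2) powH by blast
      then show ?thesis unfolding k(1) H'_def using k(2) by blast
    qed
    show "inv a \<in> H'" if aH: "a \<in> H'" for a
    proof -
      obtain h i where *: "h \<in> H" "i < d" "a = h \<otimes> x [^] i" using memH'[OF aH] by blast
      show ?thesis
      proof (cases "i = 0")
        case True
        then have "inv a = e (inv h, 0)" using * HG by (simp add: e_def)
        then show ?thesis using * d(1) unfolding H'_def by (intro image_eqI[of _ _ "(inv h, 0)"]) auto
      next
        case False
        \<comment> \<open>The normal form of an inverse uses the exponent \<open>d - i\<close>,
          compensated by the inverse of \<open>x [^] d\<close>; for \<open>i = 0\<close> this
          exponent would not be below \<open>d\<close>, hence the separate case.\<close>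
        have "a \<otimes> e (inv h \<otimes> inv (x [^] d), d - i) = (h \<otimes> inv h) \<otimes> (inv (x [^] d) \<otimes> (x [^] i \<otimes> x [^] (d - i)))"
        proof -
          have "(p \<otimes> y) \<otimes> ((q \<otimes> z) \<otimes> u) = (p \<otimes> q) \<otimes> (z \<otimes> (y \<otimes> u))"
            if "p \<in> carrier G" "y \<in> carrier G" "q \<in> carrier G" "z \<in> carrier G" "u \<in> carrier G" for p q y z u
            using that by (simp add: m_ac)
          then show ?thesis unfolding e_def prod.case *(3) using HG[OF *(1)] x(1) by simp
        qed
        also have "x [^] i \<otimes> x [^] (d - i) = x [^] d" using * x(1) by (simp add: nat_pow_mult)
        finally have "a \<otimes> e (inv h \<otimes> inv (x [^] d), d - i) = \<one>" using * HG x(1) by simp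
        then have "inv a = e (inv h \<otimes> inv (x [^] d), d - i)"
          using * HG x(1) by (intro inv_equality) (auto simp: e_def m_comm)
        then show ?thesis using * False d unfolding H'_def by (intro image_eqI) auto
      qed
    qed
  qed
  have finH: "finite H" using fin H.subset finite_subset by blast
  have cardH': "card H' = card H * d"
    unfolding H'_def using card_image[OF inj] by (simp add: card_cartesian_product)
  have "0 < card H" using finH H.one_closed by (metis card_gt_0_iff empty_iff)
  let ?S = "SIGMA f:chars G H. {c. c ^ d = f (x [^] d)}"
  \<comment> \<open>\<open>inv_into\<close> reads off the normal form, on which the extension with
    value \<open>c\<close> at \<open>x\<close> is forced.\<close>
  define ext where "ext = (\<lambda>(f :: 'a \<Rightarrow> complex, c :: complex). restrict (\<lambda>y. case inv_into ?P e y of (h, j) \<Rightarrow> f h * c ^ j) H')"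
  have ext_e: "ext (f, c) (h \<otimes> x [^] j) = f h * c ^ j" if "h \<in> H" "j < d" for f c h j
  proof -
    have "inv_into ?P e (e (h, j)) = (h, j)" using that by (intro inv_into_f_f inj) auto
    moreover have "e (h, j) \<in> H'" unfolding H'_def using that by (intro imageI) auto
    ultimately show ?thesis by (simp add: ext_def e_def)
  qed
  have ext_H: "ext (f, c) h = f h" if "h \<in> H" for f c h
    using ext_e[OF that d(1), of f c] HG[OF that] by simp
  have ext_x: "ext (f, c) x = c" if "f \<in> chars G H" for f c
    using ext_e[OF H.one_closed d2, of f c] chars_one[OF H that] x(1) by simp
  have ext_chars: "ext (f, c) \<in> chars G H'" if f: "f \<in> chars G H" and c: "c ^ d = f (x [^] d)" for f c
  proof -
    have fm: "f (a \<otimes> b) = f a * f b" "f a \<noteq> 0" if "a \<in> H" "b \<in> H" for a b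
      using f that by (auto simp: chars_def)
    have "f (x [^] d) \<noteq> 0" using fm(2) d(2) by blast
    then have c0: "c \<noteq> 0" using c d(1) by (metis zero_power)
    have "ext (f, c) (a \<otimes> b) = ext (f, c) a * ext (f, c) b" if ab: "a \<in> H'" "b \<in> H'" for a b
    proof -
      obtain h i where hi: "h \<in> H" "i < d" "a = h \<otimes> x [^] i" using memH'[OF ab(1)] by blast
      obtain h' j where hj: "h' \<in> H" "j < d" "b = h' \<otimes> x [^] j" using memH'[OF ab(2)] by blast
      obtain k where k: "a \<otimes> b = e ((h \<otimes> h') \<otimes> (x [^] d) [^] k, i + j - k * d)" "k * d \<le> i + j" "i + j - k * d < d"
        using e_mult[OF hi(1) hj(1), of i j] hi(3) hj(3) by auto
      have "ext (f, c) (a \<otimes> b) = f ((h \<otimes> h') \<otimes> (x [^] d) [^] k) * c ^ (i + j - k * d)"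
        unfolding k(1) e_def prod.case using hi hj powH k(3) by (intro ext_e) auto
      also have "f ((h \<otimes> h') \<otimes> (x [^] d) [^] k) = f h * f h' * (c ^ d) ^ k"
        using hi hj powH d(2) by (simp add: fm chars_pow[OF H f] c)
      also have "f h * f h' * (c ^ d) ^ k * c ^ (i + j - k * d) = f h * f h' * c ^ (i + j)"
        using k(2) by (simp add: power_mult[symmetric] power_add[symmetric] mult.commute[of d])
      also have "\<dots> = ext (f, c) a * ext (f, c) b"
        unfolding hi(3) hj(3) using ext_e hi hj by (simp add: power_add)
      finally show ?thesis .
    qed
    moreover have "ext (f, c) a \<noteq> 0" if "a \<in> H'" for a
      using memH'[OF that] ext_e fm(2) c0 by fastforce
    ultimately show ?thesis by (auto simp: chars_def ext_def)
  qed
  have "bij_betw ext ?S (chars G H')"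
  proof (rule bij_betwI')
    fix p q assume p: "p \<in> ?S" and q: "q \<in> ?S"
    obtain f c g c' where *: "p = (f, c)" "q = (g, c')" by (metis surj_pair)
    show "(ext p = ext q) = (p = q)"
    proof
      assume eq: "ext p = ext q"
      have "f h = g h" if "h \<in> H" for h using ext_H[OF that] eq unfolding * by metis
      moreover have "f \<in> extensional H" "g \<in> extensional H" using p q by (auto simp: * chars_def)
      ultimately have "f = g" by (intro extensionalityI) auto
      moreover have "c = c'" using ext_x[of f c] ext_x[of g c'] eq p q by (auto simp: *)
      ultimately show "p = q" by (simp add: *)
    qed simp
  next
    fix p assume "p \<in> ?S"
    then show "ext p \<in> chars G H'" using ext_chars by auto
  next
    fix g assume g: "g \<in> chars G H'"
    have HH': "H \<subseteq> H'"
    proof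
      fix h assume "h \<in> H"
      then show "h \<in> H'" unfolding H'_def using d(1) HG by (intro image_eqI[of _ _ "(h, 0)"]) (auto simp: e_def)
    qed
    have xH': "x \<in> H'"
      unfolding H'_def using d2 x(1) by (intro image_eqI[of _ _ "(\<one>, 1)"]) (auto simp: e_def)
    let ?f = "restrict g H"
    have f: "?f \<in> chars G H" using g HH' by (auto simp: chars_def)
    have root: "g x ^ d = ?f (x [^] d)" using chars_pow[OF H'sub g xH', of d] d(2) by simp
    have "ext (?f, g x) y = g y" if y: "y \<in> H'" for y
    proof -
      obtain h j where hj: "h \<in> H" "j < d" "y = h \<otimes> x [^] j" using memH'[OF y] by blast
      have "x [^] j \<in> H'" using xH' H'sub by (induction j) (auto simp: subgroup.one_closed subgroup.m_closed)
      then have "g y = g h * g (x [^] j)" using g hj HH' by (auto simp: chars_def)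
      then show ?thesis using hj ext_e[OF hj(1,2)] chars_pow[OF H'sub g xH'] by simp
    qed
    then have "g = ext (?f, g x)"
      using g by (intro extensionalityI[of _ H']) (auto simp: chars_def ext_def)
    then show "\<exists>p\<in>?S. g = ext p" using f root by (intro bexI[of _ "(?f, g x)"]) auto
  qed
  then have "card (chars G H') = card ?S" by (metis bij_betw_same_card)
  also have "\<dots> = (\<Sum>f\<in>chars G H. card {c. c ^ d = f (x [^] d)})"
  proof (rule card_SigmaI)
    show "finite (chars G H)" using card \<open>0 < card H\<close> by (intro card_ge_0_finite) simp
    show "\<forall>f\<in>chars G H. finite {c. c ^ d = f (x [^] d)}" using d(1) by (auto intro!: finite_nth_roots)
  qed
  also have "\<dots> = (\<Sum>f\<in>chars G H. d)"
    using d by (intro sum.cong) (auto simp: chars_def intro!: card_nth_roots)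
  finally have "card (chars G H') = card H'" using card cardH' by simp
  moreover have "card H < card H'" using cardH' d2 \<open>0 < card H\<close> by simp
  ultimately show ?thesis using H'sub by blast
qed

text \<open>A subgroup of largest order with as many characters as elements is the whole group, as
  otherwise it could be enlarged.\<close>

lemma card_chars:
  assumes fin: "finite (carrier G)"
  shows "card (chars G (carrier G)) = card (carrier G)"
proof -
  let ?Q = "\<lambda>H. subgroup H G \<and> card (chars G H) = card H"
  have "chars G {\<one>} = {restrict (\<lambda>_. 1) {\<one>}}"
  proof (intro equalityI subsetI)
    fix f assume f: "f \<in> chars G {\<one>}"
    then have "f \<one> = 1" using chars_one triv_subgroup by blast
    then have "f = restrict (\<lambda>_. 1) {\<one>}" using f by (intro extensionalityI[of _ "{\<one>}"]) (auto simp: chars_def)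
    then show "f \<in> {restrict (\<lambda>_. 1) {\<one>}}" by simp
  qed (auto simp: chars_def)
  then have "?Q {\<one>}" using triv_subgroup by simp
  moreover have "card H \<le> card (carrier G)" if "?Q H" for H
    using that fin subgroup.subset by (intro card_mono) auto
  ultimately obtain H where H: "?Q H" "\<And>H'. ?Q H' \<Longrightarrow> card H' \<le> card H"
    using ex_has_greatest_nat[of ?Q "{\<one>}" card "Suc (card (carrier G))"] by (metis (no_types, lifting) less_Suc_eq_le)
  have "carrier G \<subseteq> H"
  proof
    fix x assume x: "x \<in> carrier G"
    show "x \<in> H"
    proof (rule ccontr)
      assume "x \<notin> H"
      then obtain H' where "subgroup H' G" "card H < card H'" "card (chars G H') = card H'"
        using chars_extend[OF fin _ x] H(1) by blast
      then show False using H(2)[of H'] by simp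
    qed
  qed
  then have "H = carrier G" using H(1) subgroup.subset by blast
  then show ?thesis using H(1) by simp
qed

end

subsection \<open>Lattices and cosets\<close>

abbreviation zspan :: "(int ^ 'n) set \<Rightarrow> (int ^ 'n) set" where
  "zspan B \<equiv> generate Lat B"

definition dot :: "int ^ 'n \<Rightarrow> int ^ 'n \<Rightarrow> int" where
  "dot a b = (\<Sum>i\<in>UNIV. a $ i * b $ i)"

definition sat :: "(int ^ 'n) set \<Rightarrow> (int ^ 'n) set" where
  "sat B = {l. realv l \<in> span (realv ` B)}"

text \<open>Index of the sublattice generated by \<open>B\<close> in its saturation, that is, the
  multiplicity \<open>m(B)\<close> when the torsion part is trivial.\<close>

definition msat :: "(int ^ 'n) set \<Rightarrow> nat" where
  "msat B = card ((\<lambda>l. (+) l ` zspan B) ` sat B)"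

lemma comm_group_Lat: "comm_group (Lat :: (int ^ 'n) monoid)"
  by (rule comm_groupI) (auto simp: Lat_def add_ac intro: exI[of _ "- _"])

lemma Lat_simps [simp]: "carrier Lat = UNIV" "x \<otimes>\<^bsub>Lat\<^esub> y = x + y" "\<one>\<^bsub>Lat\<^esub> = 0"
  by (simp_all add: Lat_def)

lemma inv_Lat [simp]: "inv\<^bsub>Lat\<^esub> (x :: int ^ 'n) = - x"
proof -
  interpret comm_group "Lat :: (int ^ 'n) monoid" by (rule comm_group_Lat)
  show ?thesis by (rule inv_equality) auto
qed

lemma zspan_0 [simp]: "0 \<in> zspan B"
  using generate.one[of Lat B] by simp

lemma zspan_add: "x \<in> zspan B \<Longrightarrow> y \<in> zspan B \<Longrightarrow> x + y \<in> zspan B"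
  using generate.eng[of x Lat B y] by simp

lemma zspan_minus: "x \<in> zspan B \<Longrightarrow> - x \<in> zspan (B :: (int ^ 'n) set)"
proof -
  interpret comm_group "Lat :: (int ^ 'n) monoid" by (rule comm_group_Lat)
  assume "x \<in> zspan B"
  then show ?thesis using generate_m_inv_closed[of B x] by simp
qed

lemma zspan_base: "b \<in> B \<Longrightarrow> b \<in> zspan B"
  by (rule generate.incl)

lemma zspan_scale: "x \<in> zspan B \<Longrightarrow> k *s x \<in> zspan (B :: (int ^ 'n) set)"
proof -
  assume x: "x \<in> zspan B"
  have nat: "int m *s x \<in> zspan B" for m
  proof (induction m)
    case (Suc m)
    have "int (Suc m) *s x = x + int m *s x" by (simp add: vec_eq_iff algebra_simps)
    then show ?case using zspan_add[OF x Suc] by simp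
  qed simp
  show ?thesis
  proof (cases "k \<ge> 0")
    case True
    then show ?thesis using nat[of "nat k"] by simp
  next
    case False
    then have "k *s x = - (int (nat (- k)) *s x)" by (simp add: vec_eq_iff)
    then show ?thesis using zspan_minus[OF nat[of "nat (- k)"]] by simp
  qed
qed

lemma zspan_sum: "(\<And>i. i \<in> S \<Longrightarrow> f i \<in> zspan B) \<Longrightarrow> (\<Sum>i\<in>S. f i) \<in> zspan (B :: (int ^ 'n) set)"
  by (induction S rule: infinite_finite_induct) (auto intro: zspan_add)

lemma zspan_mono: "A \<subseteq> B \<Longrightarrow> zspan A \<subseteq> zspan (B :: (int ^ 'n) set)"
proof -
  interpret comm_group "Lat :: (int ^ 'n) monoid" by (rule comm_group_Lat)
  show "A \<subseteq> B \<Longrightarrow> ?thesis" using mono_generate by blast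
qed

lemma zspan_induct [consumes 1, case_names zero base minus add]:
  assumes "x \<in> zspan (B :: (int ^ 'n) set)" "P 0" "\<And>b. b \<in> B \<Longrightarrow> P b" "\<And>b. b \<in> B \<Longrightarrow> P (- b)"
    "\<And>x y. P x \<Longrightarrow> P y \<Longrightarrow> P (x + y)"
  shows "P x"
  using assms(1) by (induction rule: generate.induct) (use assms(2-) in auto)

lemma zspan_insertE:
  assumes "x \<in> zspan (insert v B)"
  obtains y k where "y \<in> zspan B" "x = y + k *s (v :: int ^ 'n)"
proof -
  have "\<exists>y k. y \<in> zspan B \<and> x = y + k *s v"
    using assms
  proof (induction rule: zspan_induct)
    case zero
    then show ?case by (intro exI[of _ 0] exI[of _ 0]) (simp add: vec_eq_iff)
  next
    case (base b)
    have "v = 0 + 1 *s v" "b = b + 0 *s v" by (simp_all add: vec_eq_iff)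
    then show ?case using base zspan_base[of b B] zspan_0[of B] by blast
  next
    case (minus b)
    have "- v = 0 + (- 1) *s v" "- b = - b + 0 *s v" by (simp_all add: vec_eq_iff)
    then show ?case using minus zspan_minus[OF zspan_base, of b B] zspan_0[of B] by blast
  next
    case (add x y)
    then obtain a k b m where *: "a \<in> zspan B" "b \<in> zspan B" "x = a + k *s v" "y = b + m *s v" by blast
    then have "x + y = (a + b) + (k + m) *s v" by (simp add: vec_eq_iff algebra_simps)
    then show ?case using zspan_add[OF *(1,2)] by blast
  qed
  then show ?thesis using that by blast
qed

lemma chi_zspan: "z \<in> ksub B \<Longrightarrow> l \<in> zspan B \<Longrightarrow> chi l z = 1"
proof -
  assume z: "z \<in> ksub B" and "l \<in> zspan B"
  then have zc: "z \<in> ctorus" by (simp add: ksub_def)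
  show ?thesis
    using \<open>l \<in> zspan B\<close>
    by (induction rule: zspan_induct) (use z zc in \<open>auto simp: ksub_def chi_add chi_minus\<close>)
qed

lemma coset_eq_iff: "(+) l ` zspan B = (+) m ` zspan B \<longleftrightarrow> l - m \<in> zspan (B :: (int ^ 'n) set)"
proof
  assume eq: "(+) l ` zspan B = (+) m ` zspan B"
  have "l + 0 \<in> (+) l ` zspan B" by (intro imageI) simp
  then have "l \<in> (+) m ` zspan B" using eq by simp
  then show "l - m \<in> zspan B" by auto
next
  have sub: "(+) l ` zspan B \<subseteq> (+) m ` zspan B" if d: "l - m \<in> zspan B" for l m :: "int ^ 'n"
  proof (rule image_subsetI)
    fix x assume "x \<in> zspan B"
    then have "(l - m) + x \<in> zspan B" using zspan_add d by blast
    then show "l + x \<in> (+) m ` zspan B" by (intro image_eqI[of _ _ "(l - m) + x"]) auto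
  qed
  assume "l - m \<in> zspan B"
  moreover from this have "m - l \<in> zspan B" using zspan_minus by fastforce
  ultimately show "(+) l ` zspan B = (+) m ` zspan B" using sub by blast
qed

lemma dot_add_left: "dot (a + b) c = dot a c + dot b c"
  by (simp add: dot_def distrib_right sum.distrib)

lemma dot_scale_left: "dot (k *s a) c = k * dot a c"
  by (simp add: dot_def sum_distrib_left mult.assoc)

lemma dot_diff_left: "dot (a - b) c = dot a c - dot b c"
  by (simp add: dot_def left_diff_distrib sum_subtractf)

lemma dot_minus_left: "dot (- a) c = - dot a c"
  by (simp add: dot_def sum_negf)

lemma realv_dot: "realv a \<bullet> realv b = of_int (dot a b)"
  by (simp add: realv_def dot_def inner_vec_def)

lemma realv_diff: "realv (a - b) = realv a - realv b"
  by (simp add: realv_def vec_eq_iff)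

lemma dot_zspan: "\<lbrakk>x \<in> zspan B; \<And>b. b \<in> B \<Longrightarrow> dot b l = 0\<rbrakk> \<Longrightarrow> dot x l = 0"
  by (induction rule: zspan_induct) (auto simp: dot_add_left dot_minus_left dot_def[of 0])

lemma span_orthogonal:
  assumes "\<And>b. b \<in> B \<Longrightarrow> dot b l = 0" "x \<in> span (realv ` B)"
  shows "x \<bullet> realv l = 0"
  using assms(2) by (rule span_induct) (use assms(1) in \<open>auto simp: subspace_def inner_add_left realv_dot\<close>)

text \<open>Among integral \<open>l\<close> orthogonal to \<open>B\<close> and arbitrary
  \<open>v\<close>, take the smallest positive pairing \<open>d\<close>. It divides every coordinate
  of \<open>l\<close>, since a remainder would be a smaller pairing; dividing by \<open>d\<close>
  makes the pairing 1.\<close>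

lemma primitive_dual:
  fixes B :: "(int ^ 'n) set"
  assumes "finite B" "dim (realv ` B) < CARD('n)"
  obtains l v where "\<And>b. b \<in> B \<Longrightarrow> dot b l = 0" "dot v l = 1"
proof -
  obtain l0 :: "int ^ 'n" where l0: "l0 \<noteq> 0" "\<And>b. b \<in> B \<Longrightarrow> dot b l0 = 0"
    using integral_orthogonal[OF assms] unfolding dot_def by metis
  define Q where "Q = (\<lambda>d::nat. 0 < d \<and> (\<exists>l v. (\<forall>b\<in>B. dot b l = 0) \<and> dot v l = int d))"
  have "0 < dot l0 l0"
  proof -
    obtain i where "l0 $ i \<noteq> 0" using l0(1) by (auto simp: vec_eq_iff)
    then show ?thesis unfolding dot_def by (intro sum_pos2[of _ i]) (auto simp: zero_less_mult_iff)
  qed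
  then have "Q (nat (dot l0 l0))" unfolding Q_def using l0(2) by auto
  then have Q: "Q (LEAST d. Q d)" and least: "\<And>d. Q d \<Longrightarrow> (LEAST d. Q d) \<le> d"
    by (auto intro: LeastI Least_le)
  define d where "d = (LEAST d. Q d)"
  obtain l v where lv: "\<And>b. b \<in> B \<Longrightarrow> dot b l = 0" "dot v l = int d" and d: "0 < d"
    using Q unfolding d_def Q_def by blast
  have "int d dvd l $ i" for i
  proof (rule ccontr)
    assume "\<not> int d dvd l $ i"
    then have "l $ i mod int d \<noteq> 0" by (simp add: dvd_eq_mod_eq_0)
    moreover have "0 \<le> l $ i mod int d" using d by simp
    ultimately have r: "0 < l $ i mod int d" by linarith
    \<comment> \<open>Constructed so that its pairing with \<open>l\<close> is exactly the remainder
      of the coordinate.\<close>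
    let ?v = "axis i 1 - (l $ i div int d) *s v"
    have "dot (axis i 1) l = l $ i" by (simp add: dot_def axis_def if_distrib[of "\<lambda>x. x * _"] cong: if_cong)
    then have "dot ?v l = l $ i mod int d"
      by (simp add: dot_diff_left dot_scale_left lv(2) minus_div_mult_eq_mod)
    then have "Q (nat (l $ i mod int d))" unfolding Q_def using r lv(1) by (intro conjI exI[of _ l] exI[of _ ?v]) auto
    then have "d \<le> nat (l $ i mod int d)" using least by (simp add: d_def)
    then show False using d pos_mod_bound[of "int d" "l $ i"] by linarith
  qed
  then have l: "l = int d *s (\<chi> i. l $ i div int d)" by (simp add: vec_eq_iff)
  let ?l = "\<chi> i. l $ i div int d"
  have dl: "dot a l = int d * dot a ?l" for a
    by (subst l) (simp add: dot_def sum_distrib_left mult_ac)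
  show ?thesis
  proof (rule that[of ?l v])
    show "dot b ?l = 0" if "b \<in> B" for b using lv(1)[OF that] d unfolding dl by simp
    show "dot v ?l = 1" using lv(2) d unfolding dl by simp
  qed
qed

lemma dual_not_in_span:
  assumes "\<And>b. b \<in> B \<Longrightarrow> dot b l = 0" "dot v l = 1"
  shows "realv v \<notin> span (realv ` B)"
  using span_orthogonal[of B l "realv v"] assms by (auto simp: realv_dot)

text \<open>The functional \<open>l\<close> splits \<open>v\<close> off: the saturation and the
  generated sublattice both gain the direct summand generated by \<open>v\<close>, so the index is
  unchanged.\<close>

lemma msat_insert:
  fixes B :: "(int ^ 'n) set"
  assumes l: "\<And>b. b \<in> B \<Longrightarrow> dot b l = 0" "dot v l = 1"
  shows "msat (insert v B) = msat B"
proof -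
  let ?C = "\<lambda>x. (+) x ` zspan B" and ?C' = "\<lambda>x. (+) x ` zspan (insert v B)"
  have sat_sub: "sat B \<subseteq> sat (insert v B)"
    unfolding sat_def by (auto intro: span_mono[THEN subsetD, rotated])
  have z_sub: "zspan B \<subseteq> zspan (insert v B)" by (intro zspan_mono) auto
  have sat_dot: "dot x l = 0" if "x \<in> sat B" for x
    using span_orthogonal[of B l "realv x"] l(1) that by (auto simp: sat_def realv_dot)
  have mem: "x - y \<in> zspan B" if xy: "x \<in> sat B" "y \<in> sat B" "x - y \<in> zspan (insert v B)" for x y
  proof -
    obtain a k where ak: "a \<in> zspan B" "x - y = a + k *s v" using zspan_insertE[OF xy(3)] .
    have "dot (x - y) l = 0" using xy sat_dot by (simp add: dot_diff_left)
    moreover have "dot (a + k *s v) l = k"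
      using dot_zspan[OF ak(1) l(1)] l(2) by (simp add: dot_add_left dot_scale_left)
    ultimately have "k = 0" using ak(2) by simp
    then have "k *s v = 0" by (simp add: vec_eq_iff)
    with ak show ?thesis by (simp only: add_0_right)
  qed
  \<comment> \<open>Enlarges a coset of \<open>zspan B\<close> to the coset of
    \<open>zspan (insert v B)\<close> containing it; the union avoids choosing a
    representative.\<close>
  define \<theta> where "\<theta> c = (\<Union>x\<in>c. ?C' x)" for c
  have \<theta>: "\<theta> (?C x) = ?C' x" for x
  proof -
    have "(\<Union>y\<in>?C x. ?C' y) = (\<Union>y\<in>?C x. ?C' x)"
    proof (rule SUP_cong[OF refl])
      fix y assume "y \<in> ?C x"
      then have "y - x \<in> zspan (insert v B)" using z_sub by auto
      then show "?C' y = ?C' x" unfolding coset_eq_iff .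
    qed
    moreover have "?C x \<noteq> {}" using zspan_0[of B] by blast
    ultimately show ?thesis unfolding \<theta>_def by simp
  qed
  have "bij_betw \<theta> (?C ` sat B) (?C' ` sat (insert v B))"
    unfolding bij_betw_def
  proof
    show "inj_on \<theta> (?C ` sat B)"
    proof (rule inj_onI)
      fix c c' assume "c \<in> ?C ` sat B" "c' \<in> ?C ` sat B" "\<theta> c = \<theta> c'"
      then obtain x y where "x \<in> sat B" "y \<in> sat B" "c = ?C x" "c' = ?C y" "?C' x = ?C' y"
        using \<theta> by auto
      then show "c = c'" using mem[of x y] by (simp add: coset_eq_iff)
    qed
    show "\<theta> ` ?C ` sat B = ?C' ` sat (insert v B)"
    proof (intro equalityI subsetI)
      fix c assume "c \<in> \<theta> ` ?C ` sat B"
      then show "c \<in> ?C' ` sat (insert v B)" using \<theta> sat_sub by auto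
    next
      fix c assume "c \<in> ?C' ` sat (insert v B)"
      then obtain x where x: "x \<in> sat (insert v B)" "c = ?C' x" by blast
      obtain r where r: "realv x - r *\<^sub>R realv v \<in> span (realv ` B)"
        using x(1) by (auto simp: sat_def span_breakdown_eq)
      have "(realv x - r *\<^sub>R realv v) \<bullet> realv l = 0" using span_orthogonal[OF l(1) r] .
      then have "r = of_int (dot x l)" by (simp add: inner_diff_left realv_dot l(2))
      \<comment> \<open>Projection along \<open>v\<close> to the kernel of \<open>l\<close>; the
        real coefficient \<open>r\<close> has just turned out to be the integer
        \<open>dot x l\<close>.\<close>
      let ?y = "x - dot x l *s v"
      have "?y \<in> sat B" using r \<open>r = _\<close> by (simp add: sat_def realv_diff realv_scale)
      moreover have "?C' x = ?C' ?y"
        unfolding coset_eq_iff using zspan_scale[OF zspan_base, of v "insert v B" "dot x l"] by simp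
      ultimately show "c \<in> \<theta> ` ?C ` sat B" using x(2) \<theta> by (metis imageI)
    qed
  qed
  then show ?thesis unfolding msat_def by (metis bij_betw_same_card)
qed

section \<open>Splitting a kernel into finitely many tori\<close>

lemma powi_sum: "(c :: complex) \<noteq> 0 \<Longrightarrow> (\<Prod>i\<in>S. c powi f i) = c powi (\<Sum>i\<in>S. f i)"
  by (induction S rule: infinite_finite_induct) (simp_all add: power_int_add)

definition cochar :: "int ^ 'n \<Rightarrow> complex \<Rightarrow> complex ^ 'n \<Rightarrow> complex ^ 'n" where
  "cochar l c z = (\<chi> i. z $ i * c powi (l $ i))"

lemma chi_cochar: "c \<noteq> 0 \<Longrightarrow> chi a (cochar l c z) = chi a z * c powi dot a l"
  by (simp add: chi_def cochar_def dot_def power_int_mult_distrib prod.distrib mult.commute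
      flip: powi_sum power_int_mult)

text \<open>The one-parameter subgroup with exponents \<open>l\<close> leaves the characters of
  \<open>B\<close> alone and has weight 1 on \<open>v\<close>; moving a point along it until
  \<open>chi v\<close> is 1 splits it into a point of the smaller kernel and a nonzero
  number.\<close>

lemma ksub_product:
  assumes l: "\<And>b. b \<in> B \<Longrightarrow> dot b l = 0" "dot v l = 1"
  shows "tp (ksub (insert v B) \<times> (- {0::complex})) homeomorphic_space tp (ksub B)"
proof -
  let ?f = "\<lambda>(y, c). cochar l c y" and ?g = "\<lambda>z. (cochar l (inverse (chi v z)) z, chi v z)"
  have ct: "cochar l c z \<in> ctorus" if "z \<in> ctorus" "c \<noteq> 0" for c z
    using that by (simp add: ctorus_def cochar_def)
  have cc: "cochar l c (cochar l d z) = cochar l (c * d) z" for c d z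
    by (simp add: cochar_def vec_eq_iff power_int_mult_distrib)
  have c1: "cochar l 1 z = z" for z by (simp add: cochar_def vec_eq_iff)
  have f: "?f p \<in> ksub B" "?g (?f p) = p" if pS: "p \<in> ksub (insert v B) \<times> (- {0})" for p
  proof -
    obtain y c where p: "p = (y, c)" "c \<noteq> 0" "y \<in> ctorus" "chi v y = 1" "y \<in> ksub B"
      using pS by (auto simp: ksub_def)
    then show "?f p \<in> ksub B" using ct[of y c] l(1) by (auto simp: chi_cochar ksub_def)
    have "chi v (cochar l c y) = c" using p l(2) by (simp add: chi_cochar)
    then show "?g (?f p) = p" using p by (simp add: cc c1)
  qed
  have g: "?g z \<in> ksub (insert v B) \<times> (- {0})" "?f (?g z) = z" if z: "z \<in> ksub B" for z
  proof -
    have zc: "z \<in> ctorus" "chi v z \<noteq> 0" using z by (auto simp: ksub_def)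
    then have "chi v (cochar l (inverse (chi v z)) z) = 1" using l(2) by (simp add: chi_cochar)
    moreover have "cochar l (inverse (chi v z)) z \<in> ksub B"
      using zc ct[of z "inverse (chi v z)"] l(1) z by (auto simp: chi_cochar ksub_def)
    ultimately show "?g z \<in> ksub (insert v B) \<times> (- {0})" using zc by (simp add: ksub_insert)
    show "?f (?g z) = z" using zc by (simp add: cc c1)
  qed
  have contf: "continuous_on (ksub (insert v B) \<times> (- {0})) ?f"
    unfolding cochar_def case_prod_unfold by (intro continuous_intros) auto
  have contchi: "continuous_on (ksub B) (chi v)" by (intro continuous_on_chi ksub_ctorus)
  have contg: "continuous_on (ksub B) ?g"
    unfolding cochar_def by (intro continuous_intros contchi) (auto simp: ksub_def)
  show ?thesis
    unfolding homeomorphic_space_def homeomorphic_maps_def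
  proof (intro exI conjI ballI)
    show "continuous_map (tp (ksub (insert v B) \<times> (- {0}))) (tp (ksub B)) ?f"
      using contf f(1) by (simp only: continuous_map_in_subtopology continuous_map_iff_continuous topspace_euclidean_subtopology) blast
    show "continuous_map (tp (ksub B)) (tp (ksub (insert v B) \<times> (- {0}))) ?g"
      using contg g(1) by (simp only: continuous_map_in_subtopology continuous_map_iff_continuous topspace_euclidean_subtopology) blast
  qed (use f(2) g(2) in auto)
qed

lemma hom_eq_chi:
  fixes f :: "int ^ 'n \<Rightarrow> complex"
  assumes add: "\<And>l m. f (l + m) = f l * f m" and nz: "\<And>l. f l \<noteq> 0"
  shows "f l = chi l (\<chi> i. f (axis i 1))"
proof -
  have f0: "f 0 = 1" using add[of 0 0] nz[of 0] by simp
  have nat: "f (int j *s m) = f m ^ j" for j m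
  proof (induction j)
    case 0
    have "int 0 *s m = 0" by (simp add: vec_eq_iff)
    then show ?case using f0 by simp
  next
    case (Suc j)
    have "int (Suc j) *s m = m + int j *s m" by (simp add: vec_eq_iff algebra_simps)
    then show ?case using add Suc by simp
  qed
  have neg: "f (- m) = inverse (f m)" for m
    using add[of "- m" m] f0 nz[of m] by (simp add: field_simps)
  have scale: "f (k *s m) = f m powi k" for k m
  proof (cases "k \<ge> 0")
    case True
    then show ?thesis using nat[of "nat k" m] by (simp add: power_int_def)
  next
    case False
    then have "k *s m = int (nat (- k)) *s (- m)" by (simp add: vec_eq_iff)
    then show ?thesis using nat[of "nat (- k)" "- m"] neg[of m] False by (simp add: power_int_def)
  qed
  have sum: "f (\<Sum>i\<in>S. g i) = (\<Prod>i\<in>S. f (g i))" if "finite S" for S and g :: "'n \<Rightarrow> int ^ 'n"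
    using that by (induction S rule: finite_induct) (simp_all add: f0 add)
  have l: "(\<Sum>i\<in>UNIV. (l $ i) *s axis i 1) = l"
    by (simp add: vec_eq_iff axis_def if_distrib[of "\<lambda>x. _ * x"] cong: if_cong)
  have "f l = (\<Prod>i\<in>UNIV. f ((l $ i) *s axis i 1))"
    using sum[of UNIV "\<lambda>i. (l $ i) *s axis i 1"] unfolding l by simp
  also have "\<dots> = chi l (\<chi> i. f (axis i 1))" by (simp add: scale chi_def)
  finally show ?thesis .
qed

text \<open>A positive multiple of each unit vector lies in the sublattice; reducing coordinates
  modulo these multiples leaves representatives in a finite box.\<close>

lemma zspan_finite_index:
  fixes B :: "(int ^ 'n) set"
  assumes "\<And>v. realv v \<in> span (realv ` B)"
  shows "finite (range (\<lambda>l. (+) l ` zspan B))"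
proof -
  have "\<exists>k. k > 0 \<and> k *s axis i 1 \<in> zspan B" for i :: 'n
  proof -
    obtain k S c where k: "k \<noteq> (0::int)" "S \<subseteq> B" "k *s axis i 1 = (\<Sum>b\<in>S. c b *s b)"
      using span_integral_multiple[OF assms[of "axis i 1"]] by metis
    have "k *s axis i 1 \<in> zspan B"
      unfolding k(3) using k(2) by (intro zspan_sum zspan_scale zspan_base) auto
    moreover have "\<bar>k\<bar> *s axis i (1::int) = k *s axis i 1 \<or> \<bar>k\<bar> *s axis i (1::int) = - (k *s axis i 1)"
      by (cases "k \<ge> 0") (auto simp: vec_eq_iff)
    ultimately have "\<bar>k\<bar> *s axis i 1 \<in> zspan B" using zspan_minus by metis
    then show ?thesis using k(1) by (intro exI[of _ "\<bar>k\<bar>"]) simp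
  qed
  then obtain k where k: "\<And>i. k i > 0" "\<And>i. k i *s axis i 1 \<in> zspan B" by metis
  let ?R = "{l :: int ^ 'n. \<forall>i. l $ i \<in> {0..<k i}}"
  have "?R \<subseteq> vec_lambda ` (PiE UNIV (\<lambda>i. {0..<k i}))"
  proof
    fix l assume "l \<in> ?R"
    then show "l \<in> vec_lambda ` (PiE UNIV (\<lambda>i. {0..<k i}))"
      by (intro image_eqI[of _ _ "\<lambda>i. l $ i"]) auto
  qed
  then have "finite ?R" by (rule finite_subset) (intro finite_imageI finite_PiE; simp)
  moreover have "range (\<lambda>l. (+) l ` zspan B) \<subseteq> (\<lambda>l. (+) l ` zspan B) ` ?R"
  proof clarify
    fix l :: "int ^ 'n"
    let ?m = "\<chi> i. l $ i mod k i"
    have "l - ?m = (\<Sum>i\<in>UNIV. (l $ i div k i) *s (k i *s axis i 1))"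
      by (simp add: vec_eq_iff axis_def if_distrib[of "\<lambda>x. _ * x"] minus_mod_eq_div_mult cong: if_cong)
    also have "\<dots> \<in> zspan B" by (intro zspan_sum zspan_scale k)
    finally have "(+) l ` zspan B = (+) ?m ` zspan B" unfolding coset_eq_iff .
    moreover have "?m \<in> ?R" using k(1) by simp
    ultimately show "(+) l ` zspan B \<in> (\<lambda>l. (+) l ` zspan B) ` ?R" by blast
  qed
  ultimately show ?thesis by (meson finite_imageI finite_subset)
qed

lemma rcos_Lat: "zspan B #>\<^bsub>Lat\<^esub> l = (+) l ` zspan (B :: (int ^ 'n) set)"
  by (auto simp: r_coset_def add.commute)

lemma subgroup_zspan: "subgroup (zspan B) (Lat :: (int ^ 'n) monoid)"
proof -
  interpret comm_group "Lat :: (int ^ 'n) monoid" by (rule comm_group_Lat)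
  show ?thesis by (rule generate_is_subgroup) simp
qed

text \<open>\<open>ksub B\<close> is the character group of the finite quotient of the lattice by \<open>zspan B\<close>.\<close>

lemma card_ksub_full_rank:
  fixes B :: "(int ^ 'n) set"
  assumes full: "\<And>v. realv v \<in> span (realv ` B)"
  shows "finite (ksub B)" "card (ksub B) = msat B"
proof -
  interpret L: comm_group "Lat :: (int ^ 'n) monoid" by (rule comm_group_Lat)
  let ?N = "zspan B"
  let ?Q = "Lat Mod ?N"
  let ?C = "\<lambda>l. (+) l ` ?N"
  have norm: "?N \<lhd> Lat" using subgroup_zspan L.subgroup_imp_normal by blast
  interpret Q: comm_group ?Q by (rule L.abelian_FactGroup[OF subgroup_zspan])
  have carr: "carrier ?Q = range ?C" by (auto simp: FactGroup_def RCOSETS_def rcos_Lat)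
  have mult: "?C l \<otimes>\<^bsub>?Q\<^esub> ?C m = ?C (l + m)" for l m
    using normal.rcos_sum[OF norm, of l m] by (simp add: FactGroup_def rcos_Lat)
  have finQ: "finite (carrier ?Q)" unfolding carr by (rule zspan_finite_index[OF full])
  \<comment> \<open>The representative is chosen arbitrarily; \<open>chi\<close> is trivial on
    \<open>zspan B\<close> for points of \<open>ksub B\<close>, so the choice is immaterial.\<close>
  define \<Theta> where "\<Theta> z = restrict (\<lambda>c. chi (SOME l. c = ?C l) z) (carrier ?Q)" for z
  have \<Theta>: "\<Theta> z (?C l) = chi l z" if z: "z \<in> ksub B" for z l
  proof -
    define m where "m = (SOME m. ?C l = ?C m)"
    have "?C l = ?C m" unfolding m_def by (rule someI[of _ l]) simp
    then have "m - l \<in> ?N" using coset_eq_iff[of m B l] by simp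
    then have "chi (m - l) z = 1" using chi_zspan[OF z] by blast
    moreover have "z \<in> ctorus" using z by (simp add: ksub_def)
    then have "chi m z = chi (m - l) z * chi l z" using chi_add[of z "m - l" l] by simp
    ultimately show ?thesis using carr by (simp add: \<Theta>_def m_def)
  qed
  have "bij_betw \<Theta> (ksub B) (chars ?Q (carrier ?Q))"
  proof (rule bij_betwI')
    fix y z assume yz: "y \<in> ksub B" "z \<in> ksub B"
    show "(\<Theta> y = \<Theta> z) = (y = z)"
      using \<Theta>[OF yz(1)] \<Theta>[OF yz(2)] chi_axis by (metis vec_eq_iff)
  next
    fix z assume z: "z \<in> ksub B"
    then have zc: "z \<in> ctorus" by (simp add: ksub_def)
    show "\<Theta> z \<in> chars ?Q (carrier ?Q)"
      unfolding chars_def carr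
    proof (intro CollectI conjI ballI)
      show "\<Theta> z \<in> extensional (range ?C)" by (simp add: \<Theta>_def carr)
      show "\<Theta> z x \<noteq> 0" if "x \<in> range ?C" for x using that \<Theta>[OF z] zc by auto
      show "\<Theta> z (x \<otimes>\<^bsub>?Q\<^esub> y) = \<Theta> z x * \<Theta> z y" if xy: "x \<in> range ?C" "y \<in> range ?C" for x y
      proof -
        obtain l m where "x = ?C l" "y = ?C m" using xy by blast
        then show ?thesis by (simp only: mult \<Theta>[OF z] chi_add[OF zc])
      qed
    qed
  next
    fix f assume f: "f \<in> chars ?Q (carrier ?Q)"
    define z where "z = (\<chi> i. f (?C (axis i 1)))"
    have f0: "f (?C l) \<noteq> 0" for l using f carr by (auto simp: chars_def)
    have fadd: "f (?C (l + m)) = f (?C l) * f (?C m)" for l m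
      using f carr by (auto simp: chars_def mult[symmetric])
    have zc: "z \<in> ctorus" using f0 by (simp add: ctorus_def z_def)
    have "f (?C 0) = f (?C 0) * f (?C 0)" using fadd[of 0 0] by (simp only: add_0_right)
    then have f1: "f (?C 0) = 1" using f0[of 0] by (metis mult_cancel_right1)
    note f1' = f1[simplified]
    have chif: "chi l z = f (?C l)" for l
      unfolding z_def by (rule hom_eq_chi[symmetric]) (rule fadd, rule f0)
    have "chi b z = 1" if "b \<in> B" for b
    proof -
      have "?C b = ?C 0" unfolding coset_eq_iff using zspan_base[OF that] by simp
      then show ?thesis using chif f1 by metis
    qed
    then have zB: "z \<in> ksub B" using zc by (simp add: ksub_def)
    have "f = \<Theta> z"
    proof (rule extensionalityI[of _ "carrier ?Q"])
      show "f \<in> extensional (carrier ?Q)" using f by (simp add: chars_def)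
      show "\<Theta> z \<in> extensional (carrier ?Q)" by (simp add: \<Theta>_def)
      show "f x = \<Theta> z x" if "x \<in> carrier ?Q" for x using that \<Theta>[OF zB] chif carr by auto
    qed
    then show "\<exists>z\<in>ksub B. f = \<Theta> z" using zB by blast
  qed
  note bij = this
  have "card (ksub B) = card (carrier ?Q)"
    using bij_betw_same_card[OF bij] Q.card_chars[OF finQ] by (rule trans)
  \<comment> \<open>\<open>card\<close> is 0 on infinite sets, so positivity turns the equality of
    cardinalities into finiteness.\<close>
  moreover have "0 < card (carrier ?Q)" using finQ carr by (simp add: card_gt_0_iff)
  then have "finite (chars ?Q (carrier ?Q))"
    using Q.card_chars[OF finQ] by (intro card_ge_0_finite) (simp only:)
  then have "finite (ksub B)" using bij_betw_finite[OF bij] by blast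
  moreover have "sat B = UNIV" using full by (auto simp: sat_def)
  ultimately show "finite (ksub B)" "card (ksub B) = msat B" by (auto simp: msat_def carr)
qed

text \<open>Induction on the corank: each step splits off a punctured plane, with factor
  \<open>1 + q\<close>, and keeps \<open>msat\<close>, until the kernel is finite with
  \<open>msat B\<close> points.\<close>

lemma has_poincare_ksub:
  fixes B :: "(int ^ 'n) set"
  assumes "finite B"
  shows "has_poincare (ksub B) (Polynomial.smult (real (msat B)) ([:1, 1:] ^ (CARD('n) - dim (realv ` B))))"
  using assms
proof (induction "CARD('n) - dim (realv ` B)" arbitrary: B)
  case 0
  have "dim (realv ` B) \<le> CARD('n)" using dim_subset_UNIV[of "realv ` B"] by simp
  then have "dim (span (realv ` B)) = DIM(real ^ 'n)" using 0 by simp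
  then have "span (realv ` B) = UNIV" by (metis dim_eq_full dim_span span_span)
  then have full: "realv v \<in> span (realv ` B)" for v by simp
  show ?case
    using has_poincare_finite[OF card_ksub_full_rank(1)[OF full]] card_ksub_full_rank(2)[OF full] 0 by simp
next
  case (Suc d)
  then have "dim (realv ` B) < CARD('n)" by simp
  then obtain l v where lv: "\<And>b. b \<in> B \<Longrightarrow> dot b l = 0" "dot v l = 1"
    using primitive_dual[OF Suc.prems] by metis
  have "dim (realv ` insert v B) = dim (realv ` B) + 1"
    using dual_not_in_span[OF lv] by (simp add: dim_insert)
  then have d: "CARD('n) - dim (realv ` insert v B) = d" using Suc.hyps(2) by simp
  have "has_poincare (ksub (insert v B)) (Polynomial.smult (real (msat B)) ([:1, 1:] ^ d))"
    using Suc.hyps(1)[of "insert v B"] Suc.prems d msat_insert[OF lv] by simp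
  then have "has_poincare (ksub B) ([:1, 1:] * Polynomial.smult (real (msat B)) ([:1, 1:] ^ d))"
    using has_poincare_homeomorphic[OF ksub_product[OF lv] has_poincare_times_punctured_plane] by blast
  then show ?case unfolding Suc.hyps(2)[symmetric] by simp
qed

section \<open>The arithmetic Tutte polynomial\<close>

definition pksub :: "(int ^ 'n) set \<Rightarrow> real poly" where
  "pksub B = Polynomial.smult (real (msat B)) ([:1, 1:] ^ (CARD('n) - rk B))"

lemma rk_insert: "rk (insert v B) = (if realv v \<in> span (realv ` B) then rk B else rk B + 1)"
  by (simp add: rk_def dim_insert)

lemma rk_mono: "A \<subseteq> B \<Longrightarrow> rk A \<le> rk B"
  unfolding rk_def by (intro dim_subset image_mono)

lemma rk_le: "rk (B :: (int ^ 'n) set) \<le> CARD('n)"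
  unfolding rk_def using dim_subset_UNIV[of "realv ` B"] by simp

text \<open>Position sets of a list \<open>v # X\<close>, separated by whether they contain the
  position 0 of \<open>v\<close>.\<close>

lemma sum_Pow_Suc:
  fixes F :: "nat set \<Rightarrow> 'a::comm_monoid_add"
  shows "(\<Sum>S\<in>Pow {..<Suc n}. F S) = (\<Sum>S\<in>Pow {..<n}. F (Suc ` S)) + (\<Sum>S\<in>Pow {..<n}. F (insert 0 (Suc ` S)))"
proof -
  let ?P = "Pow {..<n}"
  have split: "Pow {..<Suc n} = image Suc ` ?P \<union> (\<lambda>S. insert 0 (Suc ` S)) ` ?P"
    unfolding lessThan_Suc_eq_insert_0 Pow_insert image_Pow_surj[OF refl, symmetric] image_image ..
  have "inj_on (image Suc) ?P" by (auto simp: inj_on_def inj_image_eq_iff)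
  moreover have "inj_on (\<lambda>S. insert 0 (Suc ` S)) ?P"
  proof (rule inj_onI)
    fix S T :: "nat set" assume "insert 0 (Suc ` S) = insert 0 (Suc ` T)"
    then have "Suc ` S = Suc ` T" by (metis Diff_insert_absorb imageE nat.distinct(1))
    then show "S = T" by (simp add: inj_image_eq_iff)
  qed
  moreover have "image Suc ` ?P \<inter> (\<lambda>S. insert 0 (Suc ` S)) ` ?P = {}" by auto
  ultimately show ?thesis
    unfolding split by (subst sum.union_disjoint) (simp_all add: sum.reindex)
qed

lemma sub_Suc: "sub (v # X) (Suc ` S) = sub X S"
  and sub_insert_0: "sub (v # X) (insert 0 (Suc ` S)) = insert v (sub X S)"
  by (simp_all add: sub_def image_image)

text \<open>Evaluating the deletion recursion: removing \<open>v\<close> contributes \<open>- (- q) ^ c\<close> times the polynomial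
  of the intersection with the hypersurface of \<open>v\<close>, where \<open>c\<close> is its codimension, zero or one.\<close>

lemma has_poincare_arr:
  fixes B :: "(int ^ 'n) set" and X :: "(int ^ 'n) list"
  assumes "finite B"
  shows "\<exists>P. has_poincare (arr B (set X)) P \<and> (\<forall>q. poly P q =
     (\<Sum>S\<in>Pow {..<length X}. (-1) ^ card S * (-q) ^ (rk (B \<union> sub X S) - rk B) * poly (pksub (B \<union> sub X S)) q))"
  using assms
proof (induction X arbitrary: B)
  case Nil
  have "arr B {} = ksub B" by (simp add: arr_def)
  then have "has_poincare (arr B (set [])) (pksub B)"
    using has_poincare_ksub[OF Nil] by (simp add: pksub_def rk_def)
  then show ?case by (intro exI[of _ "pksub B"]) (simp add: sub_def)
next
  case (Cons v X)
  let ?c = "rk (insert v B) - rk B"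
  let ?t = "\<lambda>B S q. (-1) ^ card S * (-q) ^ (rk (B \<union> sub X S) - rk B) * poly (pksub (B \<union> sub X S)) q"
  obtain P where P: "has_poincare (arr B (set X)) P" "\<And>q. poly P q = (\<Sum>S\<in>Pow {..<length X}. ?t B S q)"
    using Cons.IH[OF Cons.prems] by blast
  obtain Q where Q: "has_poincare (arr (insert v B) (set X)) Q"
    "\<And>q. poly Q q = (\<Sum>S\<in>Pow {..<length X}. ?t (insert v B) S q)"
    using Cons.IH[of "insert v B"] Cons.prems by auto
  have "\<exists>R. has_poincare (arr B (set (v # X))) R \<and> (\<forall>q. poly R q = poly P q - (- q) ^ ?c * poly Q q)"
  proof (cases "realv v \<in> span (realv ` B)")
    case True
    then have "has_poincare (arr B (set (v # X))) (P - Q)"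
      using has_poincare_arr_insert_dependent[OF _ True P(1) Q(1)] by simp
    then show ?thesis using True by (intro exI[of _ "P - Q"]) (simp add: rk_insert)
  next
    case False
    then have "has_poincare (arr B (set (v # X))) (P + pCons 0 Q)"
      using has_poincare_arr_insert[OF _ False P(1) Q(1)] by simp
    then show ?thesis using False by (intro exI[of _ "P + pCons 0 Q"]) (simp add: rk_insert)
  qed
  then obtain R where R: "has_poincare (arr B (set (v # X))) R"
    "\<And>q. poly R q = poly P q - (- q) ^ ?c * poly Q q" by blast
  \<comment> \<open>Codimensions add along a chain; monotonicity of the rank makes the truncated
    differences genuine.\<close>
  have rk_add: "rk (insert v (B \<union> A)) - rk B = ?c + (rk (insert v (B \<union> A)) - rk (insert v B))" for A
  proof -
    have "rk B \<le> rk (insert v B)" "rk (insert v B) \<le> rk (insert v (B \<union> A))"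
      by (intro rk_mono; blast)+
    then show ?thesis by simp
  qed
  have card_Suc: "card (insert 0 (Suc ` S)) = Suc (card S)" if "S \<in> Pow {..<length X}" for S
  proof -
    have "finite S" using that finite_subset by auto
    then show ?thesis by (simp add: card_image)
  qed
  let ?u = "\<lambda>q S. (-1) ^ card S * (-q) ^ (rk (B \<union> sub (v # X) S) - rk B) * poly (pksub (B \<union> sub (v # X) S)) q"
  have "poly R q = (\<Sum>S\<in>Pow {..<length (v # X)}. ?u q S)" for q
  proof -
    have "(\<Sum>S\<in>Pow {..<length X}. ?u q (Suc ` S)) = poly P q"
      unfolding P(2) by (intro sum.cong) (simp_all add: sub_Suc card_image)
    moreover have "(\<Sum>S\<in>Pow {..<length X}. ?u q (insert 0 (Suc ` S))) = - ((- q) ^ ?c * poly Q q)"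
      unfolding Q(2) sum_distrib_left sum_negf[symmetric]
    proof (rule sum.cong[OF refl])
      fix S assume "S \<in> Pow {..<length X}"
      then show "?u q (insert 0 (Suc ` S)) = - ((- q) ^ ?c * ?t (insert v B) S q)"
        unfolding sub_insert_0 card_Suc[OF \<open>S \<in> _\<close>] Un_insert_right Un_insert_left rk_add power_add by simp
    qed
    ultimately show ?thesis unfolding R(2) length_Cons sum_Pow_Suc by simp
  qed
  then show ?case using R(1) by blast
qed

text \<open>A missing direction provides \<open>v\<close> and \<open>l\<close> with pairing 1, and
  the multiples of \<open>v\<close> lie in infinitely many cosets. This is how finite index yields
  \<open>r(X) = n\<close> in the exponents of the Tutte polynomial.\<close>

lemma finite_zspan_index_full:
  fixes B :: "(int ^ 'n) set"
  assumes "finite B" "finite (rcosets\<^bsub>Lat\<^esub> zspan B)"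
  shows "rk B = CARD('n)"
proof (rule ccontr)
  assume "rk B \<noteq> CARD('n)"
  then have "dim (realv ` B) < CARD('n)" using rk_le[of B] by (simp add: rk_def)
  then obtain l v where lv: "\<And>b. b \<in> B \<Longrightarrow> dot b l = 0" "dot v l = 1"
    using primitive_dual[OF assms(1)] by metis
  let ?f = "\<lambda>k::int. (+) (k *s v) ` zspan B"
  have "inj ?f"
  proof (rule injI)
    fix j k assume "?f j = ?f k"
    then have "j *s v - k *s v \<in> zspan B" unfolding coset_eq_iff .
    then have "dot (j *s v - k *s v) l = 0" using dot_zspan lv(1) by blast
    then show "j = k" by (simp add: dot_diff_left dot_scale_left lv(2))
  qed
  moreover have "range ?f \<subseteq> rcosets\<^bsub>Lat\<^esub> zspan B"
    by (auto simp: RCOSETS_def rcos_Lat)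
  ultimately show False using assms(2) by (metis finite_imageD finite_subset infinite_UNIV_int)
qed

text \<open>\<open>GamA G B\<close> is the saturation times \<open>carrier G\<close>, while the
  generated subgroup lies in the lattice factor; each element of \<open>G\<close> thus contributes
  its own copy of the lattice cosets.\<close>

lemma mult_A_eq:
  fixes G :: "('g, 'b) monoid_scheme" and B :: "(int ^ 'n) set"
  assumes "comm_group G"
  shows "mult_A G B = card (carrier G) * msat B"
proof -
  interpret G: comm_group G by fact
  interpret L: comm_group "Lat :: (int ^ 'n) monoid" by (rule comm_group_Lat)
  interpret P: group "Gam G :: ((int ^ 'n) \<times> 'g) monoid"
    unfolding Gam_def by (intro DirProd_group) (rule L.is_group, rule G.is_group)
  have gmult: "(a, g) \<otimes>\<^bsub>Gam G\<^esub> (b, h) = (a + b, g \<otimes>\<^bsub>G\<^esub> h)" for a b :: "int ^ 'n" and g h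
    by (simp add: Gam_def)
  have ginv: "inv\<^bsub>Gam G\<^esub> (a, g) = (- a, inv\<^bsub>G\<^esub> g)" if "g \<in> carrier G" for a :: "int ^ 'n" and g
    using that by (intro P.inv_equality) (simp_all add: gmult, simp_all add: Gam_def DirProd_def)
  have gen: "generate (Gam G) (incl G ` B) = zspan B \<times> {\<one>\<^bsub>G\<^esub>}"
  proof (intro equalityI subsetI)
    fix x assume "x \<in> generate (Gam G) (incl G ` B)"
    then show "x \<in> zspan B \<times> {\<one>\<^bsub>G\<^esub>}"
    proof (induction rule: generate.induct)
      case one
      then show ?case by (simp add: Gam_def)
    next
      case (incl h)
      then show ?case by (auto simp: incl_def intro: zspan_base)
    next
      case (inv h)
      then show ?case by (auto simp: incl_def ginv intro: zspan_minus[OF zspan_base])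
    next
      case (eng a b)
      then show ?case by (auto simp: gmult intro: zspan_add)
    qed
  next
    fix x assume "x \<in> zspan B \<times> {\<one>\<^bsub>G\<^esub>}"
    then obtain l where l: "x = (l, \<one>\<^bsub>G\<^esub>)" "l \<in> zspan B" by auto
    have "(l, \<one>\<^bsub>G\<^esub>) \<in> generate (Gam G) (incl G ` B)"
      using l(2)
    proof (induction rule: zspan_induct)
      case zero
      then show ?case using generate.one[of "Gam G" "incl G ` B"] by (simp add: Gam_def)
    next
      case (base b)
      then show ?case by (intro generate.incl) (auto simp: incl_def)
    next
      case (minus b)
      then have "inv\<^bsub>Gam G\<^esub> (incl G b) \<in> generate (Gam G) (incl G ` B)" by (intro generate.inv) auto
      then show ?case by (simp add: incl_def ginv)
    next
      case (add a b)
      then show ?case using generate.eng[of "(a, \<one>\<^bsub>G\<^esub>)" "Gam G" "incl G ` B" "(b, \<one>\<^bsub>G\<^esub>)"] by (simp add: gmult)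
    qed
    then show "x \<in> generate (Gam G) (incl G ` B)" using l(1) by simp
  qed
  let ?C = "\<lambda>l. (+) l ` zspan B"
  have coset: "(zspan B \<times> {\<one>\<^bsub>G\<^esub>}) #>\<^bsub>(Gam G)\<lparr>carrier := GamA G B\<rparr>\<^esub> (l, g) = ?C l \<times> {g}"
    if "g \<in> carrier G" for l g
    using that by (auto simp: r_coset_def gmult add.commute)
  have "rcosets\<^bsub>(Gam G)\<lparr>carrier := GamA G B\<rparr>\<^esub> (zspan B \<times> {\<one>\<^bsub>G\<^esub>}) = (\<lambda>(c, g). c \<times> {g}) ` (?C ` sat B \<times> carrier G)"
  proof -
    have "GamA G B = sat B \<times> carrier G" by (auto simp: GamA_def sat_def)
    then have "rcosets\<^bsub>(Gam G)\<lparr>carrier := GamA G B\<rparr>\<^esub> (zspan B \<times> {\<one>\<^bsub>G\<^esub>}) =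
        (\<lambda>x. (zspan B \<times> {\<one>\<^bsub>G\<^esub>}) #>\<^bsub>(Gam G)\<lparr>carrier := GamA G B\<rparr>\<^esub> x) ` (sat B \<times> carrier G)"
      by (auto simp: RCOSETS_def)
    also have "\<dots> = (\<lambda>x. ?C (fst x) \<times> {snd x}) ` (sat B \<times> carrier G)"
    proof (rule image_cong[OF refl])
      fix x assume "x \<in> sat B \<times> carrier G"
      then obtain l g where "x = (l, g)" "g \<in> carrier G" by auto
      then show "(zspan B \<times> {\<one>\<^bsub>G\<^esub>}) #>\<^bsub>(Gam G)\<lparr>carrier := GamA G B\<rparr>\<^esub> x = ?C (fst x) \<times> {snd x}"
        by (simp only: coset fst_conv snd_conv)
    qed
    also have "\<dots> = (\<lambda>(c, g). c \<times> {g}) ` map_prod ?C (\<lambda>g. g) ` (sat B \<times> carrier G)"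
      by (simp add: image_image map_prod_def case_prod_unfold)
    also have "map_prod ?C (\<lambda>g. g) ` (sat B \<times> carrier G) = ?C ` sat B \<times> carrier G"
      by (rule map_prod_surj_on) simp_all
    finally show ?thesis .
  qed
  \<comment> \<open>Cosets are nonempty, so the product with a singleton determines both
    factors.\<close>
  moreover have "inj_on (\<lambda>(c, g). c \<times> {g}) (?C ` sat B \<times> carrier G)"
  proof (rule inj_onI, clarify)
    fix l m g h assume eq: "?C l \<times> {g} = ?C m \<times> {h}"
    have "?C l \<noteq> {}" "?C m \<noteq> {}" using zspan_0[of B] by blast+
    then show "?C l = ?C m \<and> g = h" using eq by (auto simp: times_eq_iff)
  qed
  ultimately show ?thesis
    unfolding mult_A_def gen msat_def by (simp add: card_image card_cartesian_product mult.commute)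
qed

section \<open>The complement as finitely many copies of an arrangement\<close>

lemma continuous_map_vec:
  fixes f :: "'a \<Rightarrow> 'n::finite \<Rightarrow> 'b::topological_space"
  assumes "\<And>i. continuous_map X euclidean (\<lambda>x. f x i)"
  shows "continuous_map X euclidean (\<lambda>x. \<chi> i. f x i)"
  unfolding continuous_map_atin
proof
  fix x assume x: "x \<in> topspace X"
  have "((\<lambda>x. \<chi> i. f x i) \<longlongrightarrow> (\<chi> i. f x i)) (atin X x)"
    using assms x by (intro tendsto_vec_lambda) (auto simp: continuous_map_atin)
  then show "limitin euclidean (\<lambda>x. \<chi> i. f x i) (\<chi> i. f x i) (atin X x)" by simp
qed

text \<open>A homomorphism on the product is a point of the complex torus together with a character
  of \<open>G\<close>, and only the former decides membership in a hypersurface. Characters are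
  numbered so that the finite factor is a discrete set of naturals.\<close>

lemma complement_homeomorphic:
  fixes G :: "('g, 'b) monoid_scheme" and X :: "(int ^ 'n) list"
  assumes "comm_group G" "finite (carrier G)"
  shows "complement_top G X homeomorphic_space tp (arr {} (set X) \<times> {..<card (carrier G)})"
proof -
  interpret G: comm_group G by fact
  let ?N = "card (carrier G)" and ?Ch = "chars G (carrier G)"
  have cardCh: "card ?Ch = ?N" by (rule G.card_chars[OF assms(2)])
  moreover have "0 < ?N" using assms(2) G.one_closed by (metis card_gt_0_iff empty_iff)
  ultimately have finCh: "finite ?Ch" by (intro card_ge_0_finite) simp
  obtain h where h: "bij_betw h {..<?N} ?Ch"
    using ex_bij_betw_nat_finite[OF finCh] cardCh by (auto simp: atLeast0LessThan)
  define idx where "idx = inv_into {..<?N} h"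
  have h_char: "h k \<in> ?Ch" if "k < ?N" for k using h that by (auto simp: bij_betw_def)
  have idx: "idx c < ?N" "h (idx c) = c" if "c \<in> ?Ch" for c
  proof -
    have c: "c \<in> h ` {..<?N}" using h that by (simp add: bij_betw_def)
    show "idx c < ?N" using inv_into_into[OF c] by (simp add: idx_def)
    show "h (idx c) = c" using f_inv_into_f[OF c] by (simp add: idx_def)
  qed
  have idx_h: "idx (h k) = k" if "k < ?N" for k
    using h that by (auto simp: idx_def bij_betw_def)
  have carr: "carrier (Gam G) = (UNIV :: (int ^ 'n) set) \<times> carrier G"
    by (simp add: Gam_def DirProd_def)
  have gmult: "(a, g) \<otimes>\<^bsub>Gam G\<^esub> (b, g') = (a + b, g \<otimes>\<^bsub>G\<^esub> g')" for a b :: "int ^ 'n" and g g'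
    by (simp add: Gam_def)
  define zt :: "((int ^ 'n) \<times> 'g \<Rightarrow> complex) \<Rightarrow> complex ^ 'n" where "zt t = (\<chi> i. t (axis i 1, \<one>\<^bsub>G\<^esub>))" for t
  define ct :: "((int ^ 'n) \<times> 'g \<Rightarrow> complex) \<Rightarrow> 'g \<Rightarrow> complex" where "ct t = restrict (\<lambda>g. t (0, g)) (carrier G)" for t
  define mk :: "(complex ^ 'n) \<times> nat \<Rightarrow> (int ^ 'n) \<times> 'g \<Rightarrow> complex" where
    "mk p = restrict (\<lambda>x. chi (fst x) (fst p) * h (snd p) (snd x)) (carrier (Gam G))" for p
  have torus: "t (a + b, g \<otimes>\<^bsub>G\<^esub> g') = t (a, g) * t (b, g')" "t (a, g) \<noteq> 0"
    if "t \<in> torus_set G" "g \<in> carrier G" "g' \<in> carrier G" for t and a b :: "int ^ 'n" and g g'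
  proof -
    have t: "t \<in> hom (Gam G) Cstar" using that(1) by (simp add: torus_set_def)
    have "t ((a, g) \<otimes>\<^bsub>Gam G\<^esub> (b, g')) = t (a, g) \<otimes>\<^bsub>Cstar\<^esub> t (b, g')"
      by (rule hom_mult[OF t]) (use that carr in auto)
    then show "t (a + b, g \<otimes>\<^bsub>G\<^esub> g') = t (a, g) * t (b, g')" unfolding gmult by (simp add: Cstar_def)
    have "t (a, g) \<in> carrier Cstar" by (rule hom_in_carrier[OF t]) (use that carr in auto)
    then show "t (a, g) \<noteq> 0" by (simp add: Cstar_def)
  qed
  have zt_ctorus: "zt t \<in> ctorus" if "t \<in> torus_set G" for t
    using torus(2)[OF that G.one_closed G.one_closed] by (simp add: zt_def ctorus_def)
  have t_chi: "t (l, \<one>\<^bsub>G\<^esub>) = chi l (zt t)" if "t \<in> torus_set G" for t l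
    unfolding zt_def
  proof (rule hom_eq_chi)
    show "t (l + m, \<one>\<^bsub>G\<^esub>) = t (l, \<one>\<^bsub>G\<^esub>) * t (m, \<one>\<^bsub>G\<^esub>)" for l m
      using torus(1)[OF that G.one_closed G.one_closed, of l m] by simp
    show "t (l, \<one>\<^bsub>G\<^esub>) \<noteq> 0" for l by (rule torus(2)[OF that G.one_closed G.one_closed])
  qed
  have t_split: "t (l, g) = chi l (zt t) * ct t g" if "t \<in> torus_set G" "g \<in> carrier G" for t l g
    using torus(1)[OF that(1) G.one_closed that(2), of l 0] that t_chi by (simp add: ct_def)
  have ct_char: "ct t \<in> ?Ch" if "t \<in> torus_set G" for t
    using torus(1)[OF that, of _ _ 0 0] torus(2)[OF that, of _ _ 0] by (auto simp: ct_def chars_def)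
  have mk_torus: "mk (z, k) \<in> torus_set G" if "z \<in> ctorus" "k < ?N" for z k
  proof -
    have c: "\<And>g. g \<in> carrier G \<Longrightarrow> h k g \<noteq> 0"
      "\<And>g g'. g \<in> carrier G \<Longrightarrow> g' \<in> carrier G \<Longrightarrow> h k (g \<otimes>\<^bsub>G\<^esub> g') = h k g * h k g'"
      using h_char[OF that(2)] by (auto simp: chars_def)
    have "mk (z, k) \<in> hom (Gam G) Cstar"
    proof (rule homI)
      show "mk (z, k) x \<in> carrier Cstar" if "x \<in> carrier (Gam G)" for x
        using that \<open>z \<in> ctorus\<close> c(1) by (auto simp: mk_def Cstar_def carr)
      show "mk (z, k) (x \<otimes>\<^bsub>Gam G\<^esub> y) = mk (z, k) x \<otimes>\<^bsub>Cstar\<^esub> mk (z, k) y"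
        if "x \<in> carrier (Gam G)" "y \<in> carrier (Gam G)" for x y
        using that \<open>z \<in> ctorus\<close> c(2) by (cases x, cases y) (auto simp: mk_def Cstar_def carr gmult chi_add)
    qed
    then show ?thesis by (simp add: torus_set_def mk_def)
  qed
  have h1: "h k \<one>\<^bsub>G\<^esub> = 1" if "k < ?N" for k
    using G.chars_one[OF G.subgroup_self h_char[OF that]] .
  have zt_mk: "zt (mk (z, k)) = z" if "k < ?N" for z k
    using h1[OF that] by (simp add: zt_def mk_def carr vec_eq_iff chi_axis)
  have ct_mk: "ct (mk (z, k)) = h k" if "k < ?N" for z k
    using h_char[OF that] by (intro extensionalityI[of _ "carrier G"]) (auto simp: ct_def mk_def carr chars_def)
  have mk_zt: "mk (zt t, idx (ct t)) = t" if "t \<in> torus_set G" for t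
  proof (rule extensionalityI[of _ "carrier (Gam G)"])
    show "t \<in> extensional (carrier (Gam G))" using that by (auto simp: torus_set_def PiE_def)
    show "mk (zt t, idx (ct t)) x = t x" if "x \<in> carrier (Gam G)" for x
      using that t_split[OF \<open>t \<in> torus_set G\<close>] idx(2)[OF ct_char[OF \<open>t \<in> torus_set G\<close>]] by (auto simp: mk_def carr)
  qed (simp add: mk_def)
  have compl: "t \<in> complement G X \<longleftrightarrow> t \<in> torus_set G \<and> zt t \<in> arr {} (set X)" for t
    using t_chi[of t] zt_ctorus[of t] by (auto simp: complement_def Hchi_def incl_def arr_def ksub_def)
  have top: "topspace (complement_top G X) = complement G X"
    by (auto simp: complement_top_def complement_def torus_set_def)
  have ev: "continuous_map (complement_top G X) euclidean (\<lambda>t. t x)" if "x \<in> carrier (Gam G)" for x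
    unfolding complement_top_def
    using that by (intro continuous_map_from_subtopology continuous_map_product_projection)
  let ?F = "\<lambda>t. (zt t, idx (ct t))"
  have cont_zt: "continuous_map (complement_top G X) euclidean zt"
    unfolding zt_def by (intro continuous_map_vec ev) (simp add: carr)
  \<comment> \<open>Prescribing the character amounts to closed conditions on values of
    \<open>t\<close>; as there are finitely many characters, closed fibres give continuity of the
    index.\<close>
  have closed_ct: "closedin (complement_top G X) {t \<in> complement G X. ct t = c}" if c: "c \<in> ?Ch" for c
  proof -
    have "closedin (complement_top G X) {t \<in> topspace (complement_top G X). t (0, g) \<in> {c g}}" if "g \<in> carrier G" for g
      by (rule closedin_continuous_map_preimage[OF ev]) (use that carr in auto)
    then have "closedin (complement_top G X) (\<Inter>g\<in>carrier G. {t \<in> topspace (complement_top G X). t (0, g) \<in> {c g}})"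
      using G.one_closed by (intro closedin_INT) auto
    also have "(\<Inter>g\<in>carrier G. {t \<in> topspace (complement_top G X). t (0, g) \<in> {c g}}) = {t \<in> complement G X. ct t = c}"
    proof -
      have "ct t = c \<longleftrightarrow> (\<forall>g\<in>carrier G. t (0, g) = c g)" for t
      proof
        assume "\<forall>g\<in>carrier G. t (0, g) = c g"
        then show "ct t = c" using c by (intro extensionalityI[of _ "carrier G"]) (auto simp: ct_def chars_def)
      qed (auto simp: ct_def)
      then show ?thesis using top G.one_closed by auto
    qed
    finally show ?thesis .
  qed
  have cont_idx: "continuous_map (complement_top G X) euclidean (\<lambda>t. idx (ct t))"
    unfolding continuous_map_closedin
  proof (intro conjI ballI allI impI)
    fix C :: "nat set"
    have "{t \<in> topspace (complement_top G X). idx (ct t) \<in> C} = (\<Union>k\<in>C \<inter> {..<?N}. {t \<in> complement G X. ct t = h k})"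
    proof (intro equalityI subsetI)
      fix t assume "t \<in> {t \<in> topspace (complement_top G X). idx (ct t) \<in> C}"
      then have t: "t \<in> complement G X" "idx (ct t) \<in> C" using top by auto
      then have "ct t \<in> ?Ch" using compl ct_char by blast
      then show "t \<in> (\<Union>k\<in>C \<inter> {..<?N}. {t \<in> complement G X. ct t = h k})"
        using t idx[of "ct t"] by (intro UN_I[of "idx (ct t)"]) auto
    next
      fix t assume "t \<in> (\<Union>k\<in>C \<inter> {..<?N}. {t \<in> complement G X. ct t = h k})"
      then obtain k where "k \<in> C" "k < ?N" "t \<in> complement G X" "ct t = h k" by blast
      then show "t \<in> {t \<in> topspace (complement_top G X). idx (ct t) \<in> C}"
        using top idx_h[of k] by simp
    qed
    moreover have "closedin (complement_top G X) (\<Union>k\<in>C \<inter> {..<?N}. {t \<in> complement G X. ct t = h k})"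
      using closed_ct h_char by (intro closedin_Union) auto
    ultimately show "closedin (complement_top G X) {t \<in> topspace (complement_top G X). idx (ct t) \<in> C}" by simp
  qed auto
  have F_in: "?F t \<in> arr {} (set X) \<times> {..<?N}" if "t \<in> complement G X" for t
    using that compl idx(1) ct_char by auto
  have mk_in: "mk p \<in> complement G X" if "p \<in> arr {} (set X) \<times> {..<?N}" for p
    using that mk_torus zt_mk compl by (auto simp: arr_def ksub_def)
  have "continuous_map (complement_top G X) (prod_topology euclidean euclidean) ?F"
    using cont_zt cont_idx by (simp only: continuous_map_pairwise o_def fst_conv snd_conv simp_thms)
  then have contF: "continuous_map (complement_top G X) (tp (arr {} (set X) \<times> {..<?N})) ?F"
    using F_in top by (auto simp: continuous_map_in_subtopology prod_topology_euclidean)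
  have cont_mk: "continuous_map (tp (arr {} (set X) \<times> {..<?N})) (complement_top G X) mk"
    unfolding complement_top_def continuous_map_in_subtopology
  proof (intro conjI continuous_map_componentwise[THEN iffD2] ballI)
    show "mk ` topspace (tp (arr {} (set X) \<times> {..<?N})) \<subseteq> extensional (carrier (Gam G))"
      by (auto simp: mk_def)
    show "mk \<in> topspace (tp (arr {} (set X) \<times> {..<?N})) \<rightarrow> complement G X" using mk_in by auto
    fix x :: "(int ^ 'n) \<times> 'g" assume x: "x \<in> carrier (Gam G)"
    have "continuous_on (arr {} (set X) \<times> {..<?N}) (\<lambda>p. chi (fst x) (fst p) * h (snd p) (snd x))"
    proof (intro continuous_on_mult)
      show "continuous_on (arr {} (set X) \<times> {..<?N}) (\<lambda>p. chi (fst x) (fst p))"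
        by (rule continuous_on_compose2[OF continuous_on_chi[OF subset_refl]])
          (auto simp: arr_def ksub_def intro!: continuous_intros)
      show "continuous_on (arr {} (set X) \<times> {..<?N}) (\<lambda>p. h (snd p) (snd x))"
        by (rule continuous_on_compose2[of UNIV "\<lambda>k. h k (snd x)"]) (auto intro!: continuous_intros)
    qed
    then show "continuous_map (tp (arr {} (set X) \<times> {..<?N})) euclidean (\<lambda>p. mk p x)"
      using x by (simp add: mk_def)
  qed
  have "homeomorphic_maps (complement_top G X) (tp (arr {} (set X) \<times> {..<?N})) ?F mk"
    unfolding homeomorphic_maps_def
  proof (intro conjI ballI contF cont_mk)
    fix t assume "t \<in> topspace (complement_top G X)"
    then show "mk (?F t) = t" using mk_zt top compl by auto
  next
    fix p assume "p \<in> topspace (tp (arr {} (set X) \<times> {..<?N}))"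
    then obtain z k where "p = (z, k)" "k < ?N" by auto
    then show "?F (mk p) = p" using zt_mk ct_mk idx_h by simp
  qed
  then show ?thesis unfolding homeomorphic_space_def by blast
qed

text \<open>The argument \<open>(2 * q + 1) / q\<close> makes \<open>x - 1\<close> equal to
  \<open>(1 + q) / q\<close>: of the factor \<open>q ^ n\<close> exactly \<open>q ^ r\<close>
  survives, and \<open>y = 0\<close> supplies the sign. The bounds on \<open>r\<close> make both
  differences of naturals genuine.\<close>

lemma tutte_term:
  fixes q :: real
  assumes "q \<noteq> 0" "r \<le> n" "r \<le> c"
  shows "q ^ n * (((2 * q + 1) / q - 1) ^ (n - r) * (0 - 1) ^ (c - r)) = (-1) ^ c * (- q) ^ r * (1 + q) ^ (n - r)"
proof -
  obtain k where n: "n = r + k" using assms(2) le_Suc_ex by blast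
  obtain m where c: "c = r + m" using assms(3) le_Suc_ex by blast
  have "(2 * q + 1) / q - 1 = (1 + q) / q" using assms(1) by (simp add: field_simps)
  then have "q ^ k * ((2 * q + 1) / q - 1) ^ k = (1 + q) ^ k"
    using assms(1) by (simp add: power_divide)
  then have "q ^ n * (((2 * q + 1) / q - 1) ^ (n - r) * (0 - 1) ^ (c - r)) = q ^ r * (1 + q) ^ k * (-1) ^ m"
    by (simp add: n c power_add)
  moreover have "(-1) ^ c * (- q) ^ r = (-1) ^ m * q ^ r"
  proof -
    have "(-1) ^ c * (- q) ^ r = (-1) ^ m * (((-1) * (- q)) ^ r)"
      unfolding c power_add power_mult_distrib by (simp only: mult.commute mult.left_commute)
    then show ?thesis by simp
  qed
  ultimately show ?thesis by (simp add: n)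
qed

theorem theorem5p11:
  fixes G :: "('g, 'b) monoid_scheme" and X :: "(int ^ 'n) list"
  assumes "comm_group G" and "finite (carrier G)"
    and "\<forall>a\<in>set X. a \<noteq> 0"
    and "finite (rcosets\<^bsub>Lat\<^esub> (generate Lat (set X)))"
  shows "finite {k. betti k (complement_top G X) \<noteq> 0}
    \<and> (\<forall>q::real. q \<noteq> 0 \<longrightarrow>
         (\<Sum>k\<in>{k. betti k (complement_top G X) \<noteq> 0}. real (betti k (complement_top G X)) * q ^ k)
           = q ^ CARD('n) * arith_tutte G X ((2 * q + 1) / q) 0)"
proof -
  let ?T = "complement_top G X" and ?N = "card (carrier G)" and ?n = "CARD('n)"
  \<comment> \<open>With no relations imposed the rank of \<open>B\<close> is 0 and the kernel is
    the whole complex torus.\<close>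
  obtain P where P: "has_poincare (arr {} (set X)) P" and
    P_eval: "\<And>q. poly P q = (\<Sum>S\<in>Pow {..<length X}. (-1) ^ card S * (-q) ^ rk (sub X S) * poly (pksub (sub X S)) q)"
    using has_poincare_arr[of "{}" X] by (auto simp: rk_def)
  define R where "R = of_nat ?N * P"
  have R: "has_poincare (arr {} (set X) \<times> {..<?N}) R"
    using has_poincare_times_finite[of "{..<?N}", OF _ P] by (simp add: R_def)
  have betti: "real (betti k ?T) = Polynomial.coeff R k" for k
  proof -
    obtain r where r: "has_rank (hm (int k) (arr {} (set X) \<times> {..<?N}) {}) r" "real r = Polynomial.coeff R k"
      using R unfolding has_poincare_def by (metis nat_int of_nat_0_le_iff not_less)
    have "hm (int k) (arr {} (set X) \<times> {..<?N}) {} \<cong> homology_group (int k) ?T"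
      using homeomorphic_space_imp_isomorphic_homology_groups complement_homeomorphic[OF assms(1,2)]
        homeomorphic_space_sym by blast
    then have "has_rank (homology_group (int k) ?T) r"
      by (rule has_rank_is_iso) (simp_all add: r(1))
    then have "betti k ?T = r"
      unfolding betti_def by (intro comm_group.group_rank_eq) simp_all
    then show ?thesis using r(2) by simp
  qed
  then have nz: "betti k ?T \<noteq> 0 \<longleftrightarrow> Polynomial.coeff R k \<noteq> 0" for k by (metis of_nat_eq_0_iff)
  \<comment> \<open>The degree of \<open>R\<close> bounds the nonzero Betti numbers, so their
    generating sum is a finite one and evaluates \<open>R\<close>.\<close>
  have sub: "{k. betti k ?T \<noteq> 0} \<subseteq> {..Polynomial.degree R}"
    unfolding nz by (auto intro: Polynomial.le_degree)
  have "(\<Sum>k\<in>{k. betti k ?T \<noteq> 0}. real (betti k ?T) * q ^ k) = q ^ ?n * arith_tutte G X ((2 * q + 1) / q) 0"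
    if q: "q \<noteq> 0" for q
  proof -
    have "(\<Sum>k\<in>{k. betti k ?T \<noteq> 0}. real (betti k ?T) * q ^ k) = poly R q"
      unfolding poly_altdef betti nz
      by (rule sum.mono_neutral_left) (auto intro: Polynomial.le_degree)
    also have "\<dots> = (\<Sum>S\<in>Pow {..<length X}. real (mult_A G (sub X S)) *
        ((-1) ^ card S * (-q) ^ rk (sub X S) * (1 + q) ^ (?n - rk (sub X S))))"
      unfolding R_def poly_mult P_eval sum_distrib_left
      by (intro sum.cong) (simp_all add: pksub_def mult_A_eq[OF assms(1)] add.commute)
    also have "\<dots> = (\<Sum>S\<in>Pow {..<length X}. real (mult_A G (sub X S)) *
        (q ^ ?n * (((2 * q + 1) / q - 1) ^ (?n - rk (sub X S)) * (0 - 1) ^ (card S - rk (sub X S)))))"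
    proof (rule sum.cong[OF refl])
      fix S assume "S \<in> Pow {..<length X}"
      then have "finite S" using finite_subset by auto
      have "rk (sub X S) \<le> card (realv ` sub X S)"
        unfolding rk_def by (intro dim_le_card') (simp add: sub_def \<open>finite S\<close>)
      also have "\<dots> \<le> card S"
        unfolding sub_def image_image by (rule card_image_le[OF \<open>finite S\<close>])
      finally have "rk (sub X S) \<le> card S" .
      then show "real (mult_A G (sub X S)) * ((-1) ^ card S * (-q) ^ rk (sub X S) * (1 + q) ^ (?n - rk (sub X S))) =
         real (mult_A G (sub X S)) *
        (q ^ ?n * (((2 * q + 1) / q - 1) ^ (?n - rk (sub X S)) * (0 - 1) ^ (card S - rk (sub X S))))"
        using tutte_term[OF q rk_le[of "sub X S"]] by simp
    qed
    \<comment> \<open>Finite index enters here: it identifies \<open>rk (set X)\<close> with the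
      dimension.\<close>
    also have "\<dots> = q ^ ?n * arith_tutte G X ((2 * q + 1) / q) 0"
      unfolding arith_tutte_def finite_zspan_index_full[OF finite_set assms(4)] sum_distrib_left
      by (intro sum.cong) (simp_all add: mult_ac)
    finally show ?thesis .
  qed
  then show ?thesis using finite_subset[OF sub] by blast
qed

end
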